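(* Let $d\ge 1$ and let $0<\alpha<d+2$ if $d\ge2$, and $\alpha\in(0,1]\cup[2,3)$ if $d=1$. Let $0<\lambda<1$, $c_W>0$ and $$W(x)=c_{d,\alpha}|x|^{\alpha-d}+\frac{|x|^2}{2}-c_W\sum_{k=1}^\infty\lambda^{(\alpha-d)k}\exp\Big(-\frac{|x|^2}{2\lambda^{2k}}\Big),\qquad c_{d,\alpha}=\frac{\Gamma((d-\alpha)/2)}{\pi^{d/2}2^\alpha\Gamma(\alpha/2)}.$$ There exist constants $c(d,\alpha)$ and $C(d,\alpha)$, namely $$c(d,\alpha)=\alpha^{-\alpha/2}e^{\alpha/2}(2\pi)^{-d/2},\qquad C(d,\alpha)=\Big(\frac{e}{d+2-\alpha}\Big)^{(d+2-\alpha)/2}c_{d,\alpha}(d-\alpha),$$ such that the following hold. 1. If $c_W>c(d,\alpha)$, then there are $c_1,C_1>0$ such that: (a) $W(r)\le C_1(1+r)^2$; (b) the distribution $\hat W$ is a function on any compact set inside $\mathbb{R}^d\setminus\{0\}$; (c) for every $R\ge1$ there exists an interval $J\subseteq\mathbb{R}_+$ with $|J|=R$ such that $\hat W(\xi)<-c_1R^{-\alpha}$ for all $|\xi|\in J$. It follows that $W$ is infinitesimal-concave. 2. If $c_W<C(d,\alpha)$, then for all sufficiently small $\lambda$ (depending on $d$, $\alpha$ and $C(d,\alpha)-c_W$), $W$ is repulsive for short distances and attractive for long distances: there exists $R_W>0$ such that $W'(r)<0$ for all $0<r<R_W$ and $W'(r)>0$ for all $r>R_W$.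
   Context: $W$ is radial and is also written $W(r)$, $r=|x|$; $W'$ is the radial derivative. When $\alpha=d$, the convention is $c_{d,\alpha}|x|^{\alpha-d}:=-\frac{2}{\pi^{d/2}2^\alpha\Gamma(\alpha/2)}\ln|x|$, and $c_{d,\alpha}(d-\alpha)$ is understood as its limiting value $\frac{2}{\pi^{d/2}2^d\Gamma(d/2)}$. Fourier transform: $\hat f(\xi)=\int f(x)e^{-ix\cdot\xi}dx$, extended to tempered distributions. $E[\mu]=\frac12\int\int W(x-y)\mu(y)\mu(x)\,dy\,dx$. $W$ is linear-interpolation-concave with size $\delta$ if there is a nonzero $\mu\in L^\infty(\mathbb{R}^d)$ with $\int\mu\,dx=0$, $\operatorname{diam}(\operatorname{supp}\mu)\le\delta$ and $E[\mu]<0$. $W$ is infinitesimal-concave if this holds for every $\delta>0$.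
   Formalization: In 1(a) the bound W(r) ≤ C_1(1+r)^2 is stated for all r ≥ 1, and for all r > 0 only when α > d; for α ≤ d and small λ, W is unbounded above as r → 0, so the bound for all r > 0 fails. *)

theory Defs
  imports "HOL-Analysis.Analysis"
begin

section \<open>The potential\<close>

text \<open>
  The space is an arbitrary Euclidean space \<open>'a::euclidean_space\<close>; its dimension
  \<open>DIM('a)\<close>, which is at least 1, plays the role of \<open>d\<close>.
\<close>

definition riesz_const :: "nat \<Rightarrow> real \<Rightarrow> real" where
  "riesz_const d \<alpha> =
     Gamma ((real d - \<alpha>) / 2) / (pi powr (real d / 2) * 2 powr \<alpha> * Gamma (\<alpha> / 2))"

text \<open>
  At \<open>\<alpha> = d\<close> the Gamma function in \<^const>\<open>riesz_const\<close> has a pole, so \<open>c\<^sub>d\<^sub>,\<^sub>\<alpha> |x|\<^sup>\<alpha>\<^sup>-\<^sup>d\<close> is by convention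
  logarithmic and \<open>c\<^sub>d\<^sub>,\<^sub>\<alpha> (d - \<alpha>)\<close> is its limit.
\<close>

definition riesz_kernel :: "nat \<Rightarrow> real \<Rightarrow> real \<Rightarrow> real" where
  "riesz_kernel d \<alpha> r =
     (if \<alpha> = real d
      then - (2 / (pi powr (real d / 2) * 2 powr \<alpha> * Gamma (\<alpha> / 2))) * ln r
      else riesz_const d \<alpha> * r powr (\<alpha> - real d))"

definition riesz_const_mult :: "nat \<Rightarrow> real \<Rightarrow> real" where
  "riesz_const_mult d \<alpha> =
     (if \<alpha> = real d
      then 2 / (pi powr (real d / 2) * 2 powr (real d) * Gamma (real d / 2))
      else riesz_const d \<alpha> * (real d - \<alpha>))"

text \<open>
  Only \<open>r > 0\<close> is meaningful: for \<open>\<alpha> \<le> d\<close> the kernel is singular at \<open>0\<close> and the series diverges there,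
  and the value at \<open>0\<close> is then an artefact of totality (on a Lebesgue null set of the space).
  For \<open>r > 0\<close> the series converges. The index \<open>k \<ge> 1\<close> of the series is \<open>Suc j\<close>.
\<close>

definition W_radial :: "nat \<Rightarrow> real \<Rightarrow> real \<Rightarrow> real \<Rightarrow> real \<Rightarrow> real" where
  "W_radial d \<alpha> lam cW r =
     riesz_kernel d \<alpha> r + r\<^sup>2 / 2
     - cW * (\<Sum>j. lam powr ((\<alpha> - real d) * real (Suc j)) * exp (- (r\<^sup>2 / (2 * lam ^ (2 * Suc j)))))"

definition W_potential :: "real \<Rightarrow> real \<Rightarrow> real \<Rightarrow> 'a::euclidean_space \<Rightarrow> real" where
  "W_potential \<alpha> lam cW x = W_radial DIM('a) \<alpha> lam cW (norm x)"

definition c_lower :: "nat \<Rightarrow> real \<Rightarrow> real" where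
  "c_lower d \<alpha> = \<alpha> powr (- \<alpha> / 2) * exp (\<alpha> / 2) * (2 * pi) powr (- real d / 2)"

definition C_upper :: "nat \<Rightarrow> real \<Rightarrow> real" where
  "C_upper d \<alpha> =
     (exp 1 / (real d + 2 - \<alpha>)) powr ((real d + 2 - \<alpha>) / 2) * riesz_const_mult d \<alpha>"


section \<open>Schwartz functions and tempered distributions\<close>

definition partial_deriv :: "'a::euclidean_space \<Rightarrow> ('a \<Rightarrow> complex) \<Rightarrow> 'a \<Rightarrow> complex" where
  "partial_deriv b f x = frechet_derivative f (at x) b"

text \<open>A multi-index is a list of basis vectors, so the set of all lists covers all mixed partials.\<close>

definition iter_partial :: "'a::euclidean_space list \<Rightarrow> ('a \<Rightarrow> complex) \<Rightarrow> 'a \<Rightarrow> complex" where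
  "iter_partial bs f = foldr partial_deriv bs f"

text \<open>Differentiability of all iterated partials makes them all continuous, i.e. \<open>f\<close> is \<open>C\<^sup>\<infinity>\<close>.\<close>

definition smooth :: "('a::euclidean_space \<Rightarrow> complex) \<Rightarrow> bool" where
  "smooth f \<longleftrightarrow> (\<forall>bs. set bs \<subseteq> Basis \<longrightarrow> iter_partial bs f differentiable_on UNIV)"

definition schwartz :: "('a::euclidean_space \<Rightarrow> complex) \<Rightarrow> bool" where
  "schwartz f \<longleftrightarrow> smooth f \<and>
     (\<forall>bs n. set bs \<subseteq> Basis \<longrightarrow>
        bounded (range (\<lambda>x. (1 + norm x) ^ n *\<^sub>R iter_partial bs f x)))"

definition schwartz_seminorm :: "nat \<Rightarrow> ('a::euclidean_space \<Rightarrow> complex) \<Rightarrow> real" where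
  "schwartz_seminorm N f =
     (\<Sum>bs | set bs \<subseteq> Basis \<and> length bs \<le> N. SUP x. (1 + norm x) ^ N * cmod (iter_partial bs f x))"

text \<open>Functionals are total on functions, but only their values on Schwartz functions matter.\<close>

definition tempered_distribution :: "(('a::euclidean_space \<Rightarrow> complex) \<Rightarrow> complex) \<Rightarrow> bool" where
  "tempered_distribution T \<longleftrightarrow>
     (\<forall>f g. schwartz f \<longrightarrow> schwartz g \<longrightarrow> T (\<lambda>x. f x + g x) = T f + T g) \<and>
     (\<forall>c f. schwartz f \<longrightarrow> T (\<lambda>x. c * f x) = c * T f) \<and>
     (\<exists>N C. \<forall>f. schwartz f \<longrightarrow> cmod (T f) \<le> C * schwartz_seminorm N f)"

definition function_dist :: "('a::euclidean_space \<Rightarrow> real) \<Rightarrow> ('a \<Rightarrow> complex) \<Rightarrow> complex" where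
  "function_dist f = (\<lambda>\<phi>. LINT x|lborel. complex_of_real (f x) * \<phi> x)"

text \<open>The integrability clause excludes the default value \<open>0\<close> of divergent integrals.\<close>

definition tempered_function :: "('a::euclidean_space \<Rightarrow> real) \<Rightarrow> bool" where
  "tempered_function f \<longleftrightarrow>
     (\<forall>\<phi>. schwartz \<phi> \<longrightarrow> integrable lborel (\<lambda>x. complex_of_real (f x) * \<phi> x)) \<and>
     tempered_distribution (function_dist f)"

definition fourier :: "('a::euclidean_space \<Rightarrow> complex) \<Rightarrow> 'a \<Rightarrow> complex" where
  "fourier f \<xi> = (LINT x|lborel. f x * exp (- \<i> * complex_of_real (x \<bullet> \<xi>)))"

definition fourier_dist ::
    "(('a::euclidean_space \<Rightarrow> complex) \<Rightarrow> complex) \<Rightarrow> ('a \<Rightarrow> complex) \<Rightarrow> complex" where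
  "fourier_dist T = (\<lambda>\<phi>. T (fourier \<phi>))"

definition is_function_on ::
    "(('a::euclidean_space \<Rightarrow> complex) \<Rightarrow> complex) \<Rightarrow> ('a \<Rightarrow> real) \<Rightarrow> 'a set \<Rightarrow> bool" where
  "is_function_on T g K \<longleftrightarrow>
     set_integrable lborel K g \<and>
     (\<forall>\<phi>. smooth \<phi> \<longrightarrow> closure {x. \<phi> x \<noteq> 0} \<subseteq> K \<longrightarrow>
        T \<phi> = (LINT x:K|lborel. complex_of_real (g x) * \<phi> x))"


section \<open>Interaction energy and concavity\<close>

definition energy :: "('a::euclidean_space \<Rightarrow> real) \<Rightarrow> ('a \<Rightarrow> real) \<Rightarrow> real" where
  "energy W \<mu> = 1 / 2 * (LINT x|lborel. LINT y|lborel. W (x - y) * \<mu> y * \<mu> x)"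

definition L_infinity :: "('a::euclidean_space \<Rightarrow> real) \<Rightarrow> bool" where
  "L_infinity \<mu> \<longleftrightarrow> \<mu> \<in> borel_measurable lborel \<and> (\<exists>M. AE x in lborel. \<bar>\<mu> x\<bar> \<le> M)"

text \<open>The support of an almost-everywhere class: the complement of the largest open null set.\<close>

definition ess_support :: "('a::euclidean_space \<Rightarrow> real) \<Rightarrow> 'a set" where
  "ess_support \<mu> = {x. \<forall>\<epsilon>>0. \<not> (AE y in lborel. y \<in> ball x \<epsilon> \<longrightarrow> \<mu> y = 0)}"

text \<open>Boundedness is explicit because \<^const>\<open>diameter\<close> of an unbounded set is unspecified.\<close>

definition lin_interp_concave :: "('a::euclidean_space \<Rightarrow> real) \<Rightarrow> real \<Rightarrow> bool" where
  "lin_interp_concave W \<delta> \<longleftrightarrow>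
     (\<exists>\<mu>. L_infinity \<mu> \<and> \<not> (AE x in lborel. \<mu> x = 0) \<and>
          (LINT x|lborel. \<mu> x) = 0 \<and>
          bounded (ess_support \<mu>) \<and> diameter (ess_support \<mu>) \<le> \<delta> \<and>
          energy W \<mu> < 0)"

definition infinitesimal_concave :: "('a::euclidean_space \<Rightarrow> real) \<Rightarrow> bool" where
  "infinitesimal_concave W \<longleftrightarrow> (\<forall>\<delta>>0. lin_interp_concave W \<delta>)"

end

theory Submission
  imports Defs "HOL-Probability.Probability" "HOL-Real_Asymp.Real_Asymp"
begin

text \<open>
  Write \<open>d\<close> for the dimension and \<open>p = (d - \<alpha>) / 2\<close>, so that \<open>-1 < p < d / 2\<close>. The Riesz kernel, the
  quadratic term and the series in \<open>W\<close> are all reduced to Gaussians \<open>exp (- t |x|\<^sup>2)\<close>. For a weight \<open>w\<close> put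
  \<open>G t = \<integral> exp (- t |x|\<^sup>2) w x dx\<close>. If \<open>w\<close> is bounded, decays fast enough and has integral \<open>0\<close>, then
  \<open>\<integral> W w\<close> is the sum of a positive multiple of \<open>\<integral>\<^sub>0\<^sup>\<infinity> t\<^sup>p\<^sup>-\<^sup>1 G t dt\<close>, of \<open>\<integral> |x|\<^sup>2 w / 2\<close>, which is minus
  half the derivative of \<open>G\<close> at \<open>0\<close>, and of \<open>- cW\<close> times a combination of the values
  \<open>G (1 / (2 \<lambda>\<^sup>2\<^sup>k))\<close> (\<open>integral_W_potential\<close>). The Riesz part rests on the Frullani integral
  \<open>\<integral>\<^sub>0\<^sup>\<infinity> t\<^sup>p\<^sup>-\<^sup>1 (exp (- a t) - exp (- b t)) dt\<close>, which is finite for every \<open>p > -1\<close> and treats \<open>\<alpha> < d\<close>, the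
  logarithmic case \<open>\<alpha> = d\<close> and \<open>d < \<alpha> < d + 2\<close> alike; the additive constants that it ignores are
  annihilated by \<open>w\<close>.

  Fourier transform. For a test function \<open>\<phi>\<close> supported away from \<open>0\<close> take \<open>w\<close> to be its Fourier transform.
  Then \<open>G t = \<integral> (\<pi> / t)\<^sup>d\<^sup>/\<^sup>2 exp (- |\<xi>|\<^sup>2 / (4 t)) \<phi> \<xi> d\<xi>\<close> decays faster than any power of \<open>t\<close> as \<open>t\<close> tends
  to \<open>0\<close>. Hence \<open>w\<close> has vanishing integral and vanishing second moment, the quadratic term disappears, and
  a Gamma integral in \<open>t\<close> identifies the transform of \<open>W\<close> off the origin as
  \<open>|\<xi>|\<^sup>-\<^sup>\<alpha> - cW (2 \<pi>)\<^sup>d\<^sup>/\<^sup>2 \<Sum>\<^sub>k \<lambda>\<^sup>\<alpha>\<^sup>k exp (- \<lambda>\<^sup>2\<^sup>k |\<xi>|\<^sup>2 / 2)\<close> (\<open>is_function_on_W_hat\<close>). With \<open>v = \<lambda>\<^sup>k |\<xi>|\<close> this is at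
  most \<open>|\<xi>|\<^sup>-\<^sup>\<alpha> (1 - cW (2 \<pi>)\<^sup>d\<^sup>/\<^sup>2 v\<^sup>\<alpha> exp (- v\<^sup>2 / 2))\<close> for every \<open>k\<close>. The bracket is smallest at
  \<open>v = \<surd>\<alpha>\<close>, and it is negative there exactly when \<open>cW > c(d, \<alpha>)\<close>. So the transform is negative on a dilated
  copy of a fixed interval for each \<open>k\<close>, and dilations by powers of \<open>1 / \<lambda>\<close> make these intervals as long
  as desired (\<open>W_hat_negative_on_intervals\<close>).

  Concavity. The energy of \<open>\<mu>\<close> is half the integral of \<open>W\<close> against the autocorrelation of \<open>\<mu>\<close>, for which
  \<open>G\<close> is nonnegative. Only a single term of the series is therefore kept, and the quadratic term has the right
  sign. By homogeneity it suffices to find one compactly supported \<open>\<mu>\<close> of mean \<open>0\<close> with negative energy for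
  the Riesz kernel minus the single Gaussian \<open>cW exp (- |x|\<^sup>2 / 2)\<close>: its dilations by powers of \<open>\<lambda>\<close> have
  arbitrarily small support and negative energy for \<open>W\<close>. A wide Gaussian times \<open>sin (x \<bullet> \<xi>)\<close> with
  \<open>|\<xi>|\<^sup>2 = \<alpha>\<close> has this property, because its spectrum concentrates where the transform of that kernel is
  negative, and truncation preserves it (\<open>compactly_supported_negative_energy\<close>).

  Shape. With \<open>\<beta> = d + 2 - \<alpha>\<close> and \<open>h u = u\<^sup>\<beta> exp (- u\<^sup>2 / 2)\<close>, the slope \<open>W' r\<close> has the sign of
  \<open>r\<^sup>\<beta> + cW \<Sum>\<^sub>k h (r / \<lambda>\<^sup>k) - C\<close> with \<open>C = c\<^sub>d\<^sub>,\<^sub>\<alpha> (d - \<alpha>)\<close>. The maximum of \<open>h\<close> is such that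
  \<open>cW < C(d, \<alpha>)\<close> means \<open>cW max h < C\<close>. For small \<open>\<lambda>\<close> at most one term of the sum is close to \<open>max h\<close> and the
  others are negligible, so the expression is negative for small \<open>r\<close>. Beyond that range the sum varies much
  less than \<open>r\<^sup>\<beta>\<close>, the expression is strictly increasing, and its sign changes exactly once
  (\<open>reduced_slope_sign_change\<close>).
\<close>

section \<open>One-dimensional integrals and inequalities\<close>

definition mellin_weight :: "real \<Rightarrow> real \<Rightarrow> real" where
  "mellin_weight p t = indicator {0<..} t * t powr (p - 1)"

lemma mellin_weight_nonneg [simp]: "0 \<le> mellin_weight p t"
  by (simp add: mellin_weight_def)

lemma measurable_mellin_weight [measurable]: "mellin_weight p \<in> borel_measurable borel"
  unfolding mellin_weight_def [abs_def] by measurable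

lemma Gamma_has_bochner_integral:
  fixes a s :: real
  assumes a: "0 < a" and s: "0 < s"
  shows "has_bochner_integral lborel (\<lambda>t. mellin_weight a t * exp (- (s * t))) (Gamma a * s powr (- a))"
proof -
  define f where "f = (\<lambda>t. mellin_weight a t * exp (- t))"
  have "(\<integral>\<^sup>+t. ennreal (f t) \<partial>lborel) = (\<integral>\<^sup>+t. ennreal (indicator {0..} t * t powr (a - 1) / exp t) \<partial>lborel)"
    by (intro nn_integral_cong) (auto simp: f_def mellin_weight_def indicator_def exp_minus field_simps)
  also have "\<dots> = Gamma a"
    using Gamma_conv_nn_integral_real[OF a] by simp
  finally have *: "has_bochner_integral lborel f (Gamma a)"
    using a Gamma_real_pos[OF a] by (intro has_bochner_integral_nn_integral) (auto simp: f_def)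
  have "has_bochner_integral lborel (\<lambda>t. f (0 + s * t)) (Gamma a /\<^sub>R \<bar>s\<bar>)"
    using * s by (subst lborel_has_bochner_integral_real_affine_iff[symmetric]) auto
  then have "has_bochner_integral lborel (\<lambda>t. s powr (1 - a) * f (0 + s * t)) (s powr (1 - a) * (Gamma a /\<^sub>R \<bar>s\<bar>))"
    by (intro has_bochner_integral_mult_right)
  moreover have "s powr (1 - a) * f (0 + s * t) = mellin_weight a t * exp (- (s * t))" for t
    using s by (auto simp: f_def mellin_weight_def indicator_def powr_mult powr_diff zero_less_mult_iff)
  moreover have "s powr (1 - a) * (Gamma a /\<^sub>R \<bar>s\<bar>) = Gamma a * s powr (- a)"
    using s by (simp add: powr_diff powr_minus field_simps)
  ultimately show ?thesis by (simp only:)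
qed

text \<open>
  The Gamma integral after the substitution \<open>t \<mapsto> 1 / t\<close>. In this form it integrates Gaussians that
  depend on the inverse of \<open>t\<close>, as Fourier transforms of Gaussians do.
\<close>

lemma inverse_Gamma_has_bochner_integral:
  fixes a s :: real
  assumes a: "0 < a" and s: "0 < s"
  shows "has_bochner_integral lborel (\<lambda>t. mellin_weight (- a) t * exp (- (s / t))) (Gamma a * s powr (- a))"
proof -
  define f where "f = (\<lambda>t. mellin_weight a t * exp (- (s * t)))"
  define g where "g = (\<lambda>t. mellin_weight (- a) t * exp (- (s / t)))"
  have [measurable]: "f \<in> borel_measurable borel" "g \<in> borel_measurable borel"
    unfolding f_def g_def by measurable
  have *: "has_bochner_integral lborel f (Gamma a * s powr (- a))"
    unfolding f_def by (rule Gamma_has_bochner_integral[OF a s])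
  have supp: "(\<lambda>t. indicator {0<..} t * f t) = f" "(\<lambda>t. indicator {0<..} t * g t) = g"
    by (auto simp: indicator_def f_def g_def mellin_weight_def fun_eq_iff)
  have "f absolutely_integrable_on {0<..}"
    using * by (simp add: set_integrable_def supp has_bochner_integral_iff integrable_completion)
  moreover have "integral {0<..} f = Gamma a * s powr (- a)"
    using * calculation by (simp add: set_lebesgue_integral_eq_integral(2)[symmetric] set_lebesgue_integral_def supp
       has_bochner_integral_iff integral_completion)
  moreover have "inverse ` {0<..} = {0::real<..}"
  proof -
    have "x \<in> inverse ` {0<..}" if "0 < x" for x :: real
      using that by (intro image_eqI[of _ _ "inverse x"]) auto
    then show ?thesis by auto
  qed
  ultimately have "(\<lambda>t. \<bar>- inverse (t\<^sup>2)\<bar> * f (inverse t)) absolutely_integrable_on {0<..} \<and>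
     integral {0<..} (\<lambda>t. \<bar>- inverse (t\<^sup>2)\<bar> * f (inverse t)) = Gamma a * s powr (- a)"
    by (subst has_absolute_integral_change_of_variables_1')
       (auto intro!: derivative_eq_intros simp: inj_on_def power2_eq_square)
  moreover have "\<bar>- inverse (t\<^sup>2)\<bar> * f (inverse t) = g t" if "t \<in> {0<..}" for t
    using that by (auto simp: f_def g_def mellin_weight_def powr_minus powr_diff powr_divide inverse_eq_divide
        power2_eq_square field_simps powr_add)
  ultimately have g: "g absolutely_integrable_on {0<..}" "integral {0<..} g = Gamma a * s powr (- a)"
    using set_integrable_cong[of lebesgue lebesgue "{0<..}" "{0<..}" "\<lambda>t. \<bar>- inverse (t\<^sup>2)\<bar> * f (inverse t)" g]
      Henstock_Kurzweil_Integration.integral_cong[of "{0<..}" "\<lambda>t. \<bar>- inverse (t\<^sup>2)\<bar> * f (inverse t)" g]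
    by metis+
  have "integrable lborel g"
    using g(1) by (simp add: set_integrable_def supp integrable_completion)
  moreover have "integral\<^sup>L lborel g = Gamma a * s powr (- a)"
    using set_lebesgue_integral_eq_integral(2)[OF g(1)] g(2)
    by (simp add: set_lebesgue_integral_def supp integral_completion)
  ultimately show ?thesis
    by (simp add: has_bochner_integral_iff g_def)
qed

text \<open>
  A primitive of \<open>s \<mapsto> s\<^sup>-\<^sup>p\<^sup>-\<^sup>1\<close>. The Riesz kernel is a constant multiple of its value at the squared
  radius, and the logarithmic case is built in.
\<close>

definition power_primitive :: "real \<Rightarrow> real \<Rightarrow> real" where
  "power_primitive p s = (if p = 0 then ln s else - (s powr (- p)) / p)"

lemma power_primitive_deriv:
  "0 < s \<Longrightarrow> (power_primitive p has_real_derivative s powr (- p - 1)) (at s)"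
  by (cases "p = 0")
     (auto simp: power_primitive_def [abs_def] powr_minus powr_diff field_simps intro!: derivative_eq_intros)

lemma power_primitive_mono:
  assumes "0 < a" "a \<le> b"
  shows "power_primitive p a \<le> power_primitive p b"
proof (rule DERIV_nonneg_imp_nondecreasing[OF assms(2)])
  fix x assume "a \<le> x" "x \<le> b"
  then show "\<exists>y. (power_primitive p has_real_derivative y) (at x) \<and> 0 \<le> y"
    using power_primitive_deriv[of x p] assms by (intro exI[of _ "x powr (- p - 1)"]) auto
qed

lemma measurable_power_primitive [measurable]: "power_primitive p \<in> borel_measurable borel"
  unfolding power_primitive_def [abs_def] by measurable

text \<open>
  Write \<open>exp (- a t) - exp (- b t)\<close> as \<open>\<integral>\<^sub>a\<^sup>b t exp (- s t) ds\<close> and exchange the integrals: the inner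
  integral in \<open>t\<close> is then \<open>\<Gamma>(p + 1) s\<^sup>-\<^sup>p\<^sup>-\<^sup>1\<close>. For \<open>a \<le> b\<close> everything is nonnegative, so that Tonelli applies.
\<close>

lemma Frullani_has_bochner_integral_ordered:
  assumes p: "-1 < p" and a: "0 < a" and ab: "a \<le> b"
  shows "has_bochner_integral lborel (\<lambda>t. mellin_weight p t * (exp (- (a * t)) - exp (- (b * t))))
     (Gamma (p + 1) * (power_primitive p b - power_primitive p a))"
proof (rule has_bochner_integral_nn_integral)
  define F where "F = (\<lambda>t s. mellin_weight (p + 1) t * exp (- (s * t)) * indicator {a..b} s)"
  have [measurable]: "case_prod F \<in> borel_measurable (lborel \<Otimes>\<^sub>M lborel)"
    unfolding F_def by measurable
  have inner_s: "(\<integral>\<^sup>+s. ennreal (F t s) \<partial>lborel) =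
      ennreal (mellin_weight p t * (exp (- (a * t)) - exp (- (b * t))))" for t
  proof (cases "0 < t")
    case True
    have "(\<integral>\<^sup>+s. ennreal (F t s) \<partial>lborel) =
        (\<integral>\<^sup>+s. ennreal (mellin_weight (p + 1) t * exp (- (s * t))) * indicator {a..b} s \<partial>lborel)"
      by (intro nn_integral_cong) (auto simp: F_def indicator_def)
    also have "\<dots> = ennreal ((\<lambda>s. - (mellin_weight p t * exp (- (s * t)))) b - (\<lambda>s. - (mellin_weight p t * exp (- (s * t)))) a)"
      using True ab
      by (intro nn_integral_FTC_Icc)
         (auto intro!: derivative_eq_intros simp: mellin_weight_def powr_diff)
    finally show ?thesis by (simp add: algebra_simps)
  qed (auto simp: F_def mellin_weight_def)
  have inner_t: "(\<integral>\<^sup>+t. ennreal (F t s) \<partial>lborel) =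
      ennreal (Gamma (p + 1) * s powr (- p - 1)) * indicator {a..b} s" for s
  proof (cases "s \<in> {a..b}")
    case True
    then have "has_bochner_integral lborel (\<lambda>t. mellin_weight (p + 1) t * exp (- (s * t))) (Gamma (p + 1) * s powr (- (p + 1)))"
      using p a by (intro Gamma_has_bochner_integral) auto
    then have "(\<integral>\<^sup>+t. ennreal (mellin_weight (p + 1) t * exp (- (s * t))) \<partial>lborel) = Gamma (p + 1) * s powr (- (p + 1))"
      by (subst nn_integral_eq_integral) (auto simp: has_bochner_integral_iff)
    with True show ?thesis by (simp add: F_def)
  qed (auto simp: F_def)
  have "(\<integral>\<^sup>+t. ennreal (mellin_weight p t * (exp (- (a * t)) - exp (- (b * t)))) \<partial>lborel)
      = (\<integral>\<^sup>+t. \<integral>\<^sup>+s. ennreal (F t s) \<partial>lborel \<partial>lborel)"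
    by (simp add: inner_s)
  also have "\<dots> = (\<integral>\<^sup>+s. \<integral>\<^sup>+t. ennreal (F t s) \<partial>lborel \<partial>lborel)"
    by (rule lborel_pair.Fubini') measurable
  also have "\<dots> = (\<integral>\<^sup>+s. ennreal (Gamma (p + 1) * s powr (- p - 1)) * indicator {a..b} s \<partial>lborel)"
    by (simp add: inner_t)
  also have "\<dots> = ennreal (Gamma (p + 1) * power_primitive p b - Gamma (p + 1) * power_primitive p a)"
    using p a ab Gamma_real_pos[of "p + 1"]
    by (intro nn_integral_FTC_Icc) (auto intro!: DERIV_cmult power_primitive_deriv)
  finally show "(\<integral>\<^sup>+t. ennreal (mellin_weight p t * (exp (- (a * t)) - exp (- (b * t)))) \<partial>lborel)
     = ennreal (Gamma (p + 1) * (power_primitive p b - power_primitive p a))"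
    by (simp add: algebra_simps)
  show "AE t in lborel. 0 \<le> mellin_weight p t * (exp (- (a * t)) - exp (- (b * t)))"
    using ab by (intro AE_I2) (auto simp: mellin_weight_def indicator_def)
  show "0 \<le> Gamma (p + 1) * (power_primitive p b - power_primitive p a)"
    using p power_primitive_mono[OF a ab] Gamma_real_pos[of "p + 1"] by simp
qed measurable

lemma Frullani_has_bochner_integral:
  assumes p: "-1 < p" and a: "0 < a" and b: "0 < b"
  shows "has_bochner_integral lborel (\<lambda>t. mellin_weight p t * (exp (- (a * t)) - exp (- (b * t))))
     (Gamma (p + 1) * (power_primitive p b - power_primitive p a))"
proof (cases "a \<le> b")
  case False
  then have "has_bochner_integral lborel (\<lambda>t. - (mellin_weight p t * (exp (- (b * t)) - exp (- (a * t)))))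
     (- (Gamma (p + 1) * (power_primitive p a - power_primitive p b)))"
    using Frullani_has_bochner_integral_ordered[OF p b, of a] by (intro has_bochner_integral_minus) auto
  then show ?thesis by (simp add: algebra_simps)
qed (use Frullani_has_bochner_integral_ordered[OF p a] in auto)

lemma mellin_weight_times_powr:
  "mellin_weight p t * (pi / t) powr h = pi powr h * mellin_weight (- (h - p)) t"
proof (cases "0 < t")
  case True
  have "t powr (p - 1) / t powr h = t powr (- (h - p) - 1)"
    by (simp add: powr_diff[symmetric] algebra_simps)
  then show ?thesis
    using True by (simp add: mellin_weight_def powr_divide mult.commute[of "pi powr h"] flip: times_divide_eq_left)
qed (simp add: mellin_weight_def)

text \<open>
  A dominating function for \<open>t\<^sup>p\<^sup>-\<^sup>1 N t\<close> when \<open>N t\<close> is \<open>O(t)\<close> at \<open>0\<close> and, up to an exponentially small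
  term, \<open>O(t\<^sup>-\<^sup>h)\<close> at infinity. Both summands are Gamma integrands; the factors \<open>exp 1\<close> compensate for
  \<open>exp (- t) \<ge> exp (- 1)\<close> on \<open>t \<le> 1\<close> and \<open>exp (- 1 / t) \<ge> exp (- 1)\<close> on \<open>t \<ge> 1\<close>.
\<close>

definition mellin_majorant :: "real \<Rightarrow> real \<Rightarrow> real \<Rightarrow> real \<Rightarrow> real \<Rightarrow> real" where
  "mellin_majorant p h B C t = (exp 1 + 1) * C * (mellin_weight (p + 1) t * exp (- (1 * t)))
     + exp 1 * B * pi powr h * (mellin_weight (- (h - p)) t * exp (- (1 / t)))"

lemma integrable_mellin_majorant:
  assumes "-1 < p" "p < h"
  shows "integrable lborel (mellin_majorant p h B C)"
  unfolding mellin_majorant_def [abs_def]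
  using assms Gamma_has_bochner_integral[of "p + 1" 1] inverse_Gamma_has_bochner_integral[of "h - p" 1]
  by (intro Bochner_Integration.integrable_add integrable_mult_right) (auto simp: has_bochner_integral_iff)

lemma mellin_weight_times_le_majorant:
  assumes B: "0 \<le> B" and C: "0 \<le> C"
    and small: "0 < t \<Longrightarrow> N \<le> C * t" and large: "0 < t \<Longrightarrow> N \<le> B * (pi / t) powr h + exp (- t) * C"
  shows "mellin_weight p t * N \<le> mellin_majorant p h B C t"
proof (cases "0 < t")
  case t: True
  show ?thesis
  proof (cases "t \<le> 1")
    case True
    have "mellin_weight p t * N \<le> mellin_weight p t * (C * t)"
      using small[OF t] by (intro mult_left_mono) auto
    also have "\<dots> = C * mellin_weight (p + 1) t * 1"
      using t by (simp add: mellin_weight_def powr_diff)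
    also have "\<dots> \<le> C * mellin_weight (p + 1) t * (exp 1 * exp (- t))"
      using True C by (intro mult_left_mono) (auto simp flip: exp_add)
    also have "\<dots> \<le> (exp 1 + 1) * C * (mellin_weight (p + 1) t * exp (- (1 * t)))"
      using C by (simp add: algebra_simps)
    also have "\<dots> \<le> mellin_majorant p h B C t" using B by (simp add: mellin_majorant_def)
    finally show ?thesis .
  next
    case False
    have "mellin_weight p t * N \<le> mellin_weight p t * (B * (pi / t) powr h + exp (- t) * C)"
      using large[OF t] by (intro mult_left_mono) auto
    also have "\<dots> = B * (mellin_weight p t * (pi / t) powr h) + C * (mellin_weight p t * exp (- t))"
      by (simp add: algebra_simps)
    also have "\<dots> = B * pi powr h * mellin_weight (- (h - p)) t * 1 + C * (mellin_weight p t * exp (- t))"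
      unfolding mellin_weight_times_powr by simp
    also have "\<dots> \<le> B * pi powr h * mellin_weight (- (h - p)) t * (exp 1 * exp (- (1 / t)))
        + C * (mellin_weight (p + 1) t * exp (- t))"
      using t False B C
      by (intro add_mono mult_left_mono mult_right_mono) (auto simp: mellin_weight_def intro!: powr_mono simp flip: exp_add)
    also have "\<dots> \<le> mellin_majorant p h B C t" using B C by (simp add: mellin_majorant_def algebra_simps)
    finally show ?thesis .
  qed
qed (auto simp: mellin_weight_def mellin_majorant_def)

text \<open>
  The bound is the maximum, attained at \<open>u = \<surd>p\<close>; it follows from \<open>ln y \<le> y - 1\<close> at \<open>y = u\<^sup>2 / p\<close>.
  Both thresholds of the theorem are instances of this maximum.
\<close>

lemma powr_times_gaussian_le:
  fixes p u :: real
  assumes p: "0 < p" and u: "0 < u"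
  shows "u powr p * exp (- (u\<^sup>2 / 2)) \<le> p powr (p / 2) * exp (- (p / 2))"
proof -
  have "ln (u\<^sup>2 / p) \<le> u\<^sup>2 / p - 1"
    using p u by (intro ln_le_minus_one) auto
  then have "ln (u\<^sup>2 / p) * (p / 2) \<le> (u\<^sup>2 / p - 1) * (p / 2)"
    using p by (intro mult_right_mono) auto
  moreover have "ln (u\<^sup>2 / p) = 2 * ln u - ln p"
    using p u by (simp add: ln_div ln_realpow)
  moreover have "(u\<^sup>2 / p - 1) * (p / 2) = u\<^sup>2 / 2 - p / 2"
    using p by (simp add: field_simps)
  moreover have "(2 * ln u - ln p) * (p / 2) = p * ln u - p / 2 * ln p"
    by (simp add: field_simps)
  ultimately have "p * ln u - u\<^sup>2 / 2 \<le> p / 2 * ln p - p / 2"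
    by (simp only:)
  then have "exp (p * ln u + - (u\<^sup>2 / 2)) \<le> exp (p / 2 * ln p + - (p / 2))" by simp
  then show ?thesis
    using p u by (simp only: powr_def exp_add) simp
qed

section \<open>Gaussians in Euclidean space\<close>

abbreviation gaussian :: "real \<Rightarrow> 'a::real_normed_vector \<Rightarrow> real" where
  "gaussian t x \<equiv> exp (- (t * (norm x)\<^sup>2))"

text \<open>
  Lebesgue measure is the image of the product measure on coordinates, so functions of product form
  integrate coordinatewise.
\<close>

lemma
  fixes f :: "'a::euclidean_space \<Rightarrow> real \<Rightarrow> 'b::{real_normed_field,banach,second_countable_topology}"
  assumes f: "\<And>b. b \<in> Basis \<Longrightarrow> integrable lborel (f b)"
  shows integrable_lborel_prod: "integrable lborel (\<lambda>x::'a. \<Prod>b\<in>Basis. f b (x \<bullet> b))"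
    and integral_lborel_prod: "(\<integral>x. (\<Prod>b\<in>Basis. f b (x \<bullet> b)) \<partial>(lborel :: 'a measure)) = (\<Prod>b\<in>Basis. (LINT t|lborel. f b t))"
proof -
  interpret product_sigma_finite "\<lambda>_::'a. lborel :: real measure" ..
  have [measurable]: "b \<in> Basis \<Longrightarrow> f b \<in> borel_measurable borel" for b
    using borel_measurable_integrable[OF f] by simp
  have coord: "(\<Sum>b\<in>Basis. g b *\<^sub>R b) \<bullet> c = g c" if "c \<in> Basis" for g and c :: 'a
    using that by simp
  show "integrable lborel (\<lambda>x::'a. \<Prod>b\<in>Basis. f b (x \<bullet> b))"
    unfolding lborel_eq[where 'a='a] using product_integrable_prod[of Basis f] f
    by (subst integrable_distr_eq) (auto simp: coord)
  show "(\<integral>x. (\<Prod>b\<in>Basis. f b (x \<bullet> b)) \<partial>(lborel :: 'a measure)) = (\<Prod>b\<in>Basis. (LINT t|lborel. f b t))"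
    unfolding lborel_eq[where 'a='a] using product_integral_prod[of Basis f] f
    by (subst integral_distr) (auto simp: coord)
qed

text \<open>
  This is the characteristic function of the standard normal distribution after rescaling.
\<close>

lemma gaussian_fourier_real:
  fixes t \<xi> :: real
  assumes t: "0 < t"
  shows "has_bochner_integral lborel (\<lambda>x. exp (- (t * x\<^sup>2)) *\<^sub>R exp (- \<i> * complex_of_real (x * \<xi>)))
           (complex_of_real (sqrt (pi / t) * exp (- (\<xi>\<^sup>2 / (4 * t)))))"
proof -
  define s where "s = - \<xi> / sqrt (2 * t)"
  have int: "integrable lborel (\<lambda>x. std_normal_density x *\<^sub>R exp (\<i> * complex_of_real (s * x)))"
    using integrable_std_normal_moment[of 0]
    by (rule Bochner_Integration.integrable_bound) (auto simp: normal_density_nonneg)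
  have "complex_of_real (exp (- (s\<^sup>2) / 2)) = char std_normal_distribution s"
    by (simp add: char_std_normal_distribution)
  also have "\<dots> = (LINT x|lborel. std_normal_density x *\<^sub>R exp (\<i> * complex_of_real (s * x)))"
    unfolding char_def by (subst integral_density) (auto simp: normal_density_nonneg)
  finally have "has_bochner_integral lborel (\<lambda>x. std_normal_density x *\<^sub>R exp (\<i> * complex_of_real (s * x)))
      (complex_of_real (exp (- (s\<^sup>2) / 2)))"
    using int by (simp add: has_bochner_integral_iff)
  then have "has_bochner_integral lborel
     (\<lambda>x. std_normal_density (0 + sqrt (2 * t) * x) *\<^sub>R exp (\<i> * complex_of_real (s * (0 + sqrt (2 * t) * x))))
     (complex_of_real (exp (- (s\<^sup>2) / 2)) /\<^sub>R \<bar>sqrt (2 * t)\<bar>)"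
    using t by (subst lborel_has_bochner_integral_real_affine_iff[symmetric]) auto
  then have "has_bochner_integral lborel
     (\<lambda>x. sqrt (2 * pi) *\<^sub>R (std_normal_density (0 + sqrt (2 * t) * x) *\<^sub>R exp (\<i> * complex_of_real (s * (0 + sqrt (2 * t) * x)))))
     (sqrt (2 * pi) *\<^sub>R (complex_of_real (exp (- (s\<^sup>2) / 2)) /\<^sub>R \<bar>sqrt (2 * t)\<bar>))"
    by (intro has_bochner_integral_scaleR_right)
  moreover have "sqrt (2 * pi) *\<^sub>R (std_normal_density (0 + sqrt (2 * t) * x) *\<^sub>R exp (\<i> * complex_of_real (s * (0 + sqrt (2 * t) * x))))
      = exp (- (t * x\<^sup>2)) *\<^sub>R exp (- \<i> * complex_of_real (x * \<xi>))" for x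
  proof -
    have "s * (sqrt (2 * t) * x) = - (x * \<xi>)"
      using t by (simp add: s_def field_simps)
    moreover have "sqrt (2 * pi) * std_normal_density (sqrt (2 * t) * x) = exp (- (t * x\<^sup>2))"
      using t by (simp add: std_normal_density_def power_mult_distrib)
    ultimately show ?thesis by (simp del: of_real_mult)
  qed
  moreover have "sqrt (2 * pi) *\<^sub>R (complex_of_real (exp (- (s\<^sup>2) / 2)) /\<^sub>R \<bar>sqrt (2 * t)\<bar>) =
      complex_of_real (sqrt (pi / t) * exp (- (\<xi>\<^sup>2 / (4 * t))))"
  proof -
    have "s\<^sup>2 / 2 = \<xi>\<^sup>2 / (4 * t)"
      using t by (simp add: s_def power_divide)
    moreover have "sqrt (2 * pi) * (exp r / sqrt (2 * t)) = sqrt (pi / t) * exp r" for r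
      using t by (simp add: real_sqrt_mult real_sqrt_divide)
    moreover have "sqrt (2 * pi) *\<^sub>R (complex_of_real r /\<^sub>R \<bar>sqrt (2 * t)\<bar>) =
        complex_of_real (sqrt (2 * pi) * (r / sqrt (2 * t)))" for r
    proof -
      have "complex_of_real r /\<^sub>R \<bar>sqrt (2 * t)\<bar> = complex_of_real (r / sqrt (2 * t))"
        using t by (simp add: scaleR_conv_of_real divide_inverse)
      then show ?thesis by (simp only: scaleR_conv_of_real of_real_mult)
    qed
    ultimately show ?thesis by (simp only: minus_divide_left[symmetric])
  qed
  ultimately show ?thesis by (simp only:)
qed

lemma norm_power2_eq_sum: "(norm x)\<^sup>2 = (\<Sum>b\<in>Basis. (x \<bullet> b)\<^sup>2)" for x :: "'a::euclidean_space"
  unfolding power2_norm_eq_inner by (subst euclidean_inner) (simp add: power2_eq_square)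

lemma gaussian_fourier:
  fixes t :: real and \<xi> :: "'a::euclidean_space"
  assumes t: "0 < t"
  shows "has_bochner_integral lborel (\<lambda>x. gaussian t x *\<^sub>R exp (- \<i> * complex_of_real (x \<bullet> \<xi>)))
           (complex_of_real ((pi / t) powr (real DIM('a) / 2) * exp (- ((norm \<xi>)\<^sup>2 / (4 * t)))))"
proof -
  define f where "f = (\<lambda>(b::'a) x. exp (- (t * x\<^sup>2)) *\<^sub>R exp (- \<i> * complex_of_real (x * (\<xi> \<bullet> b))))"
  have f: "has_bochner_integral lborel (f b) (complex_of_real (sqrt (pi / t) * exp (- ((\<xi> \<bullet> b)\<^sup>2 / (4 * t)))))" for b
    unfolding f_def by (rule gaussian_fourier_real[OF t])
  then have "has_bochner_integral lborel (\<lambda>x::'a. \<Prod>b\<in>Basis. f b (x \<bullet> b))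
       (\<Prod>b\<in>Basis. complex_of_real (sqrt (pi / t) * exp (- ((\<xi> \<bullet> b)\<^sup>2 / (4 * t)))))"
    using integrable_lborel_prod[of f] integral_lborel_prod[of f] by (auto simp: has_bochner_integral_iff)
  moreover have "(\<Prod>b\<in>Basis. f b (x \<bullet> b)) = gaussian t x *\<^sub>R exp (- \<i> * complex_of_real (x \<bullet> \<xi>))" for x
  proof -
    have "gaussian t x = (\<Prod>b\<in>Basis. exp (- (t * (x \<bullet> b)\<^sup>2)))"
      by (simp add: exp_sum[symmetric] norm_power2_eq_sum sum_negf sum_distrib_left)
    moreover have "exp (- \<i> * complex_of_real (x \<bullet> \<xi>)) = (\<Prod>b\<in>Basis. exp (- \<i> * complex_of_real ((x \<bullet> b) * (\<xi> \<bullet> b))))"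
      by (simp add: exp_sum[symmetric] sum_negf sum_distrib_left euclidean_inner[of x \<xi>])
    ultimately show ?thesis
      by (simp add: f_def scaleR_conv_of_real prod.distrib)
  qed
  moreover have "(\<Prod>b\<in>Basis. complex_of_real (sqrt (pi / t) * exp (- ((\<xi> \<bullet> b)\<^sup>2 / (4 * t))))) =
      complex_of_real ((pi / t) powr (real DIM('a) / 2) * exp (- ((norm \<xi>)\<^sup>2 / (4 * t))))"
  proof -
    have "exp (- ((norm \<xi>)\<^sup>2 / (4 * t))) = (\<Prod>b\<in>Basis. exp (- ((\<xi> \<bullet> b)\<^sup>2 / (4 * t))))"
      by (simp add: exp_sum[symmetric] norm_power2_eq_sum sum_negf sum_divide_distrib)
    moreover have "(pi / t) powr (real DIM('a) / 2) = sqrt (pi / t) ^ DIM('a)"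
      using t by (simp add: powr_half_sqrt[symmetric] powr_powr powr_realpow[symmetric])
    ultimately show ?thesis
      by (simp add: prod.distrib)
  qed
  ultimately show ?thesis by (simp only:)
qed

lemma gaussian_integral:
  fixes t :: real
  assumes t: "0 < t"
  shows "has_bochner_integral lborel (\<lambda>x::'a::euclidean_space. gaussian t x) ((pi / t) powr (real DIM('a) / 2))"
  using has_bochner_integral_Re[OF gaussian_fourier[OF t, of "0::'a"]] by simp

lemma gaussian_cos_integral:
  fixes t :: real and \<xi> :: "'a::euclidean_space"
  assumes t: "0 < t"
  shows "has_bochner_integral lborel (\<lambda>x. gaussian t x * cos (x \<bullet> \<xi>))
           ((pi / t) powr (real DIM('a) / 2) * exp (- ((norm \<xi>)\<^sup>2 / (4 * t))))"
  using has_bochner_integral_Re[OF gaussian_fourier[OF t, of \<xi>]] by (simp add: Re_exp)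

lemma integrable_gaussian [intro]:
  "0 < t \<Longrightarrow> integrable lborel (\<lambda>x::'a::euclidean_space. gaussian t x)"
  using gaussian_integral[of t] by (auto simp: has_bochner_integral_iff)

lemma prod_ge_power_norm:
  fixes x :: "'a::euclidean_space"
  shows "(\<Prod>b\<in>Basis. 1 + (x \<bullet> b)\<^sup>2) \<le> (1 + (norm x)\<^sup>2) ^ DIM('a)"
proof -
  have "(\<Prod>b\<in>Basis. 1 + (x \<bullet> b)\<^sup>2) \<le> (\<Prod>b\<in>(Basis::'a set). 1 + (norm x)\<^sup>2)"
  proof (rule prod_mono)
    fix b :: 'a assume "b \<in> Basis"
    then have "\<bar>x \<bullet> b\<bar>\<^sup>2 \<le> (norm x)\<^sup>2"
      by (intro power_mono Basis_le_norm) auto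
    then show "0 \<le> 1 + (x \<bullet> b)\<^sup>2 \<and> 1 + (x \<bullet> b)\<^sup>2 \<le> 1 + (norm x)\<^sup>2" by auto
  qed
  then show ?thesis by simp
qed

text \<open>
  The product of \<open>1 / (1 + x\<^sub>b\<^sup>2)\<close> over the coordinates is integrable and dominates.
\<close>

lemma integrable_inverse_power_norm:
  assumes N: "DIM('a) \<le> N"
  shows "integrable lborel (\<lambda>x::'a::euclidean_space. inverse ((1 + (norm x)\<^sup>2) ^ N))"
proof (rule Bochner_Integration.integrable_bound)
  have "integrable lborel (\<lambda>x::real. inverse (1 + x\<^sup>2))"
    using integrable_inverse_1_plus_square by (simp add: set_integrable_def)
  then show "integrable lborel (\<lambda>x::'a. \<Prod>b\<in>Basis. inverse (1 + (x \<bullet> b)\<^sup>2))"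
    by (intro integrable_lborel_prod)
  show "AE x in lborel. norm (inverse ((1 + (norm (x::'a))\<^sup>2) ^ N)) \<le> norm (\<Prod>b\<in>Basis. inverse (1 + (x \<bullet> b)\<^sup>2))"
  proof (intro AE_I2)
    fix x :: 'a
    have pos: "0 < (\<Prod>b\<in>Basis. 1 + (x \<bullet> b)\<^sup>2)" by (intro prod_pos) (auto intro: add_pos_nonneg)
    have "(\<Prod>b\<in>Basis. 1 + (x \<bullet> b)\<^sup>2) \<le> (1 + (norm x)\<^sup>2) ^ DIM('a)" by (rule prod_ge_power_norm)
    also have "\<dots> \<le> (1 + (norm x)\<^sup>2) ^ N" using N by (intro power_increasing) auto
    finally have "inverse ((1 + (norm x)\<^sup>2) ^ N) \<le> inverse (\<Prod>b\<in>Basis. 1 + (x \<bullet> b)\<^sup>2)"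
      using pos by (intro le_imp_inverse_le)
    also have "\<dots> = (\<Prod>b\<in>Basis. inverse (1 + (x \<bullet> b)\<^sup>2))"
      by (simp add: prod_inversef[symmetric])
    finally show "norm (inverse ((1 + (norm x)\<^sup>2) ^ N)) \<le> norm (\<Prod>b\<in>Basis. inverse (1 + (x \<bullet> b)\<^sup>2))"
      by (auto simp: abs_of_nonneg intro!: order_trans[OF _ abs_ge_self])
  qed
qed simp

section \<open>Riesz kernels as mixtures of Gaussians\<close>

text \<open>
  The weights against which \<open>W\<close> can be integrated: boundedness controls the Riesz singularity and
  the singularity of the series at the origin, the second moment controls the growth at infinity.
  Schwartz functions, Fourier transforms of test functions and autocorrelations are moderate.
\<close>

definition moderate :: "('a::euclidean_space \<Rightarrow> 'b::{banach,second_countable_topology}) \<Rightarrow> bool" where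
  "moderate w \<longleftrightarrow> w \<in> borel_measurable borel \<and> (\<exists>B. \<forall>x. norm (w x) \<le> B) \<and>
     integrable lborel (\<lambda>x. (1 + (norm x)\<^sup>2) *\<^sub>R w x)"

definition gauss_avg :: "real \<Rightarrow> ('a::euclidean_space \<Rightarrow> 'b::{banach,second_countable_topology}) \<Rightarrow> 'b" where
  "gauss_avg t w = (LINT x|lborel. gaussian t x *\<^sub>R w x)"

lemma moderate_integrable_bound:
  assumes w: "moderate w" and [measurable]: "f \<in> borel_measurable borel"
    and f: "\<And>x. \<bar>f x\<bar> \<le> C * (1 + (norm x)\<^sup>2)"
  shows "integrable lborel (\<lambda>x. f x *\<^sub>R w x)"
proof (rule Bochner_Integration.integrable_bound)
  have [measurable]: "w \<in> borel_measurable borel" using w by (simp add: moderate_def)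
  show "integrable lborel (\<lambda>x. C *\<^sub>R ((1 + (norm x)\<^sup>2) *\<^sub>R w x))"
    using w by (intro integrable_scaleR_right) (simp add: moderate_def)
  show "AE x in lborel. norm (f x *\<^sub>R w x) \<le> norm (C *\<^sub>R ((1 + (norm x)\<^sup>2) *\<^sub>R w x))"
  proof (intro AE_I2)
    fix x
    have "\<bar>f x\<bar> \<le> \<bar>C\<bar> * \<bar>1 + (norm x)\<^sup>2\<bar>"
      using f[of x] by (metis abs_ge_self abs_mult order_trans)
    from mult_right_mono[OF this norm_ge_zero[of "w x"]]
    show "norm (f x *\<^sub>R w x) \<le> norm (C *\<^sub>R ((1 + (norm x)\<^sup>2) *\<^sub>R w x))"
      by (simp add: mult.assoc abs_mult)
  qed
  show "(\<lambda>x. f x *\<^sub>R w x) \<in> borel_measurable lborel" by measurable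
qed

lemma moderate_integrable: "moderate w \<Longrightarrow> integrable lborel w"
  using moderate_integrable_bound[of w "\<lambda>_. 1" 1] by simp

lemma moderate_integrable_norm2: "moderate w \<Longrightarrow> integrable lborel (\<lambda>x. (norm x)\<^sup>2 *\<^sub>R w x)"
  by (rule moderate_integrable_bound[where C = 1]) auto

lemma moderate_integrable_exp: "moderate w \<Longrightarrow> 0 \<le> t \<Longrightarrow> integrable lborel (\<lambda>x. gaussian t x *\<^sub>R w x)"
  by (rule moderate_integrable_bound[where C = 1]) (auto intro: order_trans[of _ 1])

text \<open>
  The integral in \<open>x\<close> of the absolute value of the integrand, without the factor \<open>t\<^sup>p\<^sup>-\<^sup>1\<close>, is \<open>O(t)\<close> for small
  \<open>t\<close>, by the second moment of \<open>w\<close>, and \<open>O(t\<^sup>-\<^sup>d\<^sup>/\<^sup>2)\<close> up to an exponentially small term for large \<open>t\<close>, by the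
  boundedness of \<open>w\<close>. These are the two regimes of the Mellin majorant.
\<close>

lemma integrable_gaussian_mixture:
  fixes w :: "'a::euclidean_space \<Rightarrow> 'b::{banach,second_countable_topology}"
  assumes w: "moderate w" and p: "-1 < p" "p < real DIM('a) / 2"
  shows "integrable (lborel \<Otimes>\<^sub>M lborel)
           (\<lambda>(t, x). (mellin_weight p t * (gaussian t x - exp (- t))) *\<^sub>R w x)"
proof -
  have [measurable]: "w \<in> borel_measurable borel" using w by (simp add: moderate_def)
  obtain B where B: "\<And>x. norm (w x) \<le> B" using w by (auto simp: moderate_def)
  then have B0: "0 \<le> B" using norm_ge_zero order_trans by blast
  define I where "I = (LINT x|lborel. (1 + (norm x)\<^sup>2) * norm (w x))"
  define F where "F = (\<lambda>(t, x). (mellin_weight p t * (gaussian t x - exp (- t))) *\<^sub>R w x)"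
  define N where "N = (\<lambda>t. LINT x|lborel. \<bar>gaussian t x - exp (- t)\<bar> * norm (w x))"
  define D where "D = mellin_majorant p (real DIM('a) / 2) B I"
  have I_int: "integrable lborel (\<lambda>x. (1 + (norm x)\<^sup>2) * norm (w x))"
  proof -
    have "integrable lborel (\<lambda>x. (1 + (norm x)\<^sup>2) *\<^sub>R w x)" using w by (simp add: moderate_def)
    from integrable_norm[OF this] show ?thesis by (simp add: abs_of_nonneg)
  qed
  have I0: "0 \<le> I" unfolding I_def by (intro integral_nonneg_AE) auto
  have diff: "\<bar>exp (- a) - exp (- b)\<bar> \<le> a + b" if "0 \<le> a" "0 \<le> b" for a b :: real
    using that exp_ge_add_one_self[of "- a"] exp_ge_add_one_self[of "- b"] exp_le_one_iff[of "- a"] exp_le_one_iff[of "- b"]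
    by linarith
  have le: "\<bar>gaussian t x - exp (- t)\<bar> \<le> t * (1 + (norm x)\<^sup>2)" if "0 < t" for t and x :: 'a
    using that diff[of "t * (norm x)\<^sup>2" t] by (simp add: algebra_simps)
  have int: "integrable lborel (\<lambda>x. \<bar>gaussian t x - exp (- t)\<bar> * norm (w x))" if "0 < t" for t
  proof (rule Bochner_Integration.integrable_bound)
    show "integrable lborel (\<lambda>x. t * ((1 + (norm x)\<^sup>2) * norm (w x)))" using I_int by auto
    show "AE x in lborel. norm (\<bar>gaussian t x - exp (- t)\<bar> * norm (w x)) \<le> norm (t * ((1 + (norm x)\<^sup>2) * norm (w x)))"
    proof (intro AE_I2)
      fix x :: 'a
      have "\<bar>gaussian t x - exp (- t)\<bar> * norm (w x) \<le> (t * (1 + (norm x)\<^sup>2)) * norm (w x)"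
        by (rule mult_right_mono[OF le[OF that]]) simp
      then show "norm (\<bar>gaussian t x - exp (- t)\<bar> * norm (w x)) \<le> norm (t * ((1 + (norm x)\<^sup>2) * norm (w x)))"
        using that by (simp add: abs_mult mult.assoc)
    qed
  qed measurable
  have small: "N t \<le> t * I" if t: "0 < t" for t
  proof -
    have "N t \<le> (LINT x|lborel. t * ((1 + (norm x)\<^sup>2) * norm (w x)))"
      unfolding N_def
    proof (intro integral_mono int t integrable_mult_right I_int)
      fix x :: 'a
      show "\<bar>gaussian t x - exp (- t)\<bar> * norm (w x) \<le> t * ((1 + (norm x)\<^sup>2) * norm (w x))"
        using mult_right_mono[OF le[OF t] norm_ge_zero[of "w x"], of x] by (simp only: mult.assoc)
    qed
    then show ?thesis by (simp add: I_def)
  qed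
  have large: "N t \<le> B * (pi / t) powr (real DIM('a) / 2) + exp (- t) * I" if t: "0 < t" for t
  proof -
    have gi: "integrable lborel (\<lambda>x::'a. gaussian t x)" using t by auto
    have "N t \<le> (LINT x|lborel. B * gaussian t (x::'a) + exp (- t) * ((1 + (norm x)\<^sup>2) * norm (w x)))"
      unfolding N_def
    proof (intro integral_mono int t Bochner_Integration.integrable_add integrable_mult_right gi I_int)
      fix x :: 'a
      have "\<bar>gaussian t x - exp (- t)\<bar> * norm (w x) \<le> (gaussian t x + exp (- t)) * norm (w x)"
        by (intro mult_right_mono) (auto simp: abs_if)
      also have "\<dots> \<le> B * gaussian t x + exp (- t) * ((1 + (norm x)\<^sup>2) * norm (w x))"
      proof -
        have 1: "gaussian t x * norm (w x) \<le> B * gaussian t x"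
          using B[of x] by simp
        have 2: "exp (- t) * norm (w x) \<le> exp (- t) * ((1 + (norm x)\<^sup>2) * norm (w x))"
          by (simp add: distrib_right)
        show ?thesis unfolding distrib_right[of "gaussian t x"] by (rule add_mono[OF 1 2])
      qed
      finally show "\<bar>gaussian t x - exp (- t)\<bar> * norm (w x) \<le>
          B * gaussian t x + exp (- t) * ((1 + (norm x)\<^sup>2) * norm (w x))" .
    qed
    also have "\<dots> = B * (pi / t) powr (real DIM('a) / 2) + exp (- t) * I"
      using t gi I_int gaussian_integral[of t, where 'a='a]
      by (simp add: I_def has_bochner_integral_iff)
    finally show ?thesis .
  qed
  have N0: "0 \<le> N t" for t unfolding N_def by (intro integral_nonneg_AE) auto
  have bound: "mellin_weight p t * N t \<le> D t" for t
    unfolding D_def using small[of t] large[of t] by (intro mellin_weight_times_le_majorant B0 I0) (simp_all only: mult.commute)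
  have D_int: "integrable lborel D"
    unfolding D_def using p by (rule integrable_mellin_majorant)
  have F_norm: "norm (F (t, x)) = mellin_weight p t * (\<bar>gaussian t x - exp (- t)\<bar> * norm (w x))" for t x
    by (simp add: F_def abs_mult)
  have [measurable]: "F \<in> borel_measurable (lborel \<Otimes>\<^sub>M lborel)"
    unfolding F_def by measurable
  have "integrable (lborel \<Otimes>\<^sub>M lborel) F"
  proof (rule lborel_pair.Fubini_integrable)
    show "integrable lborel (\<lambda>t. LINT x|lborel. norm (F (t, x)))"
    proof (rule Bochner_Integration.integrable_bound[OF D_int])
      show "AE t in lborel. norm (LINT x|lborel. norm (F (t, x))) \<le> norm (D t)"
      proof (intro AE_I2)
        fix t
        have "(LINT x|lborel. norm (F (t, x))) = mellin_weight p t * N t"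
          by (simp add: F_norm N_def)
        then show "norm (LINT x|lborel. norm (F (t, x))) \<le> norm (D t)"
          using bound[of t] N0[of t] by (simp add: abs_mult)
      qed
    qed measurable
    show "AE t in lborel. integrable lborel (\<lambda>x. F (t, x))"
    proof (intro AE_I2)
      fix t show "integrable lborel (\<lambda>x. F (t, x))"
      proof (cases "0 < t")
        case True
        from int[OF this] have "integrable lborel (\<lambda>x. norm (F (t, x)))" unfolding F_norm by auto
        then show ?thesis by (subst (asm) integrable_norm_iff) auto
      qed (simp add: F_def mellin_weight_def)
    qed
  qed measurable
  then show ?thesis by (simp add: F_def)
qed

text \<open>
  Fubini for the mixture: integration in \<open>t\<close> first gives the kernel by the Frullani integral,
  integration in \<open>x\<close> first gives the Gaussian averages.
\<close>

lemma
  fixes w :: "'a::euclidean_space \<Rightarrow> 'b::{banach,second_countable_topology}"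
  assumes w: "moderate w" and p: "-1 < p" "p < real DIM('a) / 2"
  shows integrable_power_primitive: "integrable lborel (\<lambda>x. power_primitive p ((norm x)\<^sup>2) *\<^sub>R w x)"
    and integral_power_primitive: "integral\<^sup>L lborel w = 0 \<Longrightarrow>
      (LINT x|lborel. power_primitive p ((norm x)\<^sup>2) *\<^sub>R w x) =
      - ((LINT t|lborel. mellin_weight p t *\<^sub>R gauss_avg t w) /\<^sub>R Gamma (p + 1))"
proof -
  have [measurable]: "w \<in> borel_measurable borel" using w by (simp add: moderate_def)
  define F where "F = (\<lambda>(t, x). (mellin_weight p t * (gaussian t x - exp (- t))) *\<^sub>R w x)"
  have F: "integrable (lborel \<Otimes>\<^sub>M lborel) F"
    unfolding F_def by (rule integrable_gaussian_mixture[OF assms])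
  have G0: "0 < Gamma (p + 1)" using p by (intro Gamma_real_pos) auto
  have inner: "(LINT t|lborel. F (t, x)) = Gamma (p + 1) *\<^sub>R ((power_primitive p 1 - power_primitive p ((norm x)\<^sup>2)) *\<^sub>R w x)"
    if "x \<noteq> 0" for x
    using Frullani_has_bochner_integral[of p "(norm x)\<^sup>2" 1] p that
    by (auto simp: F_def has_bochner_integral_iff mult.commute[of _ "(norm x)\<^sup>2"])
  have AE: "AE x in lborel. (LINT t|lborel. F (t, x)) = Gamma (p + 1) *\<^sub>R ((power_primitive p 1 - power_primitive p ((norm x)\<^sup>2)) *\<^sub>R w x)"
    using AE_lborel_singleton[of "0::'a"] by eventually_elim (rule inner)
  have "integrable lborel (\<lambda>x. LINT t|lborel. F (t, x))"
    using lborel_pair.integrable_snd[of "curry F"] F by simp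
  note this [THEN borel_measurable_integrable, measurable] this
  then have "integrable lborel (\<lambda>x. Gamma (p + 1) *\<^sub>R ((power_primitive p 1 - power_primitive p ((norm x)\<^sup>2)) *\<^sub>R w x))"
    using AE by (subst (asm) integrable_cong_AE) auto
  then have "integrable lborel (\<lambda>x. (power_primitive p 1 - power_primitive p ((norm x)\<^sup>2)) *\<^sub>R w x)"
    using G0 integrable_scaleR_right[of "inverse (Gamma (p + 1))" lborel
        "\<lambda>x. Gamma (p + 1) *\<^sub>R ((power_primitive p 1 - power_primitive p ((norm x)\<^sup>2)) *\<^sub>R w x)"]
    by (simp add: mult.assoc[symmetric])
  then have "integrable lborel (\<lambda>x. power_primitive p 1 *\<^sub>R w x - (power_primitive p 1 - power_primitive p ((norm x)\<^sup>2)) *\<^sub>R w x)"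
    using moderate_integrable[OF w] by auto
  then show int: "integrable lborel (\<lambda>x. power_primitive p ((norm x)\<^sup>2) *\<^sub>R w x)"
    by (simp add: algebra_simps)
  assume w0: "integral\<^sup>L lborel w = 0"
  have outer: "(LINT x|lborel. F (t, x)) = mellin_weight p t *\<^sub>R gauss_avg t w" for t
  proof (cases "0 < t")
    case True
    have "(LINT x|lborel. F (t, x)) = mellin_weight p t *\<^sub>R (LINT x|lborel. gaussian t x *\<^sub>R w x - exp (- t) *\<^sub>R w x)"
      by (simp add: F_def flip: integral_scaleR_right scaleR_diff_left)
    also have "\<dots> = mellin_weight p t *\<^sub>R gauss_avg t w"
      using True w0 moderate_integrable_exp[OF w, of t] moderate_integrable[OF w]
      by (subst Bochner_Integration.integral_diff) (auto simp: gauss_avg_def)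
    finally show ?thesis .
  qed (simp add: F_def mellin_weight_def)
  have "(LINT t|lborel. mellin_weight p t *\<^sub>R gauss_avg t w) = (LINT x|lborel. LINT t|lborel. F (t, x))"
    using lborel_pair.Fubini_integral[of "curry F"] F by (simp add: outer)
  also have "\<dots> = (LINT x|lborel. Gamma (p + 1) *\<^sub>R ((power_primitive p 1 - power_primitive p ((norm x)\<^sup>2)) *\<^sub>R w x))"
    using AE by (intro integral_cong_AE) auto
  also have "\<dots> = Gamma (p + 1) *\<^sub>R (LINT x|lborel. power_primitive p 1 *\<^sub>R w x - power_primitive p ((norm x)\<^sup>2) *\<^sub>R w x)"
    by (simp only: integral_scaleR_right scaleR_diff_left)
  also have "\<dots> = - (Gamma (p + 1) *\<^sub>R (LINT x|lborel. power_primitive p ((norm x)\<^sup>2) *\<^sub>R w x))"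
    using int moderate_integrable[OF w] w0 by (subst Bochner_Integration.integral_diff) auto
  finally show "(LINT x|lborel. power_primitive p ((norm x)\<^sup>2) *\<^sub>R w x) =
      - ((LINT t|lborel. mellin_weight p t *\<^sub>R gauss_avg t w) /\<^sub>R Gamma (p + 1))"
    using G0 by simp
qed

section \<open>The potential as a tempered function\<close>

text \<open>
  The normalization of the Riesz kernel without its numerator \<open>\<Gamma>((d - \<alpha>) / 2)\<close>, which has a pole at
  \<open>\<alpha> = d\<close>.
\<close>

definition riesz_norm :: "nat \<Rightarrow> real \<Rightarrow> real" where
  "riesz_norm d \<alpha> = 1 / (pi powr (real d / 2) * 2 powr \<alpha> * Gamma (\<alpha> / 2))"

lemma Gamma_shift:
  assumes "-1 < p" "p \<noteq> (0::real)"
  shows "Gamma (p + 1) = p * Gamma p"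
proof (rule Gamma_plus1)
  show "p \<notin> \<int>\<^sub>\<le>\<^sub>0"
  proof
    assume "p \<in> \<int>\<^sub>\<le>\<^sub>0"
    then obtain n where "p = of_int n" "n \<le> 0" by (auto elim!: nonpos_Ints_cases)
    with assms show False by auto
  qed
qed

text \<open>
  The three regimes of \<open>\<alpha>\<close> have a common formula, since \<open>\<Gamma>(p + 1) = p \<Gamma>(p)\<close> turns the pole of
  \<open>\<Gamma>(p)\<close> into the \<open>1 / p\<close> of the primitive.
\<close>

lemma riesz_kernel_eq:
  assumes \<alpha>: "\<alpha> < real d + 2" and r: "0 < r"
  shows "riesz_kernel d \<alpha> r =
    - (riesz_norm d \<alpha> * Gamma ((real d - \<alpha>) / 2 + 1) * power_primitive ((real d - \<alpha>) / 2) (r\<^sup>2))"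
proof (cases "\<alpha> = real d")
  case True
  then show ?thesis using r by (simp add: riesz_kernel_def riesz_norm_def power_primitive_def ln_realpow)
next
  case False
  define p where "p = (real d - \<alpha>) / 2"
  have p: "-1 < p" "p \<noteq> 0" using \<alpha> False by (auto simp: p_def)
  have "(r\<^sup>2) powr (- p) = r powr (\<alpha> - real d)"
  proof -
    have "(r\<^sup>2) powr (- p) = (r powr 2) powr (- p)" using r by simp
    also have "\<dots> = r powr (2 * - p)" by (rule powr_powr)
    also have "2 * - p = \<alpha> - real d" by (simp add: p_def field_simps)
    finally show ?thesis .
  qed
  then show ?thesis
    using False p by (simp add: riesz_kernel_def riesz_norm_def riesz_const_def power_primitive_def Gamma_shift flip: p_def)
qed

lemma riesz_const_mult_eq:
  assumes \<alpha>: "\<alpha> < real d + 2"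
  shows "riesz_const_mult d \<alpha> = 2 * riesz_norm d \<alpha> * Gamma ((real d - \<alpha>) / 2 + 1)"
proof (cases "\<alpha> = real d")
  case True
  then show ?thesis by (simp add: riesz_const_mult_def riesz_norm_def)
next
  case False
  define p where "p = (real d - \<alpha>) / 2"
  have p: "-1 < p" "p \<noteq> 0" "real d - \<alpha> = 2 * p" using \<alpha> False by (auto simp: p_def)
  show ?thesis
    using False p by (simp add: riesz_const_mult_def riesz_const_def riesz_norm_def Gamma_shift flip: p_def)
qed

abbreviation gauss_term :: "real \<Rightarrow> real \<Rightarrow> real \<Rightarrow> nat \<Rightarrow> real" where
  "gauss_term lam q r j \<equiv> lam powr (q * real (Suc j)) * exp (- (r\<^sup>2 / (2 * lam ^ (2 * Suc j))))"

definition gauss_series :: "real \<Rightarrow> real \<Rightarrow> real \<Rightarrow> real" where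
  "gauss_series lam q r = (\<Sum>j. gauss_term lam q r j)"

lemma W_radial_eq: "W_radial d \<alpha> lam cW r = riesz_kernel d \<alpha> r + r\<^sup>2 / 2 - cW * gauss_series lam (\<alpha> - real d) r"
  by (simp add: W_radial_def gauss_series_def)

text \<open>
  Trading the Gaussian for the power \<open>r\<^sup>-\<^sup>P\<close> raises the exponent of \<open>lam\<close> by \<open>P\<close>. With \<open>P\<close> large this makes
  the series converge at every \<open>r > 0\<close>, whatever the sign of \<open>q\<close>.
\<close>

lemma gauss_series_term_le:
  assumes lam: "0 < lam" "lam < 1" and r: "0 < r" and P: "0 < P"
  shows "gauss_term lam q r j \<le>
    P powr (P / 2) * exp (- (P / 2)) * r powr (- P) * lam powr ((q + P) * real (Suc j))"
proof -
  define u where "u = r / lam ^ Suc j"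
  have u: "0 < u" using lam r by (simp add: u_def)
  have "r\<^sup>2 / (2 * lam ^ (2 * Suc j)) = u\<^sup>2 / 2"
  proof -
    have "(lam ^ Suc j)\<^sup>2 = lam ^ (2 * Suc j)" by (simp only: power_mult[symmetric] mult.commute)
    then show ?thesis by (simp add: u_def power_divide del: power_Suc)
  qed
  moreover have "exp (- (u\<^sup>2 / 2)) \<le> P powr (P / 2) * exp (- (P / 2)) * u powr (- P)"
    using powr_times_gaussian_le[OF P u] u by (simp add: powr_minus field_simps)
  moreover have "u powr (- P) = r powr (- P) * lam powr (P * real (Suc j))"
  proof -
    have "(lam ^ Suc j) powr P = lam powr (P * real (Suc j))"
      using lam by (simp only: powr_realpow[symmetric] powr_powr mult.commute)
    then show ?thesis
      using lam r by (simp add: u_def powr_divide powr_minus_divide del: power_Suc of_nat_Suc)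
  qed
  ultimately have "gauss_term lam q r j \<le>
     lam powr (q * real (Suc j)) * (P powr (P / 2) * exp (- (P / 2)) * (r powr (- P) * lam powr (P * real (Suc j))))"
    by (intro mult_left_mono) (simp_all only: powr_ge_zero)
  then show ?thesis by (simp add: distrib_right powr_add mult_ac)
qed

lemma summable_powr_Suc:
  fixes lam :: real
  assumes lam: "0 < lam" "lam < 1" and b: "0 < b"
  shows "summable (\<lambda>j. lam powr (b * real (Suc j)))"
proof -
  have "lam powr (b * real (Suc j)) = (lam powr b) ^ Suc j" for j
    using lam by (simp add: powr_powr[symmetric] powr_realpow[symmetric] del: of_nat_Suc power_Suc)
  moreover have "lam powr b < 1"
    using powr_less_mono2[of b lam 1] lam b by simp
  ultimately show ?thesis
    using lam by (simp only: summable_Suc_iff) (rule summable_geometric, simp)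
qed

lemma gauss_series_summable:
  assumes lam: "0 < lam" "lam < 1" and r: "0 < r"
  shows "summable (\<lambda>j. gauss_term lam q r j)"
proof (rule summable_comparison_test')
  \<comment> \<open>Any P > max 0 (- q) gives a convergent geometric majorant.\<close>
  define P where "P = \<bar>q\<bar> + 1"
  show "summable (\<lambda>j. P powr (P / 2) * exp (- (P / 2)) * r powr (- P) * lam powr ((q + P) * real (Suc j)))"
    by (intro summable_mult summable_powr_Suc lam) (auto simp: P_def)
  show "norm (gauss_term lam q r j) \<le>
      P powr (P / 2) * exp (- (P / 2)) * r powr (- P) * lam powr ((q + P) * real (Suc j))" for j
    using gauss_series_term_le[OF lam r, of P q j] by (simp add: P_def)
qed

lemma gauss_series_nonneg: "0 < lam \<Longrightarrow> lam < 1 \<Longrightarrow> 0 < r \<Longrightarrow> 0 \<le> gauss_series lam q r"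
  unfolding gauss_series_def by (intro suminf_nonneg gauss_series_summable) auto

definition gauss_rate :: "real \<Rightarrow> nat \<Rightarrow> real" where
  "gauss_rate lam j = 1 / (2 * lam ^ (2 * Suc j))"

lemma gauss_rate_pos: "0 < lam \<Longrightarrow> 0 < gauss_rate lam j"
  by (simp add: gauss_rate_def)

text \<open>
  The \<open>L\<^sup>1\<close> norm of the \<open>k\<close>-th term of the series is a constant times \<open>lam\<^sup>\<alpha>\<^sup>k\<close>, and for \<open>\<alpha> > 0\<close> these norms
  are summable.
\<close>

lemma gauss_rate_pi_powr:
  assumes lam: "0 < lam"
  shows "lam powr ((\<alpha> - d) * real (Suc j)) * (pi / gauss_rate lam j) powr (d / 2) =
     (2 * pi) powr (d / 2) * lam powr (\<alpha> * real (Suc j))"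
proof -
  have "(lam ^ (2 * Suc j)) powr (d / 2) = lam powr (d * real (Suc j))"
    using lam by (simp add: powr_powr algebra_simps del: power_Suc flip: powr_realpow)
  moreover have "pi / gauss_rate lam j = (2 * pi) * lam ^ (2 * Suc j)"
    by (simp add: gauss_rate_def)
  ultimately have "(pi / gauss_rate lam j) powr (d / 2) = (2 * pi) powr (d / 2) * lam powr (d * real (Suc j))"
    using lam by (simp add: powr_mult del: power_Suc)
  moreover have "lam powr ((\<alpha> - d) * real (Suc j)) * lam powr (d * real (Suc j)) = lam powr (\<alpha> * real (Suc j))"
    by (simp add: powr_add[symmetric] algebra_simps)
  ultimately show ?thesis by simp
qed

text \<open>
  The series converges in \<open>L\<^sup>1\<close>, so it may be integrated term by term against a bounded weight. At the
  origin it may diverge, hence the statements almost everywhere.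
\<close>

lemma
  fixes w :: "'a::euclidean_space \<Rightarrow> 'b::{banach,second_countable_topology}"
  assumes w: "moderate w" and lam: "0 < lam" "lam < 1" and \<alpha>: "0 < \<alpha>"
  shows integrable_gauss_series: "integrable lborel (\<lambda>x. gauss_series lam (\<alpha> - real DIM('a)) (norm x) *\<^sub>R w x)"
    and gauss_series_sums: "(\<lambda>j. lam powr ((\<alpha> - real DIM('a)) * real (Suc j)) *\<^sub>R gauss_avg (gauss_rate lam j) w)
        sums (LINT x|lborel. gauss_series lam (\<alpha> - real DIM('a)) (norm x) *\<^sub>R w x)"
proof -
  have [measurable]: "w \<in> borel_measurable borel" using w by (simp add: moderate_def)
  obtain B where B: "\<And>x. norm (w x) \<le> B" using w by (auto simp: moderate_def)
  define q where "q = \<alpha> - real DIM('a)"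
  define f where "f = (\<lambda>j x. (gauss_term lam q (norm x) j) *\<^sub>R w x)"
  have f_eq: "f j x = lam powr (q * real (Suc j)) *\<^sub>R (gaussian (gauss_rate lam j) x *\<^sub>R w x)" for j x
    by (simp add: f_def gauss_rate_def)
  have int: "integrable lborel (f j)" for j
    unfolding f_eq [abs_def] using gauss_rate_pos[OF lam(1), of j]
    by (intro integrable_scaleR_right moderate_integrable_exp w) auto
  have summ: "summable (\<lambda>j. norm (f j x))" if "x \<noteq> 0" for x
    using summable_mult2[OF gauss_series_summable[of lam "norm x" q], of "norm (w x)"] lam that
    by (simp add: f_def abs_mult)
  have AE: "AE x in lborel. summable (\<lambda>j. norm (f j x))"
    using AE_lborel_singleton[of "0::'a"] by eventually_elim (rule summ)
  have summ_int: "summable (\<lambda>j. LINT x|lborel. norm (f j x))"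
  proof (rule summable_comparison_test')
    show "summable (\<lambda>j. B * (2 * pi) powr (real DIM('a) / 2) * lam powr (\<alpha> * real (Suc j)))"
      by (intro summable_mult summable_powr_Suc lam \<alpha>)
    fix j
    have g: "integrable lborel (\<lambda>x::'a. gaussian (gauss_rate lam j) x)"
      using gauss_rate_pos[OF lam(1)] by auto
    have "(LINT x|lborel. norm (f j x)) \<le>
       (LINT x|lborel. lam powr (q * real (Suc j)) * (B * gaussian (gauss_rate lam j) (x::'a)))"
    proof (intro integral_mono integrable_mult_right integrable_norm int g)
      fix x
      have "gaussian (gauss_rate lam j) x * norm (w x) \<le> gaussian (gauss_rate lam j) x * B"
        using B by (intro mult_left_mono) auto
      then have "lam powr (q * real (Suc j)) * (gaussian (gauss_rate lam j) x * norm (w x)) \<le>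
          lam powr (q * real (Suc j)) * (gaussian (gauss_rate lam j) x * B)"
        by (intro mult_left_mono) auto
      then show "norm (f j x) \<le> lam powr (q * real (Suc j)) * (B * gaussian (gauss_rate lam j) x)"
        by (simp add: f_eq mult.commute[of B] abs_mult del: of_nat_Suc)
    qed
    also have "\<dots> = lam powr (q * real (Suc j)) * (B * (pi / gauss_rate lam j) powr (real DIM('a) / 2))"
      using gaussian_integral[OF gauss_rate_pos[OF lam(1), of j], where 'a='a] g
      by (simp add: has_bochner_integral_iff)
    also have "\<dots> = B * (2 * pi) powr (real DIM('a) / 2) * lam powr (\<alpha> * real (Suc j))"
      using gauss_rate_pi_powr[OF lam(1), of \<alpha> "real DIM('a)" j] by (simp add: q_def mult_ac del: of_nat_Suc)
    finally show "norm (LINT x|lborel. norm (f j x)) \<le> B * (2 * pi) powr (real DIM('a) / 2) * lam powr (\<alpha> * real (Suc j))"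
      by (simp add: integral_nonneg_AE)
  qed
  have sum_eq: "(\<Sum>j. f j x) = gauss_series lam q (norm x) *\<^sub>R w x" if "x \<noteq> 0" for x
    unfolding f_def gauss_series_def using that
    by (intro suminf_scaleR_left[symmetric] gauss_series_summable lam) auto
  have AE_eq: "AE x in lborel. (\<Sum>j. f j x) = gauss_series lam q (norm x) *\<^sub>R w x"
    using AE_lborel_singleton[of "0::'a"] by eventually_elim (rule sum_eq)
  have [measurable]: "(\<lambda>x. gauss_series lam q (norm (x::'a))) \<in> borel_measurable borel"
    unfolding gauss_series_def by measurable
  have [measurable]: "f j \<in> borel_measurable borel" for j
    using int[THEN borel_measurable_integrable] by simp
  show "integrable lborel (\<lambda>x. gauss_series lam (\<alpha> - real DIM('a)) (norm x) *\<^sub>R w x)"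
    using integrable_suminf[OF int AE summ_int] AE_eq
    by (subst integrable_cong_AE[where g = "\<lambda>x. \<Sum>j. f j x"]) (auto simp flip: q_def)
  have "(LINT x|lborel. gauss_series lam q (norm x) *\<^sub>R w x) = (LINT x|lborel. (\<Sum>j. f j x))"
    using AE_eq by (intro integral_cong_AE) auto
  moreover have "(LINT x|lborel. f j x) = lam powr (q * real (Suc j)) *\<^sub>R gauss_avg (gauss_rate lam j) w" for j
    by (simp only: f_eq gauss_avg_def integral_scaleR_right)
  ultimately show "(\<lambda>j. lam powr ((\<alpha> - real DIM('a)) * real (Suc j)) *\<^sub>R gauss_avg (gauss_rate lam j) w)
        sums (LINT x|lborel. gauss_series lam (\<alpha> - real DIM('a)) (norm x) *\<^sub>R w x)"
    using sums_integral[OF int AE summ_int] by (simp flip: q_def)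
qed

lemma measurable_riesz_kernel [measurable]: "riesz_kernel d \<alpha> \<in> borel_measurable borel"
  unfolding riesz_kernel_def [abs_def] by measurable

lemma measurable_W_potential [measurable]:
  "(W_potential \<alpha> lam cW :: 'a::euclidean_space \<Rightarrow> real) \<in> borel_measurable borel"
  unfolding W_potential_def [abs_def] W_radial_def by measurable

lemma
  fixes w :: "'a::euclidean_space \<Rightarrow> 'b::{banach,second_countable_topology}"
  assumes w: "moderate w" and \<alpha>: "0 < \<alpha>" "\<alpha> < real DIM('a) + 2"
  shows integrable_riesz: "integrable lborel (\<lambda>x. riesz_kernel DIM('a) \<alpha> (norm x) *\<^sub>R w x)"
    and integral_riesz: "integral\<^sup>L lborel w = 0 \<Longrightarrow>
       (LINT x|lborel. riesz_kernel DIM('a) \<alpha> (norm x) *\<^sub>R w x) =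
       riesz_norm DIM('a) \<alpha> *\<^sub>R (LINT t|lborel. mellin_weight ((real DIM('a) - \<alpha>) / 2) t *\<^sub>R gauss_avg t w)"
proof -
  have [measurable]: "w \<in> borel_measurable borel" using w by (simp add: moderate_def)
  define p where "p = (real DIM('a) - \<alpha>) / 2"
  have p: "-1 < p" "p < real DIM('a) / 2" using \<alpha> by (auto simp: p_def)
  have G0: "0 < Gamma (p + 1)" using p by (intro Gamma_real_pos) auto
  define g where "g = (\<lambda>x. - (riesz_norm DIM('a) \<alpha> * Gamma (p + 1)) *\<^sub>R (power_primitive p ((norm x)\<^sup>2) *\<^sub>R w x))"
  have "AE x in lborel. riesz_kernel DIM('a) \<alpha> (norm x) *\<^sub>R w x = g x"
    using AE_lborel_singleton[of "0::'a"]
    by eventually_elim (simp add: riesz_kernel_eq \<alpha> g_def flip: p_def)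
  moreover have "integrable lborel g"
    unfolding g_def by (intro integrable_scaleR_right integrable_power_primitive w p)
  moreover have [measurable]: "g \<in> borel_measurable borel" unfolding g_def by measurable
  ultimately show "integrable lborel (\<lambda>x. riesz_kernel DIM('a) \<alpha> (norm x) *\<^sub>R w x)"
    by (subst integrable_cong_AE[where g = g]) auto
  assume w0: "integral\<^sup>L lborel w = 0"
  have "(LINT x|lborel. riesz_kernel DIM('a) \<alpha> (norm x) *\<^sub>R w x) = integral\<^sup>L lborel g"
    using \<open>AE x in lborel. _ = g x\<close> by (intro integral_cong_AE) auto
  also have "\<dots> = riesz_norm DIM('a) \<alpha> *\<^sub>R (LINT t|lborel. mellin_weight p t *\<^sub>R gauss_avg t w)"
    unfolding g_def integral_scaleR_right integral_power_primitive[OF w p w0] using G0 by simp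
  finally show "(LINT x|lborel. riesz_kernel DIM('a) \<alpha> (norm x) *\<^sub>R w x) =
       riesz_norm DIM('a) \<alpha> *\<^sub>R (LINT t|lborel. mellin_weight ((real DIM('a) - \<alpha>) / 2) t *\<^sub>R gauss_avg t w)"
    by (simp add: p_def)
qed

text \<open>
  All that is needed about \<open>W\<close> for the Fourier transform and for the energy: against a moderate weight of
  integral \<open>0\<close> it is an explicit functional of the Gaussian averages and of the second moment.
\<close>

lemma
  fixes w :: "'a::euclidean_space \<Rightarrow> 'b::{banach,second_countable_topology}"
  assumes w: "moderate w" and lam: "0 < lam" "lam < 1" and \<alpha>: "0 < \<alpha>" "\<alpha> < real DIM('a) + 2"
  shows integrable_W_potential: "integrable lborel (\<lambda>x. W_potential \<alpha> lam cW x *\<^sub>R w x)"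
    and integral_W_potential: "integral\<^sup>L lborel w = 0 \<Longrightarrow>
       (LINT x|lborel. W_potential \<alpha> lam cW x *\<^sub>R w x) =
       riesz_norm DIM('a) \<alpha> *\<^sub>R (LINT t|lborel. mellin_weight ((real DIM('a) - \<alpha>) / 2) t *\<^sub>R gauss_avg t w)
       + (1 / 2) *\<^sub>R (LINT x|lborel. (norm x)\<^sup>2 *\<^sub>R w x)
       - cW *\<^sub>R (\<Sum>j. lam powr ((\<alpha> - real DIM('a)) * real (Suc j)) *\<^sub>R gauss_avg (gauss_rate lam j) w)"
proof -
  have eq: "W_potential \<alpha> lam cW x *\<^sub>R w x = riesz_kernel DIM('a) \<alpha> (norm x) *\<^sub>R w x
     + (1 / 2) *\<^sub>R ((norm x)\<^sup>2 *\<^sub>R w x) - cW *\<^sub>R (gauss_series lam (\<alpha> - real DIM('a)) (norm x) *\<^sub>R w x)" for x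
    by (simp add: W_potential_def W_radial_eq scaleR_add_left scaleR_diff_left)
  note ints = integrable_riesz[OF w \<alpha>] moderate_integrable_norm2[OF w] integrable_gauss_series[OF w lam \<alpha>(1)]
  show "integrable lborel (\<lambda>x. W_potential \<alpha> lam cW x *\<^sub>R w x)"
    unfolding eq by (intro Bochner_Integration.integrable_add Bochner_Integration.integrable_diff integrable_scaleR_right ints)
  assume w0: "integral\<^sup>L lborel w = 0"
  show "(LINT x|lborel. W_potential \<alpha> lam cW x *\<^sub>R w x) =
       riesz_norm DIM('a) \<alpha> *\<^sub>R (LINT t|lborel. mellin_weight ((real DIM('a) - \<alpha>) / 2) t *\<^sub>R gauss_avg t w)
       + (1 / 2) *\<^sub>R (LINT x|lborel. (norm x)\<^sup>2 *\<^sub>R w x)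
       - cW *\<^sub>R (\<Sum>j. lam powr ((\<alpha> - real DIM('a)) * real (Suc j)) *\<^sub>R gauss_avg (gauss_rate lam j) w)"
    unfolding eq integral_riesz[OF w \<alpha> w0, symmetric] sums_unique[OF gauss_series_sums[OF w lam \<alpha>(1)], symmetric]
    by (simp only: Bochner_Integration.integral_add Bochner_Integration.integral_diff ints integral_scaleR_right
        integrable_scaleR_right Bochner_Integration.integrable_add)
qed

lemma smooth_continuous: "smooth f \<Longrightarrow> continuous_on UNIV f"
proof -
  assume "smooth f"
  then have "iter_partial [] f differentiable_on UNIV" by (auto simp: smooth_def)
  then show ?thesis by (simp add: iter_partial_def differentiable_imp_continuous_on)
qed

lemma schwartz_weight_bdd:
  assumes "schwartz f" "set bs \<subseteq> Basis"
  shows "bdd_above (range (\<lambda>x. (1 + norm x) ^ n * cmod (iter_partial bs f x)))"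
proof -
  have "bounded (range (\<lambda>x. (1 + norm x) ^ n *\<^sub>R iter_partial bs f x))"
    using assms by (auto simp: schwartz_def)
  then obtain B where "\<And>x. norm ((1 + norm x) ^ n *\<^sub>R iter_partial bs f x) \<le> B"
    by (auto simp: bounded_iff)
  then show ?thesis by (intro bdd_aboveI[of _ B]) auto
qed

lemma schwartz_le_seminorm:
  fixes f :: "'a::euclidean_space \<Rightarrow> complex"
  assumes f: "schwartz f"
  shows "(1 + norm x) ^ N * cmod (f x) \<le> schwartz_seminorm N f"
proof -
  define g where "g = (\<lambda>bs. SUP x. (1 + norm x) ^ N * cmod (iter_partial bs f x))"
  have up: "(1 + norm x) ^ N * cmod (iter_partial bs f x) \<le> g bs" if "set bs \<subseteq> Basis" for bs x
    unfolding g_def by (intro cSUP_upper schwartz_weight_bdd[OF f that]) auto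
  have fin: "finite {bs. set bs \<subseteq> (Basis :: 'a set) \<and> length bs \<le> N}"
    by (rule finite_lists_length_le) simp
  have nn: "0 \<le> g bs" if "set bs \<subseteq> Basis" for bs
    using up[OF that, of 0] norm_ge_zero[of "iter_partial bs f 0"] by (simp del: norm_ge_zero)
  have "(1 + norm x) ^ N * cmod (f x) \<le> g []"
    using up[of "[]" x] by (simp add: iter_partial_def)
  also have "\<dots> \<le> (\<Sum>bs | set bs \<subseteq> Basis \<and> length bs \<le> N. g bs)"
    using fin nn by (intro member_le_sum) auto
  finally show ?thesis by (simp add: schwartz_seminorm_def g_def)
qed

lemma moderate_inverse_power:
  "moderate (\<lambda>x::'a::euclidean_space. inverse ((1 + (norm x)\<^sup>2) ^ (Suc DIM('a))))"
proof -
  have 1: "1 \<le> (1 + (norm x)\<^sup>2) ^ n" for x :: 'a and n by simp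
  have "(1 + (norm x)\<^sup>2) *\<^sub>R inverse ((1 + (norm x)\<^sup>2) ^ (Suc DIM('a))) = inverse ((1 + (norm x)\<^sup>2) ^ DIM('a))" for x :: 'a
  proof -
    have "1 + (norm x)\<^sup>2 \<noteq> 0" using zero_le_power2[of "norm x"] by linarith
    moreover have "a * inverse (a ^ Suc n) = inverse (a ^ n)" if "a \<noteq> 0" for a :: real and n
      using that by (simp add: field_simps)
    ultimately show ?thesis by (simp only: real_scaleR_def)
  qed
  moreover have "norm (inverse ((1 + (norm x)\<^sup>2) ^ (Suc DIM('a)))) \<le> 1" for x :: 'a
    using 1[of x "Suc DIM('a)"] by (simp add: inverse_le_1_iff del: power_Suc)
  ultimately show ?thesis
    unfolding moderate_def using integrable_inverse_power_norm[of "DIM('a)", where 'a='a]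
    by (intro conjI exI[of _ 1] allI) (simp_all del: power_Suc)
qed

lemma moderate_bound:
  assumes g: "moderate g" and [measurable]: "f \<in> borel_measurable borel"
    and le: "\<And>x. norm (f x) \<le> C * norm (g x)"
  shows "moderate f"
proof -
  obtain B where B: "\<And>x. norm (g x) \<le> B" using g by (auto simp: moderate_def)
  have "norm (f x) \<le> \<bar>C\<bar> * B" for x
  proof -
    have "C * norm (g x) \<le> \<bar>C\<bar> * B" using B[of x] by (intro mult_mono) auto
    then show ?thesis using le[of x] by simp
  qed
  moreover have "integrable lborel (\<lambda>x. (1 + (norm x)\<^sup>2) *\<^sub>R f x)"
  proof (rule Bochner_Integration.integrable_bound)
    show "integrable lborel (\<lambda>x. C *\<^sub>R ((1 + (norm x)\<^sup>2) *\<^sub>R g x))"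
      using g by (intro integrable_scaleR_right) (simp add: moderate_def)
    show "AE x in lborel. norm ((1 + (norm x)\<^sup>2) *\<^sub>R f x) \<le> norm (C *\<^sub>R ((1 + (norm x)\<^sup>2) *\<^sub>R g x))"
    proof (intro AE_I2)
      fix x
      have "norm (f x) \<le> \<bar>C\<bar> * norm (g x)"
        using le[of x] by (rule order_trans) (auto intro!: mult_right_mono)
      from mult_left_mono[OF this, of "1 + (norm x)\<^sup>2"]
      show "norm ((1 + (norm x)\<^sup>2) *\<^sub>R f x) \<le> norm (C *\<^sub>R ((1 + (norm x)\<^sup>2) *\<^sub>R g x))"
        by (simp add: abs_mult mult_ac)
    qed
  qed measurable
  ultimately show ?thesis by (auto simp: moderate_def)
qed

text \<open>
  The seminorm of order \<open>2 (d + 1)\<close> controls \<open>(1 + |x|)\<^sup>2\<^sup>(\<^sup>d\<^sup>+\<^sup>1\<^sup>) |f x|\<close>, and one more power of \<open>1 + |x|\<^sup>2\<close> than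
  integrability requires makes the majorant moderate.
\<close>

lemma schwartz_decay:
  fixes f :: "'a::euclidean_space \<Rightarrow> complex"
  assumes f: "schwartz f"
  shows "cmod (f x) \<le> schwartz_seminorm (2 * Suc DIM('a)) f * inverse ((1 + (norm x)\<^sup>2) ^ (Suc DIM('a)))"
proof -
  have "(1 + (norm x)\<^sup>2) ^ Suc DIM('a) \<le> ((1 + norm x)\<^sup>2) ^ Suc DIM('a)"
    by (intro power_mono) (auto simp: power2_eq_square algebra_simps)
  then have "(1 + (norm x)\<^sup>2) ^ Suc DIM('a) * cmod (f x) \<le> (1 + norm x) ^ (2 * Suc DIM('a)) * cmod (f x)"
    by (intro mult_right_mono) (simp_all only: power_mult norm_ge_zero)
  also have "\<dots> \<le> schwartz_seminorm (2 * Suc DIM('a)) f"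
    by (rule schwartz_le_seminorm[OF f])
  finally have "(1 + (norm x)\<^sup>2) ^ Suc DIM('a) * cmod (f x) \<le> schwartz_seminorm (2 * Suc DIM('a)) f" .
  moreover have "0 < (1 + (norm x)\<^sup>2) ^ Suc DIM('a)" by (intro zero_less_power add_pos_nonneg) auto
  ultimately show ?thesis by (simp add: field_simps del: power_Suc)
qed

lemma schwartz_moderate: "schwartz f \<Longrightarrow> moderate f"
  by (rule moderate_bound[OF moderate_inverse_power, where C = "schwartz_seminorm (2 * Suc DIM('a)) f" for f :: "'a::euclidean_space \<Rightarrow> complex"])
     (use schwartz_decay[of f] smooth_continuous[of f] in \<open>auto simp: schwartz_def simp del: power_Suc intro!: borel_measurable_continuous_onI\<close>)

lemma tempered_function_W_potential:
  fixes \<alpha> lam cW :: real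
  assumes lam: "0 < lam" "lam < 1" and \<alpha>: "0 < \<alpha>" "\<alpha> < real DIM('a::euclidean_space) + 2"
  shows "tempered_function (W_potential \<alpha> lam cW :: 'a \<Rightarrow> real)"
proof -
  let ?W = "W_potential \<alpha> lam cW :: 'a \<Rightarrow> real"
  define g where "g = (\<lambda>x::'a. inverse ((1 + (norm x)\<^sup>2) ^ (Suc DIM('a))))"
  have int: "integrable lborel (\<lambda>x. complex_of_real (?W x) * f x)" if "schwartz f" for f
    using integrable_W_potential[OF schwartz_moderate[OF that] lam \<alpha>, of cW] by (simp add: scaleR_conv_of_real)
  have "integrable lborel (\<lambda>x. ?W x *\<^sub>R g x)"
    using integrable_W_potential[OF moderate_inverse_power lam \<alpha>, of cW] by (simp add: g_def)
  from integrable_norm[OF this] have gint: "integrable lborel (\<lambda>x. \<bar>?W x\<bar> * \<bar>g x\<bar>)" by (simp add: abs_mult)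
  have bound: "cmod (function_dist ?W f) \<le> (LINT x|lborel. \<bar>?W x\<bar> * \<bar>g x\<bar>) * schwartz_seminorm (2 * Suc DIM('a)) f"
    if f: "schwartz f" for f
  proof -
    let ?S = "schwartz_seminorm (2 * Suc DIM('a)) f"
    have "cmod (function_dist ?W f) \<le> (LINT x|lborel. cmod (complex_of_real (?W x) * f x))"
      unfolding function_dist_def by (rule integral_norm_bound)
    also have "\<dots> \<le> (LINT x|lborel. ?S * (\<bar>?W x\<bar> * \<bar>g x\<bar>))"
    proof (intro integral_mono integrable_mult_right gint integrable_norm int f)
      fix x
      have "cmod (f x) \<le> ?S * \<bar>g x\<bar>"
        using schwartz_decay[OF f, of x] by (simp add: g_def abs_of_nonneg del: power_Suc)
      from mult_left_mono[OF this, of "\<bar>?W x\<bar>"]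
      show "cmod (complex_of_real (?W x) * f x) \<le> ?S * (\<bar>?W x\<bar> * \<bar>g x\<bar>)"
        by (simp add: norm_mult mult.left_commute)
    qed
    finally show ?thesis by (simp add: mult.commute)
  qed
  have "tempered_distribution (function_dist ?W)"
    unfolding tempered_distribution_def
  proof (intro conjI allI impI)
    show "function_dist ?W (\<lambda>x. f x + g x) = function_dist ?W f + function_dist ?W g" if "schwartz f" "schwartz g" for f g
      using int[OF that(1)] int[OF that(2)] by (simp add: function_dist_def distrib_left)
    show "function_dist ?W (\<lambda>x. c * f x) = c * function_dist ?W f" if "schwartz f" for c f
      by (simp add: function_dist_def mult.left_commute[of _ c])
    show "\<exists>N C. \<forall>f. schwartz f \<longrightarrow> cmod (function_dist ?W f) \<le> C * schwartz_seminorm N f"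
      using bound by blast
  qed
  with int show ?thesis by (auto simp: tempered_function_def)
qed

section \<open>Decay of Fourier transforms of test functions\<close>

lemma lborel_integral_translate:
  fixes f :: "'a::euclidean_space \<Rightarrow> 'b::{banach,second_countable_topology}"
  assumes [measurable]: "f \<in> borel_measurable borel"
  shows "(LINT x|lborel. f (c + x)) = integral\<^sup>L lborel f"
proof -
  have "integral\<^sup>L lborel f = integral\<^sup>L (distr lborel borel ((+) c)) f"
    by (simp add: lborel_distr_plus)
  also have "\<dots> = (LINT x|lborel. f (c + x))"
    by (rule integral_distr) auto
  finally show ?thesis ..
qed

lemma continuous_compact_support:
  fixes f :: "'a::euclidean_space \<Rightarrow> 'b::euclidean_space"
  assumes f: "continuous_on UNIV f" and K: "compact K" and supp: "\<And>x. x \<notin> K \<Longrightarrow> f x = 0"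
  shows "integrable lborel f" "\<exists>B. \<forall>x. norm (f x) \<le> B"
proof -
  have fK: "continuous_on K f" using f continuous_on_subset by blast
  have "(\<lambda>x. indicator K x *\<^sub>R f x) = f" using supp by (auto simp: indicator_def fun_eq_iff)
  then show "integrable lborel f" using borel_integrable_compact[OF K fK] by simp
  obtain B where "\<And>x. x \<in> K \<Longrightarrow> norm (f x) \<le> B"
    using compact_imp_bounded[OF compact_continuous_image[OF fK K]] by (auto simp: bounded_iff)
  then have "norm (f x) \<le> max B 0" for x
    using supp[of x] by (cases "x \<in> K") (auto simp: le_max_iff_disj)
  then show "\<exists>B. \<forall>x. norm (f x) \<le> B" by blast
qed

text \<open>
  Integration by parts without coordinates: the difference quotients of \<open>f\<close> in direction \<open>b\<close> have integral \<open>0\<close>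
  by translation invariance, and they converge boundedly, on a common bounded set, to the derivative.
\<close>

lemma integral_directional_derivative_eq_0:
  fixes f :: "'a::euclidean_space \<Rightarrow> 'b::euclidean_space"
  assumes D: "\<And>x. (f has_derivative D x) (at x)"
    and cont: "continuous_on UNIV (\<lambda>x. D x b)"
    and K: "compact K" and supp: "\<And>x. x \<notin> K \<Longrightarrow> f x = 0" "\<And>x. x \<notin> K \<Longrightarrow> D x b = 0"
  shows "(LINT x|lborel. D x b) = 0"
proof -
  have fcont: "continuous_on UNIV f"
    using D by (meson continuous_at_imp_continuous_on has_derivative_continuous)
  then have [measurable]: "f \<in> borel_measurable borel" by (rule borel_measurable_continuous_onI)
  have [measurable]: "(\<lambda>x. D x b) \<in> borel_measurable borel" using cont by (rule borel_measurable_continuous_onI)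
  obtain M where M: "\<And>x. norm (D x b) \<le> M"
    using continuous_compact_support(2)[OF cont K supp(2)] by blast
  then have M0: "0 \<le> M" using norm_ge_zero order_trans by blast
  obtain R where R: "\<And>x. x \<in> K \<Longrightarrow> norm x \<le> R"
    using compact_imp_bounded[OF K] by (auto simp: bounded_iff)
  have line: "((\<lambda>t. f (x + t *\<^sub>R b)) has_vector_derivative D (x + t *\<^sub>R b) b) (at t)" for x t
  proof -
    have 1: "((\<lambda>t. x + t *\<^sub>R b) has_derivative (\<lambda>s. s *\<^sub>R b)) (at t)" by (auto intro!: derivative_eq_intros)
    have "((\<lambda>t. f (x + t *\<^sub>R b)) has_derivative (\<lambda>s. D (x + t *\<^sub>R b) (s *\<^sub>R b))) (at t)"
      using diff_chain_at[OF 1 D] by (simp add: o_def)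
    moreover have "D (x + t *\<^sub>R b) (s *\<^sub>R b) = s *\<^sub>R D (x + t *\<^sub>R b) b" for s
      using has_derivative_bounded_linear[OF D] by (simp add: bounded_linear.linear linear_cmul)
    ultimately show ?thesis by (simp add: has_vector_derivative_def)
  qed
  have lip: "norm (f (x + h *\<^sub>R b) - f x) \<le> M * h" if "0 \<le> h" for x h
  proof -
    have "norm ((\<lambda>t. f (x + t *\<^sub>R b)) h - (\<lambda>t. f (x + t *\<^sub>R b)) 0) \<le> M * norm (h - 0)"
    proof (rule differentiable_bound[of UNIV])
      show "((\<lambda>t. f (x + t *\<^sub>R b)) has_derivative (\<lambda>s. s *\<^sub>R D (x + t *\<^sub>R b) b)) (at t within UNIV)" for t
        using line[of x t] by (simp add: has_vector_derivative_def)
      show "onorm (\<lambda>s. s *\<^sub>R D (x + t *\<^sub>R b) b) \<le> M" for t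
        using M M0 by (intro onorm_bound) (auto simp: mult.commute[of M] intro!: mult_left_mono)
    qed auto
    with that show ?thesis by simp
  qed
  \<comment> \<open>Difference quotients along the step sizes 1 / (n + 1).\<close>
  define h where "h = (\<lambda>n. inverse (real (Suc n)))"
  have h: "0 < h n" "h n \<le> 1" for n by (auto simp: h_def inverse_le_1_iff)
  have h_lim: "h \<longlonglongrightarrow> 0" unfolding h_def by (rule LIMSEQ_inverse_real_of_nat)
  have h_at: "filterlim h (at 0) sequentially"
    using h_lim h(1) by (auto simp: filterlim_at less_imp_neq[symmetric])
  define g where "g = (\<lambda>n x. (f (h n *\<^sub>R b + x) - f x) /\<^sub>R h n)"
  have fint: "integrable lborel f" by (rule continuous_compact_support(1)[OF fcont K supp(1)])
  have fint': "integrable lborel (\<lambda>x. f (c + x))" for c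
    using integrable_distr[of "(+) c" lborel borel f] fint by (simp add: lborel_distr_plus)
  have "integral\<^sup>L lborel (g n) = 0" for n
    using fint fint' lborel_integral_translate[of f "h n *\<^sub>R b"]
    by (simp add: g_def)
  moreover have "(\<lambda>n. integral\<^sup>L lborel (g n)) \<longlonglongrightarrow> (LINT x|lborel. D x b)"
  proof (rule integral_dominated_convergence)
    show "integrable lborel (\<lambda>x. M * indicator (cball 0 (R + norm b)) (x::'a))"
      by (intro integrable_mult_right integrable_real_indicator) (auto simp: intro!: emeasure_bounded_finite[unfolded infinity_ennreal_def])
    show "AE x in lborel. (\<lambda>n. g n x) \<longlonglongrightarrow> D x b"
    proof (intro AE_I2)
      fix x
      have "((\<lambda>s. (f (x + s *\<^sub>R b) - f x) /\<^sub>R s) \<longlongrightarrow> D x b) (at 0)"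
      proof -
        have "((\<lambda>s. norm (f (x + s *\<^sub>R b) - f x - s *\<^sub>R D x b) / norm s) \<longlongrightarrow> 0) (at 0)"
          using line[of x 0] by (simp add: has_vector_derivative_def has_derivative_at)
        moreover have "norm (f (x + s *\<^sub>R b) - f x - s *\<^sub>R D x b) / norm s =
            norm ((f (x + s *\<^sub>R b) - f x) /\<^sub>R s - D x b)" if "s \<noteq> 0" for s
        proof -
          have "(f (x + s *\<^sub>R b) - f x) /\<^sub>R s - D x b = (f (x + s *\<^sub>R b) - f x - s *\<^sub>R D x b) /\<^sub>R s"
            using that by (simp add: scaleR_diff_right)
          then show ?thesis using that by (simp add: divide_inverse mult.commute)
        qed
        ultimately have "((\<lambda>s. norm ((f (x + s *\<^sub>R b) - f x) /\<^sub>R s - D x b)) \<longlongrightarrow> 0) (at 0)"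
          by (subst (asm) filterlim_cong[OF refl refl]) (auto simp: eventually_at_filter)
        then show ?thesis by (rule LIM_zero_cancel[OF tendsto_norm_zero_cancel])
      qed
      then show "(\<lambda>n. g n x) \<longlonglongrightarrow> D x b"
        using filterlim_compose[OF _ h_at] by (simp add: g_def add.commute[of _ x])
    qed
    show "AE x in lborel. norm (g n x) \<le> M * indicator (cball 0 (R + norm b)) x" for n
    proof (intro AE_I2)
      fix x
      have 1: "norm (f (x + h n *\<^sub>R b) - f x) \<le> M * h n" using lip h by (simp add: less_imp_le)
      have 2: "norm (g n x) \<le> M"
      proof -
        have "norm (g n x) = norm (f (x + h n *\<^sub>R b) - f x) / h n"
          using h(1)[of n] by (simp add: g_def add.commute[of _ x] divide_inverse mult.commute)
        then show ?thesis using h(1)[of n] 1 by (simp add: pos_divide_le_eq)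
      qed
      have "g n x = 0" if "norm x > R + norm b"
      proof -
        have "norm x \<le> norm (x + h n *\<^sub>R b) + norm (h n *\<^sub>R b)"
          using norm_triangle_ineq4[of "x + h n *\<^sub>R b" "h n *\<^sub>R b"] by simp
        moreover have "norm (h n *\<^sub>R b) \<le> norm b"
          using h[of n] by (simp add: mult_left_le_one_le)
        ultimately have "R < norm (x + h n *\<^sub>R b)" "R < norm x" using that norm_ge_zero[of b] by linarith+
        then have "x \<notin> K" "x + h n *\<^sub>R b \<notin> K" using R by force+
        then show ?thesis by (simp add: g_def add.commute[of _ x] supp)
      qed
      with 2 show "norm (g n x) \<le> M * indicator (cball 0 (R + norm b)) x"
        by (auto simp: indicator_def)
    qed
  qed (unfold g_def, measurable)
  ultimately have "(\<lambda>n. 0) \<longlonglongrightarrow> (LINT x|lborel. D x b)" by simp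
  then show ?thesis by (simp add: LIMSEQ_const_iff)
qed

definition test_on :: "'a::euclidean_space set \<Rightarrow> ('a \<Rightarrow> complex) \<Rightarrow> bool" where
  "test_on K f \<longleftrightarrow> smooth f \<and> (\<forall>x. x \<notin> K \<longrightarrow> f x = 0)"

lemma smooth_has_derivative: "smooth f \<Longrightarrow> (f has_derivative frechet_derivative f (at x)) (at x)"
proof -
  assume "smooth f"
  then have "iter_partial [] f differentiable_on UNIV" by (auto simp: smooth_def)
  then show ?thesis by (simp add: iter_partial_def differentiable_on_def frechet_derivative_works[symmetric])
qed

lemma iter_partial_snoc: "iter_partial bs (partial_deriv b f) = iter_partial (bs @ [b]) f"
  by (simp add: iter_partial_def)

lemma smooth_partial_deriv: "smooth f \<Longrightarrow> b \<in> Basis \<Longrightarrow> smooth (partial_deriv b f)"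
  by (auto simp: smooth_def iter_partial_snoc)

lemma test_on_partial_deriv:
  assumes f: "test_on K f" and K: "closed K" and b: "b \<in> Basis"
  shows "test_on K (partial_deriv b f)"
  unfolding test_on_def
proof (intro conjI allI impI)
  show "smooth (partial_deriv b f)" using f b by (auto simp: test_on_def smooth_partial_deriv)
  fix x assume x: "x \<notin> K"
  have "(f has_derivative (\<lambda>_. 0)) (at x)"
  proof (rule has_derivative_transform_within_open[OF has_derivative_const])
    show "open (- K)" using K by (simp add: open_Compl)
  qed (use x f in \<open>auto simp: test_on_def\<close>)
  then show "partial_deriv b f x = 0"
    by (simp add: partial_deriv_def frechet_derivative_at[symmetric])
qed

lemma fourier_partial_deriv:
  assumes f: "test_on K f" and K: "compact K" and b: "b \<in> Basis"
  shows "fourier (partial_deriv b f) \<xi> = (\<i> * complex_of_real (b \<bullet> \<xi>)) * fourier f \<xi>"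
proof -
  define e where "e = (\<lambda>x. exp (- \<i> * complex_of_real (x \<bullet> \<xi>)))"
  define D where "D = (\<lambda>x v. frechet_derivative f (at x) v * e x - f x * (\<i> * complex_of_real (v \<bullet> \<xi>) * e x))"
  have sf: "smooth f" and supp: "\<And>x. x \<notin> K \<Longrightarrow> f x = 0" using f by (auto simp: test_on_def)
  have pf: "test_on K (partial_deriv b f)" using test_on_partial_deriv[OF f compact_imp_closed[OF K] b] .
  have cont: "continuous_on UNIV e" unfolding e_def by (intro continuous_intros)
  have cf: "continuous_on UNIV f" and cp: "continuous_on UNIV (partial_deriv b f)"
    using sf smooth_partial_deriv[OF sf b] by (auto intro: smooth_continuous)
  have i1: "integrable lborel (\<lambda>x. partial_deriv b f x * e x)"
    using pf by (intro continuous_compact_support(1)[OF _ K] continuous_on_mult cont cp) (auto simp: test_on_def)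
  have i2: "integrable lborel (\<lambda>x. f x * e x)"
    using supp by (intro continuous_compact_support(1)[OF _ K] continuous_on_mult cont cf) auto
  have ed: "(e has_derivative (\<lambda>v. - (\<i> * complex_of_real (v \<bullet> \<xi>) * e x))) (at x)" for x
  proof -
    have "((\<lambda>x. - \<i> * complex_of_real (x \<bullet> \<xi>)) has_derivative (\<lambda>v. - \<i> * complex_of_real (v \<bullet> \<xi>))) (at x)"
      by (auto intro!: derivative_eq_intros)
    from has_derivative_compose[OF this DERIV_exp[unfolded has_field_derivative_def]]
    show ?thesis by (simp add: e_def mult_ac)
  qed
  have "(LINT x|lborel. D x b) = 0"
  proof (rule integral_directional_derivative_eq_0[where f = "\<lambda>x. f x * e x" and K = K])
    show "((\<lambda>x. f x * e x) has_derivative D x) (at x)" for x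
      unfolding D_def using has_derivative_mult[OF smooth_has_derivative[OF sf, of x] ed[of x]]
      by (simp add: algebra_simps)
    show "continuous_on UNIV (\<lambda>x. D x b)"
      unfolding D_def using cf cp cont by (auto intro!: continuous_intros simp: partial_deriv_def[abs_def])
    show "D x b = 0" if "x \<notin> K" for x
      using that pf supp by (auto simp: D_def test_on_def partial_deriv_def)
  qed (use K supp in auto)
  moreover have "D x b = partial_deriv b f x * e x - (\<i> * complex_of_real (b \<bullet> \<xi>)) * (f x * e x)" for x
    by (simp add: D_def partial_deriv_def)
  moreover have "fourier g \<xi> = (LINT x|lborel. g x * e x)" for g
    by (simp add: fourier_def e_def)
  ultimately show ?thesis
    using i1 i2 by simp
qed

lemma test_on_iter:
  assumes f: "test_on K f" and K: "compact K" and b: "b \<in> Basis"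
  shows "test_on K ((partial_deriv b ^^ n) f)"
  by (induction n) (use f test_on_partial_deriv[OF _ compact_imp_closed[OF K] b] in auto)

lemma fourier_iter:
  assumes f: "test_on K f" and K: "compact K" and b: "b \<in> Basis"
  shows "fourier ((partial_deriv b ^^ n) f) \<xi> = (\<i> * complex_of_real (b \<bullet> \<xi>)) ^ n * fourier f \<xi>"
  by (induction n) (simp_all add: fourier_partial_deriv[OF test_on_iter[OF f K b] K b] mult_ac)

lemma test_on_integrable:
  assumes f: "test_on K f" and K: "compact K"
  shows "integrable lborel f"
  using f by (intro continuous_compact_support(1)[OF _ K] smooth_continuous) (auto simp: test_on_def)

lemma norm_fourier_le: "cmod (fourier f \<xi>) \<le> (LINT x|lborel. cmod (f x))"
  unfolding fourier_def by (rule order_trans[OF integral_norm_bound]) (simp add: norm_mult)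

lemma measurable_fourier [measurable (raw)]:
  assumes [measurable]: "f \<in> borel_measurable borel"
  shows "fourier f \<in> borel_measurable borel"
  unfolding fourier_def [abs_def] by measurable

text \<open>
  Each coordinate satisfies \<open>|\<xi>\<^sub>b|\<^sup>2\<^sup>N |fourier f \<xi>| \<le> \<integral> |\<partial>\<^sub>b\<^sup>2\<^sup>N f|\<close>, and \<open>1 + |\<xi>|\<^sup>2\<close> is at most \<open>d + 1\<close> times the largest
  among \<open>1\<close> and the squared coordinates.
\<close>

lemma fourier_decay:
  fixes f :: "'a::euclidean_space \<Rightarrow> complex"
  assumes f: "test_on K f" and K: "compact K"
  shows "\<exists>C. \<forall>\<xi>. (1 + (norm \<xi>)\<^sup>2) ^ N * cmod (fourier f \<xi>) \<le> C"
proof -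
  define C where "C = (\<lambda>b. LINT x|lborel. cmod ((partial_deriv b ^^ (2 * N)) f x))"
  define C0 where "C0 = (LINT x|lborel. cmod (f x))"
  have C_nn: "0 \<le> C b" for b unfolding C_def by simp
  have "(1 + (norm \<xi>)\<^sup>2) ^ N * cmod (fourier f \<xi>) \<le> (real DIM('a) + 1) ^ N * (C0 + (\<Sum>b\<in>Basis. C b))" for \<xi>
  proof -
    \<comment> \<open>The coordinate that dominates 1 + |xi|^2, or 1 if all coordinates are small.\<close>
    define m where "m = Max (insert 1 ((\<lambda>b. (b \<bullet> \<xi>)\<^sup>2) ` Basis))"
    have m: "1 \<le> m" "\<And>b. b \<in> Basis \<Longrightarrow> (b \<bullet> \<xi>)\<^sup>2 \<le> m"
      unfolding m_def by (auto intro!: Max_ge simp del: Max_insert)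
    have "m \<in> insert 1 ((\<lambda>b. (b \<bullet> \<xi>)\<^sup>2) ` Basis)" unfolding m_def by (rule Max_in) auto
    moreover have "(b \<bullet> \<xi>)\<^sup>2 ^ N * cmod (fourier f \<xi>) \<le> C b" if "b \<in> Basis" for b
    proof -
      have "cmod (fourier ((partial_deriv b ^^ (2 * N)) f) \<xi>) = (b \<bullet> \<xi>)\<^sup>2 ^ N * cmod (fourier f \<xi>)"
        unfolding fourier_iter[OF f K that] by (simp add: norm_mult norm_power power_mult)
      then show ?thesis unfolding C_def by (metis norm_fourier_le)
    qed
    moreover have "cmod (fourier f \<xi>) \<le> C0" unfolding C0_def by (rule norm_fourier_le)
    moreover have "C b \<le> (\<Sum>b\<in>Basis. C b)" if "b \<in> Basis" for b :: 'a
      using that C_nn by (intro member_le_sum) auto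
    moreover have "0 \<le> C0" "0 \<le> (\<Sum>b\<in>Basis. C b)" using C_nn by (auto simp: C0_def sum_nonneg)
    ultimately have le: "m ^ N * cmod (fourier f \<xi>) \<le> C0 + (\<Sum>b\<in>Basis. C b)"
      by (fastforce intro: order_trans)
    have "1 + (norm \<xi>)\<^sup>2 \<le> (real DIM('a) + 1) * m"
    proof -
      have "(norm \<xi>)\<^sup>2 \<le> (\<Sum>b\<in>(Basis::'a set). m)"
        unfolding norm_power2_eq_sum using m by (intro sum_mono) (auto simp: inner_commute)
      then show ?thesis using m(1) by (simp add: algebra_simps)
    qed
    then have "(1 + (norm \<xi>)\<^sup>2) ^ N * cmod (fourier f \<xi>) \<le> ((real DIM('a) + 1) * m) ^ N * cmod (fourier f \<xi>)"
      by (intro mult_right_mono power_mono) auto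
    also have "\<dots> = (real DIM('a) + 1) ^ N * (m ^ N * cmod (fourier f \<xi>))"
      by (simp add: power_mult_distrib)
    also have "\<dots> \<le> (real DIM('a) + 1) ^ N * (C0 + (\<Sum>b\<in>Basis. C b))"
      using le by (intro mult_left_mono) auto
    finally show ?thesis .
  qed
  then show ?thesis by blast
qed

lemma moderate_fourier:
  fixes f :: "'a::euclidean_space \<Rightarrow> complex"
  assumes f: "test_on K f" and K: "compact K"
  shows "moderate (fourier f)"
proof -
  have [measurable]: "f \<in> borel_measurable borel"
    using f by (intro borel_measurable_continuous_onI smooth_continuous) (auto simp: test_on_def)
  obtain C where C: "\<And>\<xi>. (1 + (norm \<xi>)\<^sup>2) ^ Suc DIM('a) * cmod (fourier f \<xi>) \<le> C"
    using fourier_decay[OF f K] by blast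
  show ?thesis
  proof (rule moderate_bound[OF moderate_inverse_power])
    fix \<xi> :: 'a
    have "0 < (1 + (norm \<xi>)\<^sup>2) ^ Suc DIM('a)" by (intro zero_less_power add_pos_nonneg) auto
    then show "norm (fourier f \<xi>) \<le> C * norm (inverse ((1 + (norm \<xi>)\<^sup>2) ^ Suc DIM('a)))"
      using C[of \<xi>] by (simp add: field_simps del: power_Suc)
  qed measurable
qed

section \<open>The Fourier transform of the potential away from the origin\<close>

lemma one_minus_exp_bounds: "0 \<le> a \<Longrightarrow> 0 \<le> 1 - exp (- a) \<and> 1 - exp (- a) \<le> (a::real)"
  using exp_ge_add_one_self[of "- a"] by simp

lemma gauss_avg_tendsto:
  fixes w :: "'a::euclidean_space \<Rightarrow> 'b::{banach,second_countable_topology}"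
  assumes w: "moderate w"
  shows "(\<lambda>n. gauss_avg (inverse (real (Suc n))) w) \<longlonglongrightarrow> integral\<^sup>L lborel w"
  unfolding gauss_avg_def
proof (rule integral_dominated_convergence)
  have [measurable]: "w \<in> borel_measurable borel" using w by (simp add: moderate_def)
  show "integrable lborel (\<lambda>x. norm (w x))" using moderate_integrable[OF w] by auto
  show "w \<in> borel_measurable lborel" by measurable
  show "(\<lambda>x. gaussian (inverse (real (Suc n))) x *\<^sub>R w x) \<in> borel_measurable lborel" for n by measurable
  show "AE x in lborel. (\<lambda>n. gaussian (inverse (real (Suc n))) x *\<^sub>R w x) \<longlonglongrightarrow> w x"
  proof (intro AE_I2)
    fix x
    have "(\<lambda>n. gaussian (inverse (real (Suc n))) x *\<^sub>R w x) \<longlonglongrightarrow> gaussian 0 x *\<^sub>R w x"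
      by (intro tendsto_intros LIMSEQ_inverse_real_of_nat)
    then show "(\<lambda>n. gaussian (inverse (real (Suc n))) x *\<^sub>R w x) \<longlonglongrightarrow> w x" by simp
  qed
  show "AE x in lborel. norm (gaussian (inverse (real (Suc n))) x *\<^sub>R w x) \<le> norm (w x)" for n
    by (intro AE_I2) (auto intro!: mult_left_le_one_le)
qed

text \<open>
  The second moment is minus the derivative of the Gaussian average at \<open>t = 0\<close>; dominated convergence
  uses \<open>0 \<le> 1 - exp (- a) \<le> a\<close>.
\<close>

lemma gauss_avg_difference_quotient_tendsto:
  fixes w :: "'a::euclidean_space \<Rightarrow> 'b::{banach,second_countable_topology}"
  assumes w: "moderate w"
  shows "(\<lambda>n. real (Suc n) *\<^sub>R (integral\<^sup>L lborel w - gauss_avg (inverse (real (Suc n))) w))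
     \<longlonglongrightarrow> (LINT x|lborel. (norm x)\<^sup>2 *\<^sub>R w x)"
proof -
  have [measurable]: "w \<in> borel_measurable borel" using w by (simp add: moderate_def)
  define h where "h = (\<lambda>n. inverse (real (Suc n)))"
  have h: "0 < h n" "real (Suc n) = inverse (h n)" for n by (auto simp: h_def)
  have h_at: "filterlim h (at 0) sequentially"
    using LIMSEQ_inverse_real_of_nat h(1) by (auto simp: filterlim_at less_imp_neq[symmetric] h_def)
  have eq: "real (Suc n) *\<^sub>R (integral\<^sup>L lborel w - gauss_avg (h n) w) =
     (LINT x|lborel. ((1 - gaussian (h n) x) / h n) *\<^sub>R w x)" for n
  proof -
    have "integral\<^sup>L lborel w - gauss_avg (h n) w = (LINT x|lborel. w x - gaussian (h n) x *\<^sub>R w x)"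
      unfolding gauss_avg_def using moderate_integrable[OF w] moderate_integrable_exp[OF w, of "h n"] h(1)[of n]
      by (subst Bochner_Integration.integral_diff) auto
    then show ?thesis
      unfolding h(2) by (simp add: divide_inverse scaleR_diff_left scaleR_diff_right algebra_simps flip: integral_scaleR_right)
  qed
  have "(\<lambda>n. LINT x|lborel. ((1 - gaussian (h n) x) / h n) *\<^sub>R w x) \<longlonglongrightarrow> (LINT x|lborel. (norm x)\<^sup>2 *\<^sub>R w x)"
  proof (rule integral_dominated_convergence)
    show "integrable lborel (\<lambda>x. norm ((norm x)\<^sup>2 *\<^sub>R w x))" using moderate_integrable_norm2[OF w] by (rule integrable_norm)
    show "AE x in lborel. (\<lambda>n. ((1 - gaussian (h n) x) / h n) *\<^sub>R w x) \<longlonglongrightarrow> (norm x)\<^sup>2 *\<^sub>R w x"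
    proof (intro AE_I2 tendsto_scaleR tendsto_const)
      fix x :: 'a
      have "((\<lambda>s. 1 - gaussian s x) has_real_derivative (norm x)\<^sup>2) (at 0)"
        by (auto intro!: derivative_eq_intros)
      then have "((\<lambda>s. (1 - gaussian s x) / s) \<longlongrightarrow> (norm x)\<^sup>2) (at 0)"
        by (simp add: has_field_derivative_iff)
      from filterlim_compose[OF this h_at]
      show "(\<lambda>n. (1 - gaussian (h n) x) / h n) \<longlonglongrightarrow> (norm x)\<^sup>2" .
    qed
    show "AE x in lborel. norm (((1 - gaussian (h n) x) / h n) *\<^sub>R w x) \<le> norm ((norm x)\<^sup>2 *\<^sub>R w x)" for n
    proof (intro AE_I2)
      fix x :: 'a
      have "0 \<le> 1 - gaussian (h n) x \<and> 1 - gaussian (h n) x \<le> h n * (norm x)\<^sup>2"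
        using h(1)[of n] by (intro one_minus_exp_bounds) auto
      then have "\<bar>(1 - gaussian (h n) x) / h n\<bar> \<le> (norm x)\<^sup>2"
        using h(1)[of n] by (simp add: abs_of_nonneg pos_divide_le_eq mult.commute)
      then have "\<bar>(1 - gaussian (h n) x) / h n\<bar> * norm (w x) \<le> (norm x)\<^sup>2 * norm (w x)"
        by (rule mult_right_mono) simp
      then show "norm (((1 - gaussian (h n) x) / h n) *\<^sub>R w x) \<le> norm ((norm x)\<^sup>2 *\<^sub>R w x)"
        by simp
    qed
  qed measurable
  then show ?thesis using eq unfolding h_def by (simp only:)
qed

text \<open>
  Fubini moves the Fourier transform from \<open>f\<close> to the Gaussian.
\<close>

lemma gauss_avg_fourier:
  fixes f :: "'a::euclidean_space \<Rightarrow> complex"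
  assumes f: "integrable lborel f" and t: "0 < t"
  shows "gauss_avg t (fourier f) = (LINT x|lborel. ((pi / t) powr (real DIM('a) / 2) * exp (- ((norm x)\<^sup>2 / (4 * t)))) *\<^sub>R f x)"
proof -
  have [measurable]: "f \<in> borel_measurable borel" using borel_measurable_integrable[OF f] by simp
  define F where "F = (\<lambda>(x, \<xi>::'a). gaussian t \<xi> *\<^sub>R (f x * exp (- \<i> * complex_of_real (x \<bullet> \<xi>))))"
  have F_norm: "norm (F (x, \<xi>)) = cmod (f x) * gaussian t \<xi>" for x \<xi>
    by (simp add: F_def norm_mult)
  have g: "integrable lborel (\<lambda>\<xi>::'a. gaussian t \<xi>)" using t by auto
  have [measurable]: "F \<in> borel_measurable (lborel \<Otimes>\<^sub>M lborel)" unfolding F_def by measurable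
  have F: "integrable (lborel \<Otimes>\<^sub>M lborel) F"
  proof (rule lborel_pair.Fubini_integrable)
    show "integrable lborel (\<lambda>x. LINT \<xi>|lborel. norm (F (x, \<xi>)))"
      unfolding F_norm using integrable_norm[OF f] by (simp add: integrable_mult_left)
    have "integrable lborel (\<lambda>\<xi>. F (x, \<xi>))" for x
    proof (rule Bochner_Integration.integrable_bound)
      show "integrable lborel (\<lambda>\<xi>::'a. cmod (f x) * gaussian t \<xi>)" using g by auto
      show "AE \<xi> in lborel. norm (F (x, \<xi>)) \<le> norm (cmod (f x) * gaussian t \<xi>)"
        by (simp add: F_norm)
    qed measurable
    then show "AE x in lborel. integrable lborel (\<lambda>\<xi>. F (x, \<xi>))" by simp
  qed measurable
  have inner: "(LINT \<xi>|lborel. F (x, \<xi>)) = ((pi / t) powr (real DIM('a) / 2) * exp (- ((norm x)\<^sup>2 / (4 * t)))) *\<^sub>R f x" for x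
  proof -
    have "F (x, \<xi>) = f x * (gaussian t \<xi> *\<^sub>R exp (- \<i> * complex_of_real (\<xi> \<bullet> x)))" for \<xi>
      by (simp add: F_def inner_commute)
    then have "(LINT \<xi>|lborel. F (x, \<xi>)) = f x * (LINT \<xi>|lborel. gaussian t \<xi> *\<^sub>R exp (- \<i> * complex_of_real (\<xi> \<bullet> x)))"
      by (simp only: integral_mult_right_zero)
    also have "\<dots> = f x * complex_of_real ((pi / t) powr (real DIM('a) / 2) * exp (- ((norm x)\<^sup>2 / (4 * t))))"
      by (subst has_bochner_integral_integral_eq[OF gaussian_fourier[OF t, of x]]) simp
    finally show ?thesis by (simp add: scaleR_conv_of_real mult.commute)
  qed
  have "gauss_avg t (fourier f) = (LINT \<xi>|lborel. LINT x|lborel. F (x, \<xi>))"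
    by (simp add: gauss_avg_def fourier_def F_def)
  also have "\<dots> = (LINT x|lborel. LINT \<xi>|lborel. F (x, \<xi>))"
    using lborel_pair.Fubini_integral[of "curry F"] F by simp
  finally show ?thesis by (simp add: inner)
qed

lemma test_on_away_from_0:
  assumes K: "compact K" "0 \<notin> K"
  obtains \<rho> where "0 < \<rho>" "\<And>x. x \<in> K \<Longrightarrow> \<rho> \<le> norm x"
proof -
  have "open (- K)" using K by (simp add: compact_imp_closed open_Compl)
  then obtain \<rho> where "0 < \<rho>" "ball 0 \<rho> \<subseteq> - K" using K(2) open_contains_ball[of "- K"] by auto
  then show thesis by (intro that[of \<rho>]) (auto simp: subset_iff not_less[symmetric])
qed

text \<open>
  On the support of \<open>f\<close> the norm is at least some \<open>\<rho> > 0\<close>, so the average is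
  \<open>O(t\<^sup>-\<^sup>d\<^sup>/\<^sup>2 exp (- \<rho>\<^sup>2 / (4 t)))\<close> as \<open>t\<close> tends to \<open>0\<close>.
\<close>

lemma gauss_avg_fourier_rapid_decay:
  fixes f :: "'a::euclidean_space \<Rightarrow> complex"
  assumes f: "test_on K f" and K: "compact K" "0 \<notin> K"
  shows "(\<lambda>n. real (Suc n) *\<^sub>R gauss_avg (inverse (real (Suc n))) (fourier f)) \<longlonglongrightarrow> 0"
proof -
  have fi: "integrable lborel f" by (rule test_on_integrable[OF f K(1)])
  obtain \<rho> where \<rho>: "0 < \<rho>" "\<And>x. x \<in> K \<Longrightarrow> \<rho> \<le> norm x" using test_on_away_from_0[OF K] by blast
  define I where "I = (LINT x|lborel. cmod (f x))"
  define d where "d = real DIM('a) / 2"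
  define a where "a = \<rho>\<^sup>2 / 4"
  have a: "0 < a" using \<rho>(1) by (simp add: a_def)
  have bound: "norm (real (Suc n) *\<^sub>R gauss_avg (inverse (real (Suc n))) (fourier f)) \<le>
      I * (real (Suc n) * ((pi * real (Suc n)) powr d * exp (- (a * real (Suc n)))))" for n
  proof -
    define c where "c = (pi * real (Suc n)) powr d * exp (- (a * real (Suc n)))"
    have "gauss_avg (inverse (real (Suc n))) (fourier f) =
        (LINT x|lborel. ((pi * real (Suc n)) powr d * exp (- ((norm x)\<^sup>2 * real (Suc n) / 4))) *\<^sub>R f x)"
    proof -
      have "pi / inverse m = pi * m" "r / (4 * inverse m) = r * m / 4" for m r :: real
        by (cases "m = 0"; simp add: field_simps)+
      moreover have "0 < inverse (real (Suc n))" by simp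
      ultimately show ?thesis
        using gauss_avg_fourier[OF fi, of "inverse (real (Suc n))"] by (simp only: d_def)
    qed
    also have "cmod \<dots> \<le> (LINT x|lborel. norm (((pi * real (Suc n)) powr d * exp (- ((norm x)\<^sup>2 * real (Suc n) / 4))) *\<^sub>R f x))"
      by (rule integral_norm_bound)
    also have "\<dots> \<le> (LINT x|lborel. c * cmod (f x))"
    proof (rule integral_mono_AE')
      show "integrable lborel (\<lambda>x. c * cmod (f x))" using fi by auto
      have "norm (((pi * real (Suc n)) powr d * exp (- ((norm x)\<^sup>2 * real (Suc n) / 4))) *\<^sub>R f x) \<le> c * cmod (f x)" for x
      proof (cases "x \<in> K")
        case True
        have "\<rho>\<^sup>2 \<le> (norm x)\<^sup>2" using \<rho> True by (intro power_mono) auto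
        then have "a * real (Suc n) \<le> (norm x)\<^sup>2 * real (Suc n) / 4"
          by (simp add: a_def mult_right_mono divide_right_mono del: of_nat_Suc)
        then show ?thesis by (simp add: c_def mult_left_mono mult_right_mono abs_mult del: of_nat_Suc)
      next
        case False
        then have "f x = 0" using f by (simp add: test_on_def)
        then show ?thesis by simp
      qed
      then show "AE x in lborel. norm (((pi * real (Suc n)) powr d * exp (- ((norm x)\<^sup>2 * real (Suc n) / 4))) *\<^sub>R f x) \<le> c * cmod (f x)"
        by (intro AE_I2)
    qed (auto simp: c_def)
    also have "\<dots> = c * I" by (simp add: I_def)
    finally have "real (Suc n) * cmod (gauss_avg (inverse (real (Suc n))) (fourier f)) \<le> real (Suc n) * (c * I)"
      by (intro mult_left_mono) auto
    then show ?thesis by (simp add: c_def mult_ac del: of_nat_Suc)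
  qed
  have "(\<lambda>n. real (Suc n) * ((pi * real (Suc n)) powr d * exp (- (a * real (Suc n))))) \<longlonglongrightarrow> 0"
    using a by real_asymp
  then have "(\<lambda>n. I * (real (Suc n) * ((pi * real (Suc n)) powr d * exp (- (a * real (Suc n)))))) \<longlonglongrightarrow> 0"
    by (rule tendsto_mult_right_zero)
  then show ?thesis
    by (rule Lim_null_comparison[rotated]) (intro always_eventually allI bound)
qed

text \<open>
  Up to constants these are the value and the Laplacian of \<open>f\<close> at the origin, where \<open>f\<close> vanishes. Instead of
  Fourier inversion, let \<open>t\<close> tend to \<open>0\<close> in the Gaussian average and in its difference quotient.
\<close>

lemma
  fixes f :: "'a::euclidean_space \<Rightarrow> complex"
  assumes f: "test_on K f" and K: "compact K" "0 \<notin> K"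
  shows integral_fourier_eq_0: "integral\<^sup>L lborel (fourier f) = 0"
    and integral_norm2_fourier_eq_0: "(LINT x|lborel. (norm x)\<^sup>2 *\<^sub>R fourier f x) = 0"
proof -
  let ?g = "\<lambda>n. gauss_avg (inverse (real (Suc n))) (fourier f)"
  have m: "moderate (fourier f)" by (rule moderate_fourier[OF f K(1)])
  have lim: "(\<lambda>n. real (Suc n) *\<^sub>R ?g n) \<longlonglongrightarrow> 0" by (rule gauss_avg_fourier_rapid_decay[OF f K])
  have "(\<lambda>n. inverse (real (Suc n)) *\<^sub>R (real (Suc n) *\<^sub>R ?g n)) \<longlonglongrightarrow> 0 *\<^sub>R 0"
    by (intro tendsto_scaleR LIMSEQ_inverse_real_of_nat lim)
  then have "?g \<longlonglongrightarrow> 0" by (simp del: of_nat_Suc)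
  then show int0: "integral\<^sup>L lborel (fourier f) = 0"
    using LIMSEQ_unique gauss_avg_tendsto[OF m] by blast
  have "(\<lambda>n. - (real (Suc n) *\<^sub>R ?g n)) \<longlonglongrightarrow> - 0" by (intro tendsto_minus lim)
  moreover have "(\<lambda>n. - (real (Suc n) *\<^sub>R ?g n)) \<longlonglongrightarrow> (LINT x|lborel. (norm x)\<^sup>2 *\<^sub>R fourier f x)"
    using gauss_avg_difference_quotient_tendsto[OF m] by (simp add: int0 del: of_nat_Suc)
  ultimately show "(LINT x|lborel. (norm x)\<^sup>2 *\<^sub>R fourier f x) = 0"
    using LIMSEQ_unique by fastforce
qed

text \<open>
  The Fourier transform of the Riesz kernel away from the origin is \<open>|\<xi>|\<^sup>-\<^sup>\<alpha>\<close>: after Fubini, the integral in \<open>t\<close> is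
  an inverse Gamma integral with parameter \<open>|x|\<^sup>2 / 4\<close>.
\<close>

lemma mellin_gauss_avg_fourier:
  fixes f :: "'a::euclidean_space \<Rightarrow> complex"
  assumes f: "test_on K f" and K: "compact K" "0 \<notin> K" and \<alpha>: "0 < \<alpha>"
  shows "riesz_norm DIM('a) \<alpha> *\<^sub>R (LINT t|lborel. mellin_weight ((real DIM('a) - \<alpha>) / 2) t *\<^sub>R gauss_avg t (fourier f))
     = (LINT x|lborel. (norm x) powr (- \<alpha>) *\<^sub>R f x)"
proof -
  have fi: "integrable lborel f" by (rule test_on_integrable[OF f K(1)])
  have [measurable]: "f \<in> borel_measurable borel" using borel_measurable_integrable[OF fi] by simp
  obtain \<rho> where \<rho>: "0 < \<rho>" "\<And>x. x \<in> K \<Longrightarrow> \<rho> \<le> norm x" using test_on_away_from_0[OF K] by blast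
  have f0: "f x = 0" if "x \<notin> K" for x using f that by (simp add: test_on_def)
  define d where "d = real DIM('a) / 2"
  define F where "F = (\<lambda>(x, t). (mellin_weight (- (\<alpha> / 2)) t * exp (- ((norm x)\<^sup>2 / 4 / t))) *\<^sub>R f x)"
  define I where "I = (\<lambda>x::'a. Gamma (\<alpha> / 2) * ((norm x)\<^sup>2 / 4) powr (- (\<alpha> / 2)))"
  have I: "has_bochner_integral lborel (\<lambda>t. mellin_weight (- (\<alpha> / 2)) t * exp (- ((norm x)\<^sup>2 / 4 / t))) (I x)"
    if "x \<noteq> 0" for x :: 'a
    unfolding I_def using \<alpha> that by (intro inverse_Gamma_has_bochner_integral) auto
  have [measurable]: "F \<in> borel_measurable (lborel \<Otimes>\<^sub>M lborel)" unfolding F_def by measurable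
  have inner: "(LINT t|lborel. F (x, t)) = I x *\<^sub>R f x" "(LINT t|lborel. norm (F (x, t))) = I x * cmod (f x)"
     "integrable lborel (\<lambda>t. F (x, t))" if "x \<in> K" for x
  proof -
    have x: "x \<noteq> 0" using that K by auto
    show "(LINT t|lborel. F (x, t)) = I x *\<^sub>R f x" "(LINT t|lborel. norm (F (x, t))) = I x * cmod (f x)" "integrable lborel (\<lambda>t. F (x, t))"
      using I[OF x] by (auto simp: F_def has_bochner_integral_iff abs_mult)
  qed
  have inner': "(LINT t|lborel. F (x, t)) = I x *\<^sub>R f x" "(LINT t|lborel. norm (F (x, t))) = I x * cmod (f x)"
     "integrable lborel (\<lambda>t. F (x, t))" for x
    using inner[of x] f0[of x] by (cases "x \<in> K"; simp add: F_def)+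
  have I_le: "I x \<le> Gamma (\<alpha> / 2) * (\<rho>\<^sup>2 / 4) powr (- (\<alpha> / 2))" "0 \<le> I x" if "x \<in> K" for x
  proof -
    have "\<rho>\<^sup>2 \<le> (norm x)\<^sup>2" using \<rho> that by (intro power_mono) auto
    then have "((norm x)\<^sup>2 / 4) powr (- (\<alpha> / 2)) \<le> (\<rho>\<^sup>2 / 4) powr (- (\<alpha> / 2))"
      using \<rho>(1) \<alpha> by (intro powr_mono2') auto
    then show "I x \<le> Gamma (\<alpha> / 2) * (\<rho>\<^sup>2 / 4) powr (- (\<alpha> / 2))" "0 \<le> I x"
      using Gamma_real_pos[of "\<alpha> / 2"] \<alpha> by (auto simp: I_def mult_left_mono)
  qed
  have F: "integrable (lborel \<Otimes>\<^sub>M lborel) F"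
  proof (rule lborel_pair.Fubini_integrable)
    show "integrable lborel (\<lambda>x. LINT t|lborel. norm (F (x, t)))"
      unfolding inner'
    proof (rule Bochner_Integration.integrable_bound)
      show "integrable lborel (\<lambda>x. Gamma (\<alpha> / 2) * (\<rho>\<^sup>2 / 4) powr (- (\<alpha> / 2)) * cmod (f x))" using fi by auto
      show "AE x in lborel. norm (I x * cmod (f x)) \<le> norm (Gamma (\<alpha> / 2) * (\<rho>\<^sup>2 / 4) powr (- (\<alpha> / 2)) * cmod (f x))"
      proof (intro AE_I2)
        fix x
        show "norm (I x * cmod (f x)) \<le> norm (Gamma (\<alpha> / 2) * (\<rho>\<^sup>2 / 4) powr (- (\<alpha> / 2)) * cmod (f x))"
        proof (cases "x \<in> K")
          case True
          have "I x * cmod (f x) \<le> Gamma (\<alpha> / 2) * (\<rho>\<^sup>2 / 4) powr (- (\<alpha> / 2)) * cmod (f x)"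
            by (intro mult_right_mono I_le True) simp
          then show ?thesis using I_le(2)[OF True] by simp
        qed (simp add: f0)
      qed
    qed (unfold I_def, measurable)
  qed (use inner' in auto)
  have "mellin_weight ((real DIM('a) - \<alpha>) / 2) t *\<^sub>R gauss_avg t (fourier f) = pi powr d *\<^sub>R (LINT x|lborel. F (x, t))" for t
  proof (cases "0 < t")
    case True
    have "mellin_weight ((real DIM('a) - \<alpha>) / 2) t * (pi / t) powr d = pi powr d * mellin_weight (- (\<alpha> / 2)) t"
      by (simp add: mellin_weight_times_powr d_def field_simps)
    then have *: "mellin_weight ((real DIM('a) - \<alpha>) / 2) t * ((pi / t) powr d * exp (- ((norm x)\<^sup>2 / (4 * t)))) =
        pi powr d * (mellin_weight (- (\<alpha> / 2)) t * exp (- ((norm x)\<^sup>2 / 4 / t)))" for x :: 'a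
      by simp
    show ?thesis
      unfolding gauss_avg_fourier[OF fi True] d_def[symmetric] integral_scaleR_right[symmetric] F_def
      by (simp only: scaleR_scaleR * prod.case)
  qed (simp add: F_def mellin_weight_def)
  then have "(LINT t|lborel. mellin_weight ((real DIM('a) - \<alpha>) / 2) t *\<^sub>R gauss_avg t (fourier f))
      = pi powr d *\<^sub>R (LINT t|lborel. LINT x|lborel. F (x, t))"
    by (simp only: integral_scaleR_right)
  also have "(LINT t|lborel. LINT x|lborel. F (x, t)) = (LINT x|lborel. LINT t|lborel. F (x, t))"
    using lborel_pair.Fubini_integral[of "curry F"] F by simp
  finally have "riesz_norm DIM('a) \<alpha> *\<^sub>R (LINT t|lborel. mellin_weight ((real DIM('a) - \<alpha>) / 2) t *\<^sub>R gauss_avg t (fourier f))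
      = (LINT x|lborel. (riesz_norm DIM('a) \<alpha> * pi powr d * I x) *\<^sub>R f x)"
    by (simp add: inner' mult.assoc flip: integral_scaleR_right)
  also have "\<dots> = (LINT x|lborel. (norm x) powr (- \<alpha>) *\<^sub>R f x)"
  proof (rule Bochner_Integration.integral_cong[OF refl])
    fix x
    show "(riesz_norm DIM('a) \<alpha> * pi powr d * I x) *\<^sub>R f x = (norm x) powr (- \<alpha>) *\<^sub>R f x"
    proof (cases "x \<in> K")
      case True
      then have x: "0 < norm x" using K by auto
      have "((norm x)\<^sup>2 / 4) = (norm x / 2) powr 2" using x by (simp add: power_divide)
      then have "((norm x)\<^sup>2 / 4) powr (- (\<alpha> / 2)) = (norm x / 2) powr (- \<alpha>)"
        by (simp only: powr_powr) simp
      also have "\<dots> = 2 powr \<alpha> * norm x powr (- \<alpha>)"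
        using x by (simp add: powr_divide powr_minus field_simps)
      finally have "((norm x)\<^sup>2 / 4) powr (- (\<alpha> / 2)) = 2 powr \<alpha> * norm x powr (- \<alpha>)" .
      moreover have "0 < Gamma (\<alpha> / 2)" using \<alpha> by (intro Gamma_real_pos) simp
      then have "Gamma (\<alpha> / 2) \<noteq> 0" by simp
      ultimately show ?thesis by (simp add: I_def riesz_norm_def d_def)
    qed (simp add: f0)
  qed
  finally show ?thesis .
qed

abbreviation hat_term :: "real \<Rightarrow> real \<Rightarrow> real \<Rightarrow> nat \<Rightarrow> real" where
  "hat_term lam \<alpha> s j \<equiv> lam powr (\<alpha> * real (Suc j)) * exp (- (lam ^ (2 * Suc j) * s\<^sup>2 / 2))"

definition W_hat :: "real \<Rightarrow> real \<Rightarrow> real \<Rightarrow> 'a::euclidean_space \<Rightarrow> real" where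
  "W_hat \<alpha> lam cW \<xi> = norm \<xi> powr (- \<alpha>) - cW * (2 * pi) powr (real DIM('a) / 2) *
     (\<Sum>j. hat_term lam \<alpha> (norm \<xi>) j)"

lemma W_hat_series_summable:
  assumes lam: "0 < lam" "lam < 1" and \<alpha>: "0 < \<alpha>"
  shows "summable (\<lambda>j. hat_term lam \<alpha> s j)"
proof (rule summable_comparison_test'[OF summable_powr_Suc[OF lam \<alpha>]])
  fix j
  have "0 \<le> lam ^ (2 * Suc j) * s\<^sup>2" using lam by simp
  then show "norm (hat_term lam \<alpha> s j) \<le> lam powr (\<alpha> * real (Suc j))"
    by (simp add: mult_left_le del: of_nat_Suc power_Suc)
qed

lemma continuous_on_W_hat:
  assumes lam: "0 < lam" "lam < 1" and \<alpha>: "0 < \<alpha>"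
  shows "continuous_on (UNIV - {0}) (W_hat \<alpha> lam cW :: 'a::euclidean_space \<Rightarrow> real)"
proof -
  have "uniform_limit UNIV (\<lambda>n (\<xi>::'a). \<Sum>j<n. hat_term lam \<alpha> (norm \<xi>) j)
     (\<lambda>\<xi>. \<Sum>j. hat_term lam \<alpha> (norm \<xi>) j) sequentially"
  proof (rule Weierstrass_m_test[OF _ summable_powr_Suc[OF lam \<alpha>]])
    fix j and \<xi> :: 'a
    have "0 \<le> lam ^ (2 * Suc j) * (norm \<xi>)\<^sup>2" using lam by simp
    then show "norm (hat_term lam \<alpha> (norm \<xi>) j) \<le> lam powr (\<alpha> * real (Suc j))"
      by (simp add: mult_left_le del: of_nat_Suc power_Suc)
  qed
  then have "continuous_on UNIV (\<lambda>\<xi>::'a. \<Sum>j. hat_term lam \<alpha> (norm \<xi>) j)"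
    by (rule uniform_limit_theorem[rotated]) (auto intro!: always_eventually continuous_intros)
  then show ?thesis
    unfolding W_hat_def [abs_def]
    by (intro continuous_intros) (auto intro: continuous_on_subset)
qed

lemma is_function_on_W_hat:
  fixes K :: "'a::euclidean_space set"
  assumes lam: "0 < lam" "lam < 1" and \<alpha>: "0 < \<alpha>" "\<alpha> < real DIM('a) + 2"
    and K: "compact K" "K \<subseteq> UNIV - {0}"
  shows "is_function_on (fourier_dist (function_dist (W_potential \<alpha> lam cW))) (W_hat \<alpha> lam cW) K"
  unfolding is_function_on_def
proof (intro conjI allI impI)
  have K0: "0 \<notin> K" using K by auto
  have cont: "continuous_on K (W_hat \<alpha> lam cW)"
    using continuous_on_W_hat[OF lam \<alpha>(1)] K(2) by (rule continuous_on_subset)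
  show "set_integrable lborel K (W_hat \<alpha> lam cW)"
    unfolding set_integrable_def by (rule borel_integrable_compact[OF K(1) cont])
  fix f :: "'a \<Rightarrow> complex"
  assume "smooth f" and sub: "closure {x. f x \<noteq> 0} \<subseteq> K"
  then have f: "test_on K f" using closure_subset[of "{x. f x \<noteq> 0}"] by (auto simp: test_on_def)
  then have f0: "f x = 0" if "x \<notin> K" for x using that by (simp add: test_on_def)
  have fi: "integrable lborel f" by (rule test_on_integrable[OF f K(1)])
  have fc: "continuous_on UNIV f" using \<open>smooth f\<close> by (rule smooth_continuous)
  have [measurable]: "f \<in> borel_measurable borel" using borel_measurable_integrable[OF fi] by simp
  define s where "s = (\<lambda>j (x::'a). hat_term lam \<alpha> (norm x) j)"
  have s_sum: "summable (\<lambda>j. s j x)" for x unfolding s_def by (rule W_hat_series_summable[OF lam \<alpha>(1)])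
  have s_nn: "0 \<le> s j x" for j x by (simp add: s_def)
  have s_le: "s j x \<le> lam powr (\<alpha> * real (Suc j))" for j x
  proof -
    have "0 \<le> lam ^ (2 * Suc j) * (norm x)\<^sup>2" using lam by simp
    then show ?thesis by (simp add: s_def mult_left_le del: of_nat_Suc power_Suc)
  qed
  have s_int: "integrable lborel (\<lambda>x. s j x *\<^sub>R f x)" for j
    using f0 by (intro continuous_compact_support(1)[OF _ K(1)]) (auto simp: s_def intro!: continuous_intros fc)
  have s_sums: "(\<lambda>j. LINT x|lborel. s j x *\<^sub>R f x) sums (LINT x|lborel. (\<Sum>j. s j x *\<^sub>R f x))"
    and s_int_sum: "integrable lborel (\<lambda>x. (\<Sum>j. s j x *\<^sub>R f x))"
  proof -
    have 1: "AE x in lborel. summable (\<lambda>j. norm (s j x *\<^sub>R f x))"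
      using s_sum s_nn by (auto intro!: AE_I2 summable_mult2 simp: abs_of_nonneg)
    have 2: "summable (\<lambda>j. LINT x|lborel. norm (s j x *\<^sub>R f x))"
    proof (rule summable_comparison_test')
      show "summable (\<lambda>j. lam powr (\<alpha> * real (Suc j)) * (LINT x|lborel. cmod (f x)))"
        by (intro summable_mult2 summable_powr_Suc lam \<alpha>)
      fix j
      have "(LINT x|lborel. norm (s j x *\<^sub>R f x)) \<le> (LINT x|lborel. lam powr (\<alpha> * real (Suc j)) * cmod (f x))"
        using s_nn s_le by (intro integral_mono integrable_norm s_int integrable_mult_right fi) (auto intro: mult_right_mono)
      then show "norm (LINT x|lborel. norm (s j x *\<^sub>R f x)) \<le> lam powr (\<alpha> * real (Suc j)) * (LINT x|lborel. cmod (f x))"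
        by (simp add: integral_nonneg_AE del: of_nat_Suc)
    qed
    show "(\<lambda>j. LINT x|lborel. s j x *\<^sub>R f x) sums (LINT x|lborel. (\<Sum>j. s j x *\<^sub>R f x))"
      by (rule sums_integral[OF s_int 1 2])
    show "integrable lborel (\<lambda>x. (\<Sum>j. s j x *\<^sub>R f x))"
      by (rule integrable_suminf[OF s_int 1 2])
  qed
  have coeff: "lam powr ((\<alpha> - real DIM('a)) * real (Suc j)) *\<^sub>R gauss_avg (gauss_rate lam j) (fourier f) =
      (2 * pi) powr (real DIM('a) / 2) *\<^sub>R (LINT x|lborel. s j x *\<^sub>R f x)" for j
  proof -
    have "(norm x)\<^sup>2 / (4 * gauss_rate lam j) = lam ^ (2 * Suc j) * (norm x)\<^sup>2 / 2" for x :: 'a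
      using lam by (simp add: gauss_rate_def del: power_Suc)
    then have "gauss_avg (gauss_rate lam j) (fourier f) = (LINT x|lborel. ((pi / gauss_rate lam j) powr (real DIM('a) / 2) *
        exp (- (lam ^ (2 * Suc j) * (norm x)\<^sup>2 / 2))) *\<^sub>R f x)"
      using gauss_avg_fourier[OF fi gauss_rate_pos[OF lam(1), of j]] by (simp only:)
    then show ?thesis
      unfolding s_def using gauss_rate_pi_powr[OF lam(1), of \<alpha> "real DIM('a)" j]
      by (simp only: integral_scaleR_right[symmetric] scaleR_scaleR mult.assoc[symmetric])
  qed
  have "fourier_dist (function_dist (W_potential \<alpha> lam cW)) f = (LINT x|lborel. W_potential \<alpha> lam cW x *\<^sub>R fourier f x)"
    by (simp add: fourier_dist_def function_dist_def scaleR_conv_of_real)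
  also have "\<dots> = (LINT x|lborel. norm x powr (- \<alpha>) *\<^sub>R f x)
     - cW *\<^sub>R (\<Sum>j. (2 * pi) powr (real DIM('a) / 2) *\<^sub>R (LINT x|lborel. s j x *\<^sub>R f x))"
    unfolding integral_W_potential[OF moderate_fourier[OF f K(1)] lam \<alpha> integral_fourier_eq_0[OF f K(1) K0]]
      mellin_gauss_avg_fourier[OF f K(1) K0 \<alpha>(1)] integral_norm2_fourier_eq_0[OF f K(1) K0] coeff by simp
  also have "(\<Sum>j. (2 * pi) powr (real DIM('a) / 2) *\<^sub>R (LINT x|lborel. s j x *\<^sub>R f x)) =
      (2 * pi) powr (real DIM('a) / 2) *\<^sub>R (LINT x|lborel. (\<Sum>j. s j x *\<^sub>R f x))"
    using sums_unique[OF sums_scaleR_right[OF s_sums]] by simp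
  also have "(LINT x|lborel. norm x powr (- \<alpha>) *\<^sub>R f x) - cW *\<^sub>R \<dots> =
     (LINT x|lborel. norm x powr (- \<alpha>) *\<^sub>R f x - cW *\<^sub>R (2 * pi) powr (real DIM('a) / 2) *\<^sub>R (\<Sum>j. s j x *\<^sub>R f x))"
  proof -
    have "integrable lborel (\<lambda>x. indicator K x *\<^sub>R (norm x powr (- \<alpha>) *\<^sub>R f x))"
      using K0 by (intro borel_integrable_compact K continuous_intros) (auto intro: continuous_on_subset[OF fc])
    moreover have "(\<lambda>x. indicator K x *\<^sub>R (norm x powr (- \<alpha>) *\<^sub>R f x)) = (\<lambda>x. norm x powr (- \<alpha>) *\<^sub>R f x)"
      using f0 by (auto simp: indicator_def fun_eq_iff)
    ultimately show ?thesis
      using s_int_sum by (subst Bochner_Integration.integral_diff) auto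
  qed
  also have "\<dots> = (LINT x:K|lborel. complex_of_real (W_hat \<alpha> lam cW x) * f x)"
    unfolding set_lebesgue_integral_def
  proof (rule Bochner_Integration.integral_cong[OF refl])
    fix x
    have ser: "(\<Sum>j. s j x *\<^sub>R f x) = (\<Sum>j. s j x) *\<^sub>R f x"
      by (rule suminf_scaleR_left[symmetric, OF s_sum])
    show "norm x powr (- \<alpha>) *\<^sub>R f x - cW *\<^sub>R (2 * pi) powr (real DIM('a) / 2) *\<^sub>R (\<Sum>j. s j x *\<^sub>R f x) =
       indicator K x *\<^sub>R (complex_of_real (W_hat \<alpha> lam cW x) * f x)"
    proof -
      have "W_hat \<alpha> lam cW x = norm x powr (- \<alpha>) - cW * (2 * pi) powr (real DIM('a) / 2) * (\<Sum>j. s j x)"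
        by (simp add: W_hat_def s_def)
      then have "complex_of_real (W_hat \<alpha> lam cW x) * f x =
          norm x powr (- \<alpha>) *\<^sub>R f x - cW *\<^sub>R (2 * pi) powr (real DIM('a) / 2) *\<^sub>R ((\<Sum>j. s j x) *\<^sub>R f x)"
        by (simp only: scaleR_conv_of_real[symmetric] scaleR_diff_left scaleR_scaleR mult.assoc)
      then show ?thesis
        unfolding ser using f0[of x] by (cases "x \<in> K") simp_all
    qed
  qed
  finally show "fourier_dist (function_dist (W_potential \<alpha> lam cW)) f =
      (LINT x:K|lborel. complex_of_real (W_hat \<alpha> lam cW x) * f x)" .
qed

section \<open>Growth of the potential and negativity of its Fourier transform\<close>

text \<open>
  The series enters with a negative sign and nonnegative terms, so only the Riesz kernel has to be bounded.
  Its exponent \<open>\<alpha> - d\<close> is less than \<open>2\<close>, and where it is not positive only \<open>r \<ge> 1\<close> is considered.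
\<close>

lemma W_radial_quadratic_bound:
  assumes lam: "0 < lam" "lam < 1" and cW: "0 < cW"
  shows "\<exists>C>0. \<forall>r. 1 \<le> r \<or> (real d < \<alpha> \<and> 0 < r) \<longrightarrow> \<alpha> < real d + 2 \<longrightarrow> W_radial d \<alpha> lam cW r \<le> C * (1 + r)\<^sup>2"
proof (intro exI[of _ "\<bar>riesz_const d \<alpha>\<bar> + \<bar>riesz_norm d \<alpha>\<bar> + 1"] conjI allI impI)
  fix r :: real assume r: "1 \<le> r \<or> (real d < \<alpha> \<and> 0 < r)" and \<alpha>: "\<alpha> < real d + 2"
  have r0: "0 < r" using r by (elim disjE) auto
  have sq: "1 \<le> (1 + r)\<^sup>2" using r0 by (simp add: power2_eq_square algebra_simps)
  have "riesz_kernel d \<alpha> r \<le> (\<bar>riesz_const d \<alpha>\<bar> + \<bar>riesz_norm d \<alpha>\<bar>) * (1 + r)\<^sup>2"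
  proof (cases "\<alpha> = real d")
    case True
    then have "0 \<le> ln r" "riesz_kernel d \<alpha> r = - (2 * riesz_norm d \<alpha> * ln r)" using r by (auto simp: riesz_kernel_def riesz_norm_def)
    have "ln r \<le> r" using r0 ln_le_minus_one[of r] by simp
    moreover have "2 * r \<le> (1 + r)\<^sup>2" by (simp add: power2_eq_square algebra_simps)
    ultimately have "2 * ln r \<le> (1 + r)\<^sup>2" by linarith
    then have "\<bar>riesz_norm d \<alpha>\<bar> * (2 * ln r) \<le> \<bar>riesz_norm d \<alpha>\<bar> * (1 + r)\<^sup>2" by (intro mult_left_mono) auto
    moreover have "- (2 * riesz_norm d \<alpha> * ln r) \<le> \<bar>riesz_norm d \<alpha>\<bar> * (2 * ln r)"
      using \<open>0 \<le> ln r\<close> by (cases "0 \<le> riesz_norm d \<alpha>") (auto simp: mult_nonneg_nonneg)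
    moreover have "0 \<le> \<bar>riesz_const d \<alpha>\<bar> * (1 + r)\<^sup>2" by simp
    ultimately show ?thesis unfolding \<open>riesz_kernel d \<alpha> r = _\<close> distrib_right by linarith
  next
    case False
    have "r powr (\<alpha> - real d) \<le> (1 + r)\<^sup>2"
    proof (cases "real d < \<alpha>")
      case True
      have "r powr (\<alpha> - real d) \<le> (1 + r) powr (\<alpha> - real d)" using True r0 by (intro powr_mono2) auto
      also have "\<dots> \<le> (1 + r) powr 2" using \<alpha> r0 by (intro powr_mono) auto
      finally show ?thesis using r0 by simp
    next
      case False
      then have "r powr (\<alpha> - real d) \<le> r powr 0" using r by (intro powr_mono) auto
      then show ?thesis using order_trans[OF _ sq] r0 by simp
    qed
    then have "riesz_const d \<alpha> * r powr (\<alpha> - real d) \<le> \<bar>riesz_const d \<alpha>\<bar> * (1 + r)\<^sup>2"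
      by (intro mult_mono) auto
    moreover have "0 \<le> \<bar>riesz_norm d \<alpha>\<bar> * (1 + r)\<^sup>2" by simp
    moreover have "riesz_kernel d \<alpha> r = riesz_const d \<alpha> * r powr (\<alpha> - real d)"
      using False by (simp add: riesz_kernel_def)
    ultimately show ?thesis unfolding distrib_right by linarith
  qed
  moreover have "r\<^sup>2 / 2 \<le> (1 + r)\<^sup>2" using r0 by (simp add: power2_eq_square algebra_simps)
  moreover have "0 \<le> cW * gauss_series lam (\<alpha> - real d) r" using cW gauss_series_nonneg[OF lam r0] by simp
  ultimately show "W_radial d \<alpha> lam cW r \<le> (\<bar>riesz_const d \<alpha>\<bar> + \<bar>riesz_norm d \<alpha>\<bar> + 1) * (1 + r)\<^sup>2"
    unfolding W_radial_eq distrib_right by linarith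
qed (simp add: add_nonneg_pos)

text \<open>
  The threshold is the condition that, at \<open>|\<xi>|\<^sup>2 = \<alpha>\<close>, the transform of \<open>cW exp (- |x|\<^sup>2 / 2)\<close> exceeds that of
  the Riesz kernel.
\<close>

lemma c_lower_less_iff:
  assumes \<alpha>: "0 < \<alpha>"
  shows "c_lower d \<alpha> < cW \<longleftrightarrow> \<alpha> powr (- (\<alpha> / 2)) < cW * (2 * pi) powr (real d / 2) * exp (- (\<alpha> / 2))"
proof -
  have *: "c_lower d \<alpha> = \<alpha> powr (- (\<alpha> / 2)) / ((2 * pi) powr (real d / 2) * exp (- (\<alpha> / 2)))"
    by (simp add: c_lower_def exp_minus powr_minus_divide inverse_eq_divide)
  have pos: "0 < (2 * pi) powr (real d / 2) * exp (- (\<alpha> / 2))" by simp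
  show ?thesis unfolding * pos_divide_less_eq[OF pos] by (simp add: mult.assoc)
qed

text \<open>
  Keeping one term of the series, \<open>W_hat\<close> at radius \<open>s\<close> is at most \<open>s\<^sup>-\<^sup>\<alpha> g (s l)\<close> for every power \<open>l\<close> of \<open>lam\<close>, and \<open>g\<close> is
  bounded away from \<open>0\<close> on an interval of length \<open>\<eta>\<close> to the right of its minimum \<open>\<surd>\<alpha>\<close>. The largest admissible \<open>l\<close> with
  \<open>R l \<le> \<eta>\<close> is comparable to \<open>1 / R\<close>, so \<open>s\<close> stays of order \<open>R\<close>.
\<close>

lemma W_hat_negative_on_intervals:
  assumes lam: "0 < lam" "lam < 1" and \<alpha>: "0 < \<alpha>" and cW: "0 < cW" "c_lower DIM('a::euclidean_space) \<alpha> < cW"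
  shows "\<exists>c>0. \<forall>R\<ge>1. \<exists>J. is_interval J \<and> J \<subseteq> {0<..} \<and> measure lborel J = R \<and>
     (\<forall>\<xi>::'a. norm \<xi> \<in> J \<longrightarrow> W_hat \<alpha> lam cW \<xi> < - c * R powr (- \<alpha>))"
proof -
  define c' where "c' = cW * (2 * pi) powr (real DIM('a) / 2)"
  have c': "0 < c'" using cW by (simp add: c'_def)
  define g where "g = (\<lambda>v. 1 - c' * (v powr \<alpha> * exp (- (v\<^sup>2 / 2))))"
  define v0 where "v0 = sqrt \<alpha>"
  have v0: "0 < v0" "v0\<^sup>2 = \<alpha>" using \<alpha> by (auto simp: v0_def)
  have g0: "g v0 < 0"
  proof -
    have "\<alpha> powr (\<alpha> / 2) * \<alpha> powr (- (\<alpha> / 2)) < \<alpha> powr (\<alpha> / 2) * (c' * exp (- (\<alpha> / 2)))"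
      using cW(2) \<alpha> unfolding c_lower_less_iff[OF \<alpha>] c'_def by (intro mult_strict_left_mono) auto
    moreover have "v0 powr \<alpha> = \<alpha> powr (\<alpha> / 2)" using \<alpha> by (simp add: v0_def powr_half_sqrt[symmetric] powr_powr)
    moreover have "\<alpha> powr (\<alpha> / 2) * \<alpha> powr (- (\<alpha> / 2)) = 1" using \<alpha> by (simp flip: powr_add)
    ultimately show ?thesis by (simp add: g_def v0(2) mult_ac)
  qed
  define m where "m = - g v0 / 2"
  have m: "0 < m" "g v0 < - m" using g0 by (auto simp: m_def)
  have "isCont g v0" unfolding g_def using v0(1) by (intro continuous_intros) auto
  then have "eventually (\<lambda>v. g v < - m) (at v0)"
    using m(2) by (intro order_tendstoD(2)) (auto simp: isCont_def)
  then obtain \<eta>' where \<eta>': "0 < \<eta>'" "\<And>v. v \<noteq> v0 \<Longrightarrow> dist v v0 < \<eta>' \<Longrightarrow> g v < - m"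
    unfolding eventually_at by auto
  define \<eta> where "\<eta> = \<eta>' / 2"
  have \<eta>: "0 < \<eta>" "\<And>v. v0 \<le> v \<Longrightarrow> v \<le> v0 + \<eta> \<Longrightarrow> g v < - m"
  proof -
    show "0 < \<eta>" using \<eta>'(1) by (simp add: \<eta>_def)
    fix v assume "v0 \<le> v" "v \<le> v0 + \<eta>"
    then have "dist v v0 < \<eta>'" using \<eta>'(1) by (simp add: \<eta>_def dist_real_def)
    then show "g v < - m" using \<eta>'(2)[of v] m(2) by (cases "v = v0") auto
  qed
  \<comment> \<open>The largest admissible power l of lam satisfies 1 / l <= R M.\<close>
  define M where "M = max 1 (1 / \<eta>) / lam"
  have M: "0 < M" using lam by (simp add: M_def)
  define C where "C = v0 * M + 1"
  have C: "0 < C" using v0 M by (simp add: C_def add_pos_pos)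
  show ?thesis
  proof (intro exI[of _ "m * C powr (- \<alpha>)"] conjI allI impI)
    show "0 < m * C powr (- \<alpha>)" using m C by simp
    fix R :: real assume R: "1 \<le> R"
    have "\<exists>j. R * lam ^ Suc j \<le> \<eta>"
    proof -
      obtain n where n: "lam ^ n < \<eta> / R" using real_arch_pow_inv[of "\<eta> / R" lam] \<eta>(1) R lam by auto
      have "lam ^ Suc n \<le> lam ^ n" using lam by (simp add: mult_left_le_one_le)
      then have "lam ^ Suc n \<le> \<eta> / R" using n by simp
      then show ?thesis using R by (intro exI[of _ n]) (simp add: pos_le_divide_eq mult.commute)
    qed
    then obtain j where j: "R * lam ^ Suc j \<le> \<eta>" and least: "\<And>i. i < j \<Longrightarrow> \<eta> < R * lam ^ Suc i"
      using exists_least_iff[of "\<lambda>j. R * lam ^ Suc j \<le> \<eta>"] by (auto simp: not_le simp del: power_Suc)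
    define l where "l = lam ^ Suc j"
    have l: "0 < l" using lam by (simp add: l_def)
    have l_inv: "1 / l \<le> R * M"
    proof (cases j)
      case 0
      have "1 \<le> R * max 1 (1 / \<eta>)" using R by (smt (verit) mult_le_cancel_left1 max.cobounded1)
      then show ?thesis using lam by (simp add: l_def 0 M_def divide_right_mono)
    next
      case (Suc i)
      have "\<eta> < R * lam ^ j" using least[of i] Suc by simp
      then have "1 < R * (1 / \<eta>) * lam ^ j" using \<eta>(1) by (simp add: field_simps)
      also have "\<dots> \<le> R * max 1 (1 / \<eta>) * lam ^ j" using R lam by (intro mult_right_mono mult_left_mono) auto
      finally have "1 / lam ^ j \<le> R * max 1 (1 / \<eta>)" using lam by (simp add: field_simps)
      then have "1 / lam ^ j / lam \<le> R * max 1 (1 / \<eta>) / lam" using lam by (intro divide_right_mono) auto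
      then show ?thesis by (simp add: l_def M_def mult.commute)
    qed
    define J where "J = {v0 / l .. v0 / l + R}"
    show "\<exists>J. is_interval J \<and> J \<subseteq> {0<..} \<and> measure lborel J = R \<and>
       (\<forall>\<xi>::'a. norm \<xi> \<in> J \<longrightarrow> W_hat \<alpha> lam cW \<xi> < - (m * C powr (- \<alpha>)) * R powr (- \<alpha>))"
    proof (intro exI[of _ J] conjI allI impI)
      show "is_interval J" by (simp add: J_def is_interval_cc)
      have "0 < v0 / l" using v0 l by simp
      then show "J \<subseteq> {0<..}" by (auto simp: J_def)
      show "measure lborel J = R" using R by (simp add: J_def)
      fix \<xi> :: 'a assume "norm \<xi> \<in> J"
      define s where "s = norm \<xi>"
      define v where "v = s * l"
      have sJ: "v0 / l \<le> s" "s \<le> v0 / l + R" using \<open>norm \<xi> \<in> J\<close> by (auto simp: J_def s_def)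
      have s: "0 < s" using sJ(1) \<open>0 < v0 / l\<close> by linarith
      have "v0 \<le> v" using sJ(1) l by (simp add: v_def pos_divide_le_eq)
      moreover have "v \<le> v0 + \<eta>"
      proof -
        have "v \<le> (v0 / l + R) * l" unfolding v_def using sJ(2) l by (intro mult_right_mono) auto
        also have "\<dots> = v0 + R * l" using l by (simp add: distrib_right)
        finally show ?thesis using j by (simp add: l_def)
      qed
      ultimately have gv: "g v < - m" by (rule \<eta>(2))
      define T where "T = (\<lambda>i. hat_term lam \<alpha> (norm \<xi>) i)"
      have T: "T j = s powr (- \<alpha>) * (v powr \<alpha> * exp (- (v\<^sup>2 / 2)))"
      proof -
        have "lam powr (\<alpha> * real (Suc j)) = l powr \<alpha>"
          unfolding l_def using lam by (simp only: powr_realpow[symmetric] powr_powr mult.commute)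
        moreover have "lam ^ (2 * Suc j) = l\<^sup>2" by (simp only: l_def power_mult[symmetric] mult.commute)
        moreover have "s powr (- \<alpha>) * v powr \<alpha> = l powr \<alpha>" using s l by (simp add: v_def powr_mult powr_minus)
        moreover have "l\<^sup>2 * s\<^sup>2 = v\<^sup>2" by (simp add: v_def power_mult_distrib)
        ultimately show ?thesis by (simp only: T_def s_def[symmetric] mult.assoc[symmetric])
      qed
      have "T j \<le> suminf T"
      proof -
        have "summable T" unfolding T_def by (rule W_hat_series_summable[OF lam \<alpha>])
        then show ?thesis using sum_le_suminf[of T "{j}"] by (simp add: T_def)
      qed
      then have "c' * T j \<le> c' * suminf T" using c' by (intro mult_left_mono) auto
      then have "W_hat \<alpha> lam cW \<xi> \<le> s powr (- \<alpha>) - c' * T j" by (simp add: W_hat_def T_def c'_def s_def)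
      also have "\<dots> = s powr (- \<alpha>) * g v" by (simp add: T g_def algebra_simps)
      also have "\<dots> < s powr (- \<alpha>) * (- m)" using gv s by (intro mult_strict_left_mono) auto
      also have "\<dots> \<le> (R * C) powr (- \<alpha>) * (- m)"
      proof -
        have "s \<le> v0 * (1 / l) + R" using sJ by simp
        also have "\<dots> \<le> v0 * (R * M) + R" using l_inv v0 by (intro add_right_mono mult_left_mono) auto
        finally have "s \<le> R * C" by (simp add: C_def algebra_simps)
        then have "(R * C) powr (- \<alpha>) \<le> s powr (- \<alpha>)" using s \<alpha> by (intro powr_mono2') auto
        then show ?thesis using m by simp
      qed
      finally show "W_hat \<alpha> lam cW \<xi> < - (m * C powr (- \<alpha>)) * R powr (- \<alpha>)"
        using R C by (simp add: powr_mult mult_ac)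
    qed
  qed
qed

section \<open>Autocorrelations and interaction energies\<close>

lemma moderate_gaussian:
  assumes a: "0 < a"
  shows "moderate (\<lambda>x::'a::euclidean_space. gaussian a x)"
  unfolding moderate_def
proof (intro conjI exI[of _ 1] allI)
  show "integrable lborel (\<lambda>x::'a. (1 + (norm x)\<^sup>2) *\<^sub>R gaussian a x)"
  proof (rule Bochner_Integration.integrable_bound)
    show "integrable lborel (\<lambda>x::'a. (1 + 2 / a) * gaussian (a / 2) x)"
      using a by (intro integrable_mult_right integrable_gaussian) auto
    show "AE x in lborel. norm ((1 + (norm x)\<^sup>2) *\<^sub>R gaussian a (x::'a)) \<le> norm ((1 + 2 / a) * gaussian (a / 2) x)"
    proof (intro AE_I2)
      fix x :: 'a
      define s where "s = a / 2 * (norm x)\<^sup>2"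
      have s: "0 \<le> s" "(norm x)\<^sup>2 = 2 / a * s" using a by (auto simp: s_def)
      have "s \<le> exp s" using exp_ge_add_one_self[of s] by linarith
      then have "s * exp (- s) \<le> 1" by (simp add: exp_minus field_simps)
      then have "2 / a * (s * exp (- s)) \<le> 2 / a * 1" using a by (intro mult_left_mono) auto
      moreover have "exp (- s) \<le> 1" using s by simp
      moreover have "(1 + 2 / a * s) * exp (- s) = exp (- s) + 2 / a * (s * exp (- s))" by (simp add: algebra_simps)
      ultimately have "(1 + 2 / a * s) * exp (- s) \<le> 1 + 2 / a" by linarith
      then have "(1 + 2 / a * s) * exp (- s) * exp (- s) \<le> (1 + 2 / a) * exp (- s)" by (intro mult_right_mono) auto
      moreover have "gaussian a x = exp (- s) * exp (- s)"
        using a by (simp add: s_def flip: exp_add)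
      moreover have "gaussian (a / 2) x = exp (- s)" by (simp add: s_def)
      ultimately show "norm ((1 + (norm x)\<^sup>2) *\<^sub>R gaussian a x) \<le> norm ((1 + 2 / a) * gaussian (a / 2) x)"
        using a s by (simp add: abs_mult mult.assoc)
    qed
  qed measurable
  show "norm (gaussian a x) \<le> 1" for x :: 'a using a by simp
qed measurable

text \<open>
  The energy of \<open>\<mu>\<close> for a convolution kernel is the integral of the kernel against this function, which
  replaces a double integral by a single one.
\<close>

definition autocorr :: "('a::euclidean_space \<Rightarrow> real) \<Rightarrow> 'a \<Rightarrow> real" where
  "autocorr \<mu> z = (LINT y|lborel. \<mu> (z + y) * \<mu> y)"

lemma measurable_autocorr [measurable (raw)]:
  assumes [measurable]: "\<mu> \<in> borel_measurable borel"
  shows "autocorr \<mu> \<in> borel_measurable borel"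
  unfolding autocorr_def [abs_def] by measurable

lemma shifted_norm_bound:
  fixes z y :: "'a::real_inner"
  shows "(norm z)\<^sup>2 / 4 + (norm y)\<^sup>2 / 2 \<le> (norm (z + y))\<^sup>2 + (norm y)\<^sup>2"
proof -
  have "0 \<le> (norm (z + 2 *\<^sub>R y))\<^sup>2" by simp
  then show ?thesis
    unfolding power2_norm_eq_inner by (simp add: inner_simps inner_commute algebra_simps) (use inner_ge_zero[of "z + y"] in \<open>simp add: inner_simps inner_commute\<close>)
qed

text \<open>
  Half of the joint decay in \<open>z + y\<close> and \<open>y\<close> is spent on \<open>z\<close>, half on \<open>y\<close>.
\<close>

lemma shifted_product_bound:
  fixes \<mu> :: "'a::euclidean_space \<Rightarrow> real"
  assumes \<epsilon>: "0 < \<epsilon>" and \<mu>: "\<And>x. \<bar>\<mu> x\<bar> \<le> gaussian \<epsilon> x"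
  shows "\<bar>\<mu> (z + y) * \<mu> y\<bar> \<le> gaussian (\<epsilon> / 4) z * gaussian (\<epsilon> / 2) y"
proof -
  have "\<bar>\<mu> (z + y) * \<mu> y\<bar> \<le> gaussian \<epsilon> (z + y) * gaussian \<epsilon> y"
    unfolding abs_mult by (intro mult_mono \<mu>) auto
  also have "\<dots> = exp (- (\<epsilon> * ((norm (z + y))\<^sup>2 + (norm y)\<^sup>2)))" by (simp add: algebra_simps flip: exp_add)
  also have "\<dots> \<le> exp (- (\<epsilon> * ((norm z)\<^sup>2 / 4 + (norm y)\<^sup>2 / 2)))"
    using \<epsilon> shifted_norm_bound[of z y] by (simp add: mult_left_mono)
  also have "\<dots> = gaussian (\<epsilon> / 4) z * gaussian (\<epsilon> / 2) y"
    by (simp add: algebra_simps flip: exp_add)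
  finally show ?thesis .
qed

lemma
  fixes \<mu> :: "'a::euclidean_space \<Rightarrow> real"
  assumes [measurable]: "\<mu> \<in> borel_measurable borel"
    and \<epsilon>: "0 < \<epsilon>" and \<mu>: "\<And>x. \<bar>\<mu> x\<bar> \<le> gaussian \<epsilon> x"
  shows integrable_shifted_product: "integrable lborel (\<lambda>y. \<mu> (z + y) * \<mu> y)"
    and integral_abs_shifted_product_le: "(LINT y|lborel. \<bar>\<mu> (z + y) * \<mu> y\<bar>) \<le>
       (2 * pi / \<epsilon>) powr (real DIM('a) / 2) * gaussian (\<epsilon> / 4) z"
proof -
  have g: "integrable lborel (\<lambda>y::'a. gaussian (\<epsilon> / 4) z * gaussian (\<epsilon> / 2) y)"
    using \<epsilon> by (intro integrable_mult_right integrable_gaussian) auto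
  show int: "integrable lborel (\<lambda>y. \<mu> (z + y) * \<mu> y)"
    using shifted_product_bound[OF \<epsilon> \<mu>, of z] by (intro Bochner_Integration.integrable_bound[OF g]) auto
  have "(LINT y|lborel. \<bar>\<mu> (z + y) * \<mu> y\<bar>) \<le> (LINT y|lborel. gaussian (\<epsilon> / 4) z * gaussian (\<epsilon> / 2) (y::'a))"
    by (intro integral_mono integrable_abs int g shifted_product_bound[OF \<epsilon> \<mu>])
  also have "\<dots> = (2 * pi / \<epsilon>) powr (real DIM('a) / 2) * gaussian (\<epsilon> / 4) z"
    using gaussian_integral[of "\<epsilon> / 2", where 'a='a] \<epsilon> by (simp add: has_bochner_integral_iff mult.commute)
  finally show "(LINT y|lborel. \<bar>\<mu> (z + y) * \<mu> y\<bar>) \<le> (2 * pi / \<epsilon>) powr (real DIM('a) / 2) * gaussian (\<epsilon> / 4) z" .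
qed

lemma autocorr_bound:
  fixes \<mu> :: "'a::euclidean_space \<Rightarrow> real"
  assumes "\<mu> \<in> borel_measurable borel" "0 < \<epsilon>" "\<And>x. \<bar>\<mu> x\<bar> \<le> gaussian \<epsilon> x"
  shows "\<bar>autocorr \<mu> z\<bar> \<le> (2 * pi / \<epsilon>) powr (real DIM('a) / 2) * gaussian (\<epsilon> / 4) z"
  unfolding autocorr_def by (rule order_trans[OF integral_abs_bound integral_abs_shifted_product_le[OF assms]])

lemma moderate_autocorr:
  fixes \<mu> :: "'a::euclidean_space \<Rightarrow> real"
  assumes "\<mu> \<in> borel_measurable borel" "0 < \<epsilon>" "\<And>x. \<bar>\<mu> x\<bar> \<le> gaussian \<epsilon> x"
  shows "moderate (autocorr \<mu>)"
  using assms autocorr_bound[OF assms]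
  by (intro moderate_bound[OF moderate_gaussian[of "\<epsilon> / 4"], where C = "(2 * pi / \<epsilon>) powr (real DIM('a) / 2)"]) (auto intro: measurable_autocorr)

text \<open>
  Substitute \<open>z = x - y\<close>. The Gaussian bound on \<open>\<mu>\<close> makes the double integral absolutely convergent for kernels
  that are integrable against a Gaussian.
\<close>

lemma interaction_eq_autocorr:
  fixes \<mu> k :: "'a::euclidean_space \<Rightarrow> real"
  assumes [measurable]: "\<mu> \<in> borel_measurable borel" "k \<in> borel_measurable borel"
    and \<epsilon>: "0 < \<epsilon>" and \<mu>: "\<And>x. \<bar>\<mu> x\<bar> \<le> gaussian \<epsilon> x"
    and k: "integrable lborel (\<lambda>z. k z * gaussian (\<epsilon> / 4) z)"
  shows "(LINT x|lborel. LINT y|lborel. k (x - y) * \<mu> y * \<mu> x) = (LINT z|lborel. k z * autocorr \<mu> z)"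
proof -
  define F where "F = (\<lambda>(z, y). k z * (\<mu> (z + y) * \<mu> y))"
  define G where "G = (\<lambda>(y, x). k (x - y) * \<mu> y * \<mu> x)"
  have [measurable]: "F \<in> borel_measurable (lborel \<Otimes>\<^sub>M lborel)" "G \<in> borel_measurable (lborel \<Otimes>\<^sub>M lborel)"
    unfolding F_def G_def by measurable
  have shift: "G (y, y + z) = F (z, y)" for y z by (simp add: F_def G_def add.commute mult_ac)
  have F: "integrable (lborel \<Otimes>\<^sub>M lborel) F"
  proof (rule lborel_pair.Fubini_integrable)
    show "integrable lborel (\<lambda>z. LINT y|lborel. norm (F (z, y)))"
    proof (rule Bochner_Integration.integrable_bound)
      show "integrable lborel (\<lambda>z. (2 * pi / \<epsilon>) powr (real DIM('a) / 2) * (k z * gaussian (\<epsilon> / 4) z))"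
        using k by (intro integrable_mult_right)
      show "AE z in lborel. norm (LINT y|lborel. norm (F (z, y))) \<le>
          norm ((2 * pi / \<epsilon>) powr (real DIM('a) / 2) * (k z * gaussian (\<epsilon> / 4) z))"
      proof (intro AE_I2)
        fix z
        have "(LINT y|lborel. norm (F (z, y))) = \<bar>k z\<bar> * (LINT y|lborel. \<bar>\<mu> (z + y) * \<mu> y\<bar>)"
          by (simp add: F_def abs_mult)
        also have "\<dots> \<le> \<bar>k z\<bar> * ((2 * pi / \<epsilon>) powr (real DIM('a) / 2) * gaussian (\<epsilon> / 4) z)"
          by (intro mult_left_mono integral_abs_shifted_product_le \<epsilon> \<mu>) auto
        finally show "norm (LINT y|lborel. norm (F (z, y))) \<le>
          norm ((2 * pi / \<epsilon>) powr (real DIM('a) / 2) * (k z * gaussian (\<epsilon> / 4) z))"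
          by (simp add: abs_mult mult_ac)
      qed
    qed measurable
    show "AE z in lborel. integrable lborel (\<lambda>y. F (z, y))"
      unfolding F_def using integrable_shifted_product[OF assms(1) \<epsilon> \<mu>] by (intro AE_I2) auto
  qed measurable
  have inner_F: "(LINT y|lborel. F (z, y)) = k z * autocorr \<mu> z" for z
    by (simp add: F_def autocorr_def)
  have translate: "(LINT x|lborel. f (G (y, x))) = (LINT z|lborel. f (F (z, y)))"
    if [measurable]: "f \<in> borel_measurable borel" for y and f :: "real \<Rightarrow> real"
    using lborel_integral_translate[of "\<lambda>x. f (G (y, x))" y] by (simp add: shift)
  have G: "integrable (lborel \<Otimes>\<^sub>M lborel) G"
  proof (rule lborel_pair.Fubini_integrable)
    have "integrable lborel (\<lambda>y. LINT z|lborel. norm (F (z, y)))"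
      using lborel_pair.integrable_snd[of "\<lambda>z y. norm (F (z, y))"] integrable_norm[OF F] by (simp add: case_prod_unfold)
    then show "integrable lborel (\<lambda>y. LINT x|lborel. norm (G (y, x)))"
      using translate[of norm] by simp
    have "AE y in lborel. integrable lborel (\<lambda>z. F (z, y))"
      using lborel_pair.AE_integrable_snd[of "curry F"] F by simp
    then show "AE y in lborel. integrable lborel (\<lambda>x. G (y, x))"
    proof eventually_elim
      fix y assume "integrable lborel (\<lambda>z. F (z, y))"
      then have "integrable (distr lborel borel ((+) (- y))) (\<lambda>z. F (z, y))" by (simp add: lborel_distr_plus)
      then have "integrable lborel (\<lambda>x. F (- y + x, y))" by (subst (asm) integrable_distr_eq) auto
      then show "integrable lborel (\<lambda>x. G (y, x))" using shift[of y "- y + _"] by simp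
    qed
  qed measurable
  have "(LINT x|lborel. LINT y|lborel. k (x - y) * \<mu> y * \<mu> x) = (LINT x|lborel. LINT y|lborel. G (y, x))"
    by (simp add: G_def)
  also have "\<dots> = (LINT y|lborel. LINT x|lborel. G (y, x))"
    using lborel_pair.Fubini_integral[of "curry G"] G by simp
  also have "\<dots> = (LINT y|lborel. LINT z|lborel. F (z, y))"
    using translate[of "\<lambda>r. r"] by simp
  also have "\<dots> = (LINT z|lborel. LINT y|lborel. F (z, y))"
    using lborel_pair.Fubini_integral[of "curry F"] F by simp
  also have "\<dots> = (LINT z|lborel. k z * autocorr \<mu> z)" by (simp add: inner_F)
  finally show "(LINT x|lborel. LINT y|lborel. k (x - y) * \<mu> y * \<mu> x) = (LINT z|lborel. k z * autocorr \<mu> z)" .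
qed

lemma integrable_of_gaussian_bound:
  fixes \<mu> :: "'a::euclidean_space \<Rightarrow> real"
  assumes [measurable]: "\<mu> \<in> borel_measurable borel"
    and \<epsilon>: "0 < \<epsilon>" and \<mu>: "\<And>x. \<bar>\<mu> x\<bar> \<le> gaussian \<epsilon> x"
  shows "integrable lborel \<mu>"
  using \<mu> by (intro Bochner_Integration.integrable_bound[OF integrable_gaussian[OF \<epsilon>]]) auto

lemma integral_autocorr:
  fixes \<mu> :: "'a::euclidean_space \<Rightarrow> real"
  assumes \<mu>: "\<mu> \<in> borel_measurable borel" "0 < \<epsilon>" "\<And>x. \<bar>\<mu> x\<bar> \<le> gaussian \<epsilon> x"
  shows "integral\<^sup>L lborel (autocorr \<mu>) = (integral\<^sup>L lborel \<mu>)\<^sup>2"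
  using interaction_eq_autocorr[OF \<mu>(1) _ \<mu>(2,3), of "\<lambda>_. 1"] \<mu>(2) integrable_gaussian[of "\<epsilon> / 4", where 'a='a]
  by (simp add: power2_eq_square)

text \<open>
  This is \<open>|\<integral> \<mu> x exp (\<i> x \<bullet> \<xi>) dx|\<^sup>2\<close>, by the addition theorem for the cosine.
\<close>

lemma integral_cos_autocorr_nonneg:
  fixes \<mu> :: "'a::euclidean_space \<Rightarrow> real"
  assumes \<mu>: "\<mu> \<in> borel_measurable borel" "0 < \<epsilon>" "\<And>x. \<bar>\<mu> x\<bar> \<le> gaussian \<epsilon> x"
  shows "0 \<le> (LINT z|lborel. cos (z \<bullet> \<xi>) * autocorr \<mu> z)"
proof -
  have [measurable]: "\<mu> \<in> borel_measurable borel" by fact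
  have g: "integrable lborel (\<lambda>z::'a. cos (z \<bullet> \<xi>) * gaussian (\<epsilon> / 4) z)"
    using \<mu>(2) by (intro Bochner_Integration.integrable_bound[OF integrable_gaussian[of "\<epsilon> / 4"]]) (auto simp: abs_mult mult_left_le_one_le)
  have int: "integrable lborel \<mu>" by (rule integrable_of_gaussian_bound[OF \<mu>])
  have c: "integrable lborel (\<lambda>x. cos (x \<bullet> \<xi>) * \<mu> x)" and s: "integrable lborel (\<lambda>x. sin (x \<bullet> \<xi>) * \<mu> x)"
    by (intro Bochner_Integration.integrable_bound[OF int]; auto simp: abs_mult mult_left_le_one_le)+
  define A where "A = (LINT x|lborel. cos (x \<bullet> \<xi>) * \<mu> x)"
  define B where "B = (LINT x|lborel. sin (x \<bullet> \<xi>) * \<mu> x)"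
  have "(LINT z|lborel. cos (z \<bullet> \<xi>) * autocorr \<mu> z) = (LINT x|lborel. LINT y|lborel. cos ((x - y) \<bullet> \<xi>) * \<mu> y * \<mu> x)"
    by (subst interaction_eq_autocorr[OF _ _ \<mu>(2,3), where k = "\<lambda>z. cos (z \<bullet> \<xi>)"]) (use g in auto)
  also have "\<dots> = (LINT x|lborel. A * (cos (x \<bullet> \<xi>) * \<mu> x) + B * (sin (x \<bullet> \<xi>) * \<mu> x))"
  proof (rule Bochner_Integration.integral_cong[OF refl])
    fix x
    have "(LINT y|lborel. cos ((x - y) \<bullet> \<xi>) * \<mu> y * \<mu> x) =
      (LINT y|lborel. (cos (x \<bullet> \<xi>) * \<mu> x) * (cos (y \<bullet> \<xi>) * \<mu> y) + (sin (x \<bullet> \<xi>) * \<mu> x) * (sin (y \<bullet> \<xi>) * \<mu> y))"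
      by (simp add: inner_diff_left cos_diff algebra_simps)
    also have "\<dots> = (cos (x \<bullet> \<xi>) * \<mu> x) * A + (sin (x \<bullet> \<xi>) * \<mu> x) * B"
      using c s by (simp add: A_def B_def)
    finally show "(LINT y|lborel. cos ((x - y) \<bullet> \<xi>) * \<mu> y * \<mu> x) = A * (cos (x \<bullet> \<xi>) * \<mu> x) + B * (sin (x \<bullet> \<xi>) * \<mu> x)"
      by (simp add: mult.commute)
  qed
  also have "\<dots> = A * A + B * B" using c s by (simp add: A_def B_def)
  finally show ?thesis by simp
qed

text \<open>
  A Gaussian is a positive combination of the functions \<open>z \<mapsto> cos (z \<bullet> \<xi>)\<close>.
\<close>

lemma gauss_avg_autocorr_nonneg:
  fixes \<mu> :: "'a::euclidean_space \<Rightarrow> real"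
  assumes \<mu>: "\<mu> \<in> borel_measurable borel" "0 < \<epsilon>" "\<And>x. \<bar>\<mu> x\<bar> \<le> gaussian \<epsilon> x" and t: "0 < t"
  shows "0 \<le> gauss_avg t (autocorr \<mu>)"
proof -
  define w where "w = autocorr \<mu>"
  have w: "integrable lborel w" unfolding w_def by (rule moderate_integrable[OF moderate_autocorr[OF \<mu>]])
  have [measurable]: "w \<in> borel_measurable borel" using borel_measurable_integrable[OF w] by simp
  \<comment> \<open>The Fourier transform of a Gaussian of rate 1 / (4 t) is a multiple of the Gaussian of rate t.\<close>
  define t' where "t' = 1 / (4 * t)"
  have t': "0 < t'" using t by (simp add: t'_def)
  define c where "c = (pi / t') powr (real DIM('a) / 2)"
  have c: "0 < c" using t' by (simp add: c_def)
  define F where "F = (\<lambda>(z, \<xi>::'a). w z * (gaussian t' \<xi> * cos (\<xi> \<bullet> z)))"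
  have [measurable]: "F \<in> borel_measurable (lborel \<Otimes>\<^sub>M lborel)" unfolding F_def by measurable
  have g: "integrable lborel (\<lambda>\<xi>::'a. gaussian t' \<xi>)" using t' by auto
  have F_le: "norm (F (z, \<xi>)) \<le> \<bar>w z\<bar> * gaussian t' \<xi>" for z \<xi>
    by (auto simp: F_def abs_mult intro!: mult_left_mono mult_right_le_one_le)
  have F_int: "integrable lborel (\<lambda>\<xi>. F (z, \<xi>))" for z
    using F_le by (intro Bochner_Integration.integrable_bound[OF integrable_mult_right[OF g, of "\<bar>w z\<bar>"]]) auto
  have F: "integrable (lborel \<Otimes>\<^sub>M lborel) F"
  proof (rule lborel_pair.Fubini_integrable)
    show "integrable lborel (\<lambda>z. LINT \<xi>|lborel. norm (F (z, \<xi>)))"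
    proof (rule Bochner_Integration.integrable_bound)
      show "integrable lborel (\<lambda>z. \<bar>w z\<bar> * (LINT \<xi>|lborel. gaussian t' (\<xi>::'a)))" using w by auto
      have "(LINT \<xi>|lborel. norm (F (z, \<xi>))) \<le> (LINT \<xi>|lborel. \<bar>w z\<bar> * gaussian t' (\<xi>::'a))" for z
        by (intro integral_mono integrable_norm F_int integrable_mult_right g F_le)
      then show "AE z in lborel. norm (LINT \<xi>|lborel. norm (F (z, \<xi>))) \<le> norm (\<bar>w z\<bar> * (LINT \<xi>|lborel. gaussian t' (\<xi>::'a)))"
        by (intro AE_I2) (simp add: integral_nonneg_AE abs_mult)
    qed measurable
  qed (use F_int in auto)
  have "(LINT \<xi>|lborel. F (z, \<xi>)) = c * (gaussian t z * w z)" for z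
  proof -
    have "(LINT \<xi>|lborel. F (z, \<xi>)) = w z * (c * exp (- ((norm z)\<^sup>2 / (4 * t'))))"
      using gaussian_cos_integral[OF t', of z] by (simp add: F_def has_bochner_integral_iff c_def)
    moreover have "(norm z)\<^sup>2 / (4 * t') = t * (norm z)\<^sup>2" using t by (simp add: t'_def)
    ultimately show ?thesis by (simp only: mult_ac)
  qed
  then have "c * gauss_avg t w = (LINT z|lborel. LINT \<xi>|lborel. F (z, \<xi>))"
    by (simp add: gauss_avg_def)
  also have "\<dots> = (LINT \<xi>|lborel. LINT z|lborel. F (z, \<xi>))"
    using lborel_pair.Fubini_integral[of "curry F"] F by simp
  also have "\<dots> = (LINT \<xi>|lborel. gaussian t' \<xi> * (LINT z|lborel. cos (z \<bullet> \<xi>) * w z))"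
  proof -
    have "F (z, \<xi>) = gaussian t' \<xi> * (cos (z \<bullet> \<xi>) * w z)" for z \<xi>
      by (simp add: F_def inner_commute mult_ac)
    then show ?thesis by (simp only: integral_mult_right_zero)
  qed
  also have "\<dots> \<ge> 0"
    unfolding w_def by (intro integral_nonneg_AE AE_I2 mult_nonneg_nonneg integral_cos_autocorr_nonneg[OF \<mu>]) auto
  finally show ?thesis using c by (simp add: w_def zero_le_mult_iff)
qed

text \<open>
  For mean \<open>0\<close> the Gaussian average of the autocorrelation vanishes at \<open>t = 0\<close> and is nonnegative for
  \<open>t > 0\<close>, and the second moment is minus its derivative at \<open>0\<close>.
\<close>

lemma integral_norm2_autocorr_nonpos:
  fixes \<mu> :: "'a::euclidean_space \<Rightarrow> real"
  assumes \<mu>: "\<mu> \<in> borel_measurable borel" "0 < \<epsilon>" "\<And>x. \<bar>\<mu> x\<bar> \<le> gaussian \<epsilon> x"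
    and mean: "integral\<^sup>L lborel \<mu> = 0"
  shows "(LINT z|lborel. (norm z)\<^sup>2 * autocorr \<mu> z) \<le> 0"
proof -
  have "(\<lambda>n. real (Suc n) * (0 - gauss_avg (inverse (real (Suc n))) (autocorr \<mu>)))
     \<longlonglongrightarrow> (LINT z|lborel. (norm z)\<^sup>2 * autocorr \<mu> z)"
    using gauss_avg_difference_quotient_tendsto[OF moderate_autocorr[OF \<mu>]] by (simp add: integral_autocorr[OF \<mu>] mean)
  moreover have "real (Suc n) * (0 - gauss_avg (inverse (real (Suc n))) (autocorr \<mu>)) \<le> 0" for n
    using gauss_avg_autocorr_nonneg[OF \<mu>, of "inverse (real (Suc n))"] by (intro mult_nonneg_nonpos) auto
  ultimately show ?thesis by (intro LIMSEQ_le_const2) auto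
qed

lemma lborel_integral_scale:
  fixes f :: "'a::euclidean_space \<Rightarrow> 'b::{banach,second_countable_topology}"
  assumes c: "c \<noteq> 0" and [measurable]: "f \<in> borel_measurable borel"
  shows "(LINT x|lborel. f (c *\<^sub>R x)) = integral\<^sup>L lborel f /\<^sub>R \<bar>c\<bar> ^ DIM('a)"
proof -
  have "integral\<^sup>L lborel f = integral\<^sup>L (density (distr lborel borel (\<lambda>x::'a. 0 + c *\<^sub>R x)) (\<lambda>_. \<bar>c\<bar> ^ DIM('a))) f"
    using lborel_affine[OF c, of "0::'a"] by simp
  also have "\<dots> = \<bar>c\<bar> ^ DIM('a) *\<^sub>R (LINT x|lborel. f (c *\<^sub>R x))"
    by (subst integral_density) (auto simp: integral_distr)
  finally show ?thesis using c by simp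
qed

lemma autocorr_scale:
  fixes \<mu> :: "'a::euclidean_space \<Rightarrow> real"
  assumes c: "0 < c" and [measurable]: "\<mu> \<in> borel_measurable borel"
  shows "autocorr (\<lambda>x. \<mu> (x /\<^sub>R c)) z = c ^ DIM('a) * autocorr \<mu> (z /\<^sub>R c)"
  using lborel_integral_scale[of "inverse c" "\<lambda>y. \<mu> (z /\<^sub>R c + y) * \<mu> y"] c
  by (simp add: autocorr_def scaleR_add_right power_inverse)

lemma gauss_avg_autocorr_scale:
  fixes \<mu> :: "'a::euclidean_space \<Rightarrow> real"
  assumes c: "0 < c" and [measurable]: "\<mu> \<in> borel_measurable borel"
  shows "gauss_avg t (autocorr (\<lambda>x. \<mu> (x /\<^sub>R c))) = c ^ (2 * DIM('a)) * gauss_avg (t * c\<^sup>2) (autocorr \<mu>)"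
proof -
  have "gauss_avg t (autocorr (\<lambda>x. \<mu> (x /\<^sub>R c))) =
     (LINT z|lborel. c ^ DIM('a) * (gaussian (t * c\<^sup>2) (z /\<^sub>R c) * autocorr \<mu> (z /\<^sub>R c)))"
    unfolding gauss_avg_def autocorr_scale[OF assms] using c
    by (intro Bochner_Integration.integral_cong) (auto simp: power_mult_distrib power_inverse field_simps)
  also have "\<dots> = c ^ DIM('a) * (c ^ DIM('a) * gauss_avg (t * c\<^sup>2) (autocorr \<mu>))"
    using lborel_integral_scale[of "inverse c" "\<lambda>z. gaussian (t * c\<^sup>2) z * autocorr \<mu> z"] c
    by (simp add: gauss_avg_def power_inverse)
  finally show ?thesis by (simp add: power_add mult_2)
qed

lemma mellin_scale:
  assumes c: "0 < c"
  shows "(LINT t|lborel. mellin_weight p t * H (t * c\<^sup>2)) = c powr (- 2 * p) * (LINT t|lborel. mellin_weight p t * H t)"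
proof -
  have "(LINT t|lborel. mellin_weight p t * H t) = c\<^sup>2 * (LINT t|lborel. mellin_weight p (0 + c\<^sup>2 * t) * H (0 + c\<^sup>2 * t))"
    using c lborel_integral_real_affine[of "c\<^sup>2" "\<lambda>t. mellin_weight p t * H t" 0] by simp
  also have "\<dots> = c\<^sup>2 * (LINT t|lborel. (c\<^sup>2) powr (p - 1) * (mellin_weight p t * H (t * c\<^sup>2)))"
    using c by (intro arg_cong[where f = "(*) (c\<^sup>2)"] Bochner_Integration.integral_cong)
      (auto simp: mellin_weight_def indicator_def powr_mult zero_less_mult_iff mult.commute)
  also have "\<dots> = (c\<^sup>2) powr p * (LINT t|lborel. mellin_weight p t * H (t * c\<^sup>2))"
    using c by (simp add: powr_diff)
  finally have *: "(LINT t|lborel. mellin_weight p t * H t) = (c\<^sup>2) powr p * (LINT t|lborel. mellin_weight p t * H (t * c\<^sup>2))" .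
  have "c powr (- 2 * p) * (c\<^sup>2) powr p = 1"
  proof -
    have "(c\<^sup>2) powr p = (c powr 2) powr p" using c by simp
    then show ?thesis using c by (simp add: powr_powr flip: powr_add del: powr_numeral)
  qed
  then show ?thesis unfolding * by (simp only: mult.assoc[symmetric] mult_1)
qed

section \<open>Infinitesimal concavity\<close>

text \<open>
  Up to a constant factor, the Gaussian average at \<open>t\<close> of the autocorrelation of
  \<open>exp (- 2 \<eta> |x|\<^sup>2) sin (x \<bullet> \<xi>)\<close> in dimension \<open>2 h\<close>, where \<open>s = |\<xi>|\<^sup>2 / 4\<close>. The subtracted exponential, due to the
  overlap of the two spectral peaks at \<open>\<xi>\<close> and \<open>- \<xi>\<close>, makes it vanish at \<open>t = 0\<close>.
\<close>

definition sine_profile :: "real \<Rightarrow> real \<Rightarrow> real \<Rightarrow> real \<Rightarrow> real" where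
  "sine_profile h s \<eta> t = (pi / (t + \<eta>)) powr h * (exp (- (s / (t + \<eta>))) - exp (- (s / \<eta>)))"

text \<open>
  Centre the integration variable at \<open>- z / 2\<close>: the two Gaussians then multiply to one Gaussian in \<open>z\<close> and one in
  \<open>y\<close>, and the product of sines becomes \<open>(cos (z \<bullet> \<xi>) - cos (2 y \<bullet> \<xi>)) / 2\<close>.
\<close>

lemma autocorr_gaussian_sine:
  fixes \<xi> :: "'a::euclidean_space"
  assumes \<epsilon>: "0 < \<epsilon>"
  shows "autocorr (\<lambda>x. gaussian \<epsilon> x * sin (x \<bullet> \<xi>)) z =
    1 / 2 * (pi / (2 * \<epsilon>)) powr (real DIM('a) / 2) * gaussian (\<epsilon> / 2) z * (cos (z \<bullet> \<xi>) - exp (- ((norm \<xi>)\<^sup>2 / (2 * \<epsilon>))))"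
proof -
  let ?\<nu> = "\<lambda>x. gaussian \<epsilon> x * sin (x \<bullet> \<xi>)"
  let ?c = "(pi / (2 * \<epsilon>)) powr (real DIM('a) / 2)"
  have pw: "?\<nu> (z + (- (1/2) *\<^sub>R z + y)) * ?\<nu> (- (1/2) *\<^sub>R z + y) = 1 / 2 * gaussian (\<epsilon> / 2) z *
     (cos (z \<bullet> \<xi>) * gaussian (2 * \<epsilon>) y - gaussian (2 * \<epsilon>) y * cos (y \<bullet> (2 *\<^sub>R \<xi>)))" for y
  proof -
    define A where "A = (1/2) *\<^sub>R z + y"
    define B where "B = - (1/2) *\<^sub>R z + y"
    have AB: "z + B = A" by (simp add: A_def B_def algebra_simps flip: scaleR_add_left)
    have "(norm A)\<^sup>2 + (norm B)\<^sup>2 = 2 * (norm y)\<^sup>2 + (norm z)\<^sup>2 / 2"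
      unfolding power2_norm_eq_inner A_def B_def by (simp add: inner_simps inner_commute field_simps)
    moreover have "exp (- (\<epsilon> * a)) * exp (- (\<epsilon> * b)) = exp (- (\<epsilon> * (a + b)))" for a b
      by (simp add: distrib_left flip: exp_add)
    ultimately have "gaussian \<epsilon> A * gaussian \<epsilon> B = exp (- (\<epsilon> * (2 * (norm y)\<^sup>2 + (norm z)\<^sup>2 / 2)))"
      by (simp only:)
    also have "\<dots> = gaussian (\<epsilon> / 2) z * gaussian (2 * \<epsilon>) y"
      by (simp add: algebra_simps flip: exp_add)
    finally have 1: "gaussian \<epsilon> A * gaussian \<epsilon> B = gaussian (\<epsilon> / 2) z * gaussian (2 * \<epsilon>) y" .
    have "A \<bullet> \<xi> - B \<bullet> \<xi> = z \<bullet> \<xi>" "A \<bullet> \<xi> + B \<bullet> \<xi> = y \<bullet> (2 *\<^sub>R \<xi>)"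
      by (simp_all add: A_def B_def inner_simps)
    then have 2: "sin (A \<bullet> \<xi>) * sin (B \<bullet> \<xi>) = (cos (z \<bullet> \<xi>) - cos (y \<bullet> (2 *\<^sub>R \<xi>))) / 2"
      by (simp only: sin_times_sin)
    have "?\<nu> A * ?\<nu> B = (gaussian \<epsilon> A * gaussian \<epsilon> B) * (sin (A \<bullet> \<xi>) * sin (B \<bullet> \<xi>))"
      by (simp add: mult_ac)
    then show ?thesis unfolding B_def[symmetric] AB 1 2 by (simp add: field_simps)
  qed
  have g: "has_bochner_integral lborel (\<lambda>y::'a. gaussian (2 * \<epsilon>) y) ?c"
    using \<epsilon> by (intro gaussian_integral) simp
  have gc: "has_bochner_integral lborel (\<lambda>y. gaussian (2 * \<epsilon>) y * cos (y \<bullet> (2 *\<^sub>R \<xi>))) (?c * exp (- ((norm \<xi>)\<^sup>2 / (2 * \<epsilon>))))"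
    using gaussian_cos_integral[of "2 * \<epsilon>" "2 *\<^sub>R \<xi>"] \<epsilon> by (simp add: power_mult_distrib)
  have "autocorr ?\<nu> z = (LINT y|lborel. ?\<nu> (z + (- (1/2) *\<^sub>R z + y)) * ?\<nu> (- (1/2) *\<^sub>R z + y))"
    unfolding autocorr_def by (rule lborel_integral_translate[symmetric]) measurable
  also have "\<dots> = 1 / 2 * gaussian (\<epsilon> / 2) z * (cos (z \<bullet> \<xi>) * ?c - ?c * exp (- ((norm \<xi>)\<^sup>2 / (2 * \<epsilon>))))"
    unfolding pw by (intro has_bochner_integral_integral_eq has_bochner_integral_mult_right has_bochner_integral_diff g gc)
  finally show ?thesis by (simp add: algebra_simps)
qed

lemma gauss_avg_gaussian_sine:
  fixes \<xi> :: "'a::euclidean_space"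
  assumes \<eta>: "0 < \<eta>" and t: "0 \<le> t"
  shows "gauss_avg t (autocorr (\<lambda>x. gaussian (2 * \<eta>) x * sin (x \<bullet> \<xi>))) =
    1 / 2 * (pi / (4 * \<eta>)) powr (real DIM('a) / 2) * sine_profile (real DIM('a) / 2) ((norm \<xi>)\<^sup>2 / 4) \<eta> t"
proof -
  let ?c = "1 / 2 * (pi / (4 * \<eta>)) powr (real DIM('a) / 2)"
  let ?h = "real DIM('a) / 2"
  define s where "s = (norm \<xi>)\<^sup>2 / 4"
  have t\<eta>: "0 < t + \<eta>" using assms by simp
  have g: "has_bochner_integral lborel (\<lambda>z::'a. gaussian (t + \<eta>) z) ((pi / (t + \<eta>)) powr ?h)"
    using t\<eta> by (rule gaussian_integral)
  have gc: "has_bochner_integral lborel (\<lambda>z. gaussian (t + \<eta>) z * cos (z \<bullet> \<xi>)) ((pi / (t + \<eta>)) powr ?h * exp (- (s / (t + \<eta>))))"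
    using gaussian_cos_integral[OF t\<eta>, of \<xi>] by (simp add: s_def)
  have "gaussian t z *\<^sub>R autocorr (\<lambda>x. gaussian (2 * \<eta>) x * sin (x \<bullet> \<xi>)) z =
     ?c * (gaussian (t + \<eta>) z * cos (z \<bullet> \<xi>) - gaussian (t + \<eta>) z * exp (- (s / \<eta>)))" for z
  proof -
    have e: "gaussian (t + \<eta>) z = gaussian t z * gaussian \<eta> z"
      by (simp add: distrib_right flip: exp_add)
    have a: "autocorr (\<lambda>x. gaussian (2 * \<eta>) x * sin (x \<bullet> \<xi>)) z =
        ?c * gaussian \<eta> z * (cos (z \<bullet> \<xi>) - exp (- (s / \<eta>)))"
      using autocorr_gaussian_sine[of "2 * \<eta>" \<xi> z] \<eta> by (simp add: s_def)
    show ?thesis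
      unfolding e a real_scaleR_def by (simp add: right_diff_distrib left_diff_distrib mult_ac)
  qed
  then have "gauss_avg t (autocorr (\<lambda>x. gaussian (2 * \<eta>) x * sin (x \<bullet> \<xi>))) =
     (LINT z|lborel. ?c * (gaussian (t + \<eta>) z * cos (z \<bullet> \<xi>) - gaussian (t + \<eta>) z * exp (- (s / \<eta>))))"
    unfolding gauss_avg_def by (simp only:)
  also have "\<dots> = ?c * ((pi / (t + \<eta>)) powr ?h * exp (- (s / (t + \<eta>))) - (pi / (t + \<eta>)) powr ?h * exp (- (s / \<eta>)))"
    by (intro has_bochner_integral_integral_eq has_bochner_integral_mult_right has_bochner_integral_mult_left has_bochner_integral_diff g gc)
  finally show ?thesis by (simp add: sine_profile_def s_def right_diff_distrib)
qed

text \<open>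
  Bounds uniform in \<open>\<eta>\<close>, to pass to the limit \<open>\<eta> \<rightarrow> 0\<close> under the Mellin integral: the power bound for large
  \<open>t\<close>, the linear bound for small \<open>t\<close>. The latter comes from the mean value theorem for \<open>u \<mapsto> exp (- s / u)\<close>, as
  \<open>u\<^sup>-\<^sup>h\<^sup>-\<^sup>2 exp (- s / u)\<close> is bounded on \<open>u > 0\<close>.
\<close>

lemma sine_profile_bounds:
  assumes \<eta>: "0 < \<eta>" and t: "0 < t" and s: "0 < s" and h: "0 \<le> h"
  shows "0 \<le> sine_profile h s \<eta> t"
    and "sine_profile h s \<eta> t \<le> (pi / t) powr h"
    and "sine_profile h s \<eta> t \<le>
        pi powr h * s * ((2 * (h + 2)) powr (h + 2) * exp (- (h + 2)) / (2 * s) powr (h + 2)) * t"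
proof -
  have "s / (t + \<eta>) \<le> s / \<eta>" using \<eta> t s by (intro divide_left_mono) auto
  then show "0 \<le> sine_profile h s \<eta> t" by (simp add: sine_profile_def)
  have "(pi / (t + \<eta>)) powr h \<le> (pi / t) powr h"
    using \<eta> t h by (intro powr_mono2 divide_left_mono) auto
  moreover have "exp (- (s / (t + \<eta>))) - exp (- (s / \<eta>)) \<le> 1"
  proof -
    have "exp (- (s / (t + \<eta>))) \<le> 1" using \<eta> t s by simp
    moreover have "0 < exp (- (s / \<eta>))" by simp
    ultimately show ?thesis by linarith
  qed
  ultimately have "sine_profile h s \<eta> t \<le> (pi / t) powr h * 1"
    unfolding sine_profile_def using \<open>s / (t + \<eta>) \<le> s / \<eta>\<close> by (intro mult_mono) auto
  then show "sine_profile h s \<eta> t \<le> (pi / t) powr h" by simp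
  have der: "((\<lambda>u. exp (- (s / u))) has_real_derivative exp (- (s / u)) * (s / u\<^sup>2)) (at u)" if "0 < u" for u
    using that by (auto intro!: derivative_eq_intros simp: power2_eq_square)
  have "\<exists>u. \<eta> < u \<and> u < t + \<eta> \<and> exp (- (s / (t + \<eta>))) - exp (- (s / \<eta>)) = (t + \<eta> - \<eta>) * (exp (- (s / u)) * (s / u\<^sup>2))"
    using \<eta> t by (intro MVT2 der) auto
  then obtain u where u: "\<eta> < u" "u < t + \<eta>" "exp (- (s / (t + \<eta>))) - exp (- (s / \<eta>)) = t * (exp (- (s / u)) * (s / u\<^sup>2))"
    by auto
  have u0: "0 < u" using u \<eta> by simp
  have "sine_profile h s \<eta> t \<le> (pi / u) powr h * (t * (exp (- (s / u)) * (s / u\<^sup>2)))"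
    unfolding sine_profile_def u(3) using u u0 h s t by (intro mult_right_mono powr_mono2 divide_left_mono) auto
  also have "\<dots> = pi powr h * s * (exp (- (s / u)) * u powr (- (h + 2))) * t"
  proof -
    have "u powr (- (h + 2)) = u powr (- h) / u\<^sup>2" using u0 by (simp add: powr_diff)
    then show ?thesis using u0 by (simp add: powr_divide powr_minus_divide)
  qed
  also have "\<dots> \<le> pi powr h * s * ((2 * (h + 2)) powr (h + 2) * exp (- (h + 2)) / (2 * s) powr (h + 2)) * t"
  proof -
    \<comment> \<open>This choice turns exp (- s / u) into a Gaussian in v.\<close>
    define v where "v = sqrt (2 * s / u)"
    have v: "0 < v" "v\<^sup>2 = 2 * s / u" using s u0 by (auto simp: v_def)
    have "v powr (2 * (h + 2)) = (2 * s / u) powr (h + 2)"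
    proof -
      have "v powr (2 * (h + 2)) = (v powr 2) powr (h + 2)" by (simp only: powr_powr)
      then show ?thesis using v by simp
    qed
    also have "(2 * s / u) powr a = (2 * s) powr a * u powr (- a)" for a
      using s u0 by (simp add: powr_divide powr_minus_divide)
    finally have v_powr: "v powr (2 * (h + 2)) = (2 * s) powr (h + 2) * u powr (- (h + 2))" .
    have "v powr (2 * q) * exp (- (v\<^sup>2 / 2)) \<le> (2 * q) powr q * exp (- q)" if "0 < q" for q
      using powr_times_gaussian_le[of "2 * q" v] that v(1) by simp
    from this[of "h + 2"] have "v powr (2 * (h + 2)) * exp (- (s / u)) \<le> (2 * (h + 2)) powr (h + 2) * exp (- (h + 2))"
      using h v(2) by simp
    then have "(2 * s) powr (h + 2) * (exp (- (s / u)) * u powr (- (h + 2))) \<le> (2 * (h + 2)) powr (h + 2) * exp (- (h + 2))"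
      unfolding v_powr by (simp only: mult_ac)
    moreover have "0 < (2 * s) powr (h + 2)" using s by simp
    ultimately have "exp (- (s / u)) * u powr (- (h + 2)) \<le> (2 * (h + 2)) powr (h + 2) * exp (- (h + 2)) / (2 * s) powr (h + 2)"
      by (simp add: pos_le_divide_eq mult.commute)
    then show ?thesis using s t by (intro mult_right_mono mult_left_mono) auto
  qed
  finally show "sine_profile h s \<eta> t \<le>
        pi powr h * s * ((2 * (h + 2)) powr (h + 2) * exp (- (h + 2)) / (2 * s) powr (h + 2)) * t" .
qed

lemma sine_profile_tendsto:
  assumes t: "0 < t" and s: "0 < s"
  shows "(\<lambda>n. sine_profile h s (inverse (real (Suc n))) t) \<longlonglongrightarrow> (pi / t) powr h * exp (- (s / t))"
proof -
  have "(\<lambda>n. exp (- (s / inverse (real (Suc n))))) \<longlonglongrightarrow> 0"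
    using s by real_asymp
  then have "(\<lambda>n. sine_profile h s (inverse (real (Suc n))) t) \<longlonglongrightarrow> (pi / (t + 0)) powr h * (exp (- (s / (t + 0))) - 0)"
    unfolding sine_profile_def using t
    by (intro tendsto_mult tendsto_powr tendsto_divide tendsto_add tendsto_const LIMSEQ_inverse_real_of_nat tendsto_diff tendsto_exp tendsto_minus) auto
  then show ?thesis by simp
qed

lemma mellin_sine_profile_tendsto:
  assumes p: "-1 < p" "p < h" and h: "0 \<le> h" and s: "0 < s"
  shows "(\<lambda>n. LINT t|lborel. mellin_weight p t * sine_profile h s (inverse (real (Suc n))) t)
     \<longlonglongrightarrow> pi powr h * (Gamma (h - p) * s powr (- (h - p)))"
proof -
  define C where "C = pi powr h * s * ((2 * (h + 2)) powr (h + 2) * exp (- (h + 2)) / (2 * s) powr (h + 2))"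
  have C: "0 \<le> C" using s by (simp add: C_def)
  have lim: "has_bochner_integral lborel (\<lambda>t. pi powr h * (mellin_weight (- (h - p)) t * exp (- (s / t)))) (pi powr h * (Gamma (h - p) * s powr (- (h - p))))"
    using p s by (intro has_bochner_integral_mult_right inverse_Gamma_has_bochner_integral) auto
  have "(\<lambda>n. LINT t|lborel. mellin_weight p t * sine_profile h s (inverse (real (Suc n))) t)
     \<longlonglongrightarrow> (LINT t|lborel. pi powr h * (mellin_weight (- (h - p)) t * exp (- (s / t))))"
  proof (rule integral_dominated_convergence)
    show "integrable lborel (mellin_majorant p h 1 C)" using p by (rule integrable_mellin_majorant)
    show "AE t in lborel. (\<lambda>n. mellin_weight p t * sine_profile h s (inverse (real (Suc n))) t)
      \<longlonglongrightarrow> pi powr h * (mellin_weight (- (h - p)) t * exp (- (s / t)))"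
    proof (intro AE_I2)
      fix t
      show "(\<lambda>n. mellin_weight p t * sine_profile h s (inverse (real (Suc n))) t)
        \<longlonglongrightarrow> pi powr h * (mellin_weight (- (h - p)) t * exp (- (s / t)))"
      proof (cases "0 < t")
        case True
        have "(\<lambda>n. mellin_weight p t * sine_profile h s (inverse (real (Suc n))) t)
          \<longlonglongrightarrow> mellin_weight p t * ((pi / t) powr h * exp (- (s / t)))"
          by (intro tendsto_mult_left sine_profile_tendsto True s)
        then show ?thesis by (simp only: mult.assoc[symmetric] mellin_weight_times_powr)
      qed (simp add: mellin_weight_def)
    qed
    show "AE t in lborel. norm (mellin_weight p t * sine_profile h s (inverse (real (Suc n))) t) \<le> mellin_majorant p h 1 C t" for n
    proof (intro AE_I2)
      fix t :: real
      define P where "P = sine_profile h s (inverse (real (Suc n))) t"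
      have P: "0 \<le> P" "P \<le> (pi / t) powr h" "P \<le> C * t" if "0 < t"
        using sine_profile_bounds[OF _ that s h, of "inverse (real (Suc n))"] by (simp_all add: P_def C_def)
      have "0 \<le> exp (- t) * C" using C by simp
      then have "P \<le> 1 * (pi / t) powr h + exp (- t) * C" if "0 < t" using P(2)[OF that] by linarith
      then have "mellin_weight p t * P \<le> mellin_majorant p h 1 C t"
        using P(3) C by (intro mellin_weight_times_le_majorant) auto
      moreover have "0 \<le> mellin_weight p t * P"
        using P(1) by (cases "0 < t") (auto simp: mellin_weight_def)
      ultimately show "norm (mellin_weight p t * sine_profile h s (inverse (real (Suc n))) t) \<le> mellin_majorant p h 1 C t"
        by (simp add: P_def)
    qed
  qed (unfold sine_profile_def, measurable)
  then show ?thesis using lim by (simp add: has_bochner_integral_iff)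
qed

text \<open>
  As \<open>\<epsilon>\<close> tends to \<open>0\<close>, the spectrum of the Gaussian times sine concentrates at \<open>\<xi>\<close> and \<open>- \<xi>\<close>. After division by
  the common factor, the two sides tend to \<open>|\<xi>|\<^sup>-\<^sup>\<alpha>\<close> and \<open>cW (2 \<pi>)\<^sup>d\<^sup>/\<^sup>2 exp (- |\<xi>|\<^sup>2 / 2)\<close>, and at \<open>|\<xi>|\<^sup>2 = \<alpha>\<close> the
  hypothesis on \<open>cW\<close> says that the second is larger.
\<close>

lemma gaussian_sine_negative_energy:
  assumes \<alpha>: "0 < \<alpha>" "\<alpha> < real DIM('a::euclidean_space) + 2" and cW: "c_lower DIM('a) \<alpha> < cW"
    and \<xi>: "(norm (\<xi>::'a))\<^sup>2 = \<alpha>"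
  shows "\<exists>\<epsilon>>0. riesz_norm DIM('a) \<alpha> * (LINT t|lborel. mellin_weight ((real DIM('a) - \<alpha>) / 2) t *
        gauss_avg t (autocorr (\<lambda>x. gaussian \<epsilon> x * sin (x \<bullet> \<xi>))))
      < cW * gauss_avg (1 / 2) (autocorr (\<lambda>x. gaussian \<epsilon> x * sin (x \<bullet> \<xi>)))"
proof -
  define h where "h = real DIM('a) / 2"
  define p where "p = (real DIM('a) - \<alpha>) / 2"
  have p: "-1 < p" "p < h" "h - p = \<alpha> / 2" using \<alpha> by (auto simp: p_def h_def field_simps)
  have h: "0 \<le> h" by (simp add: h_def)
  define s where "s = \<alpha> / 4"
  have s: "0 < s" using \<alpha> by (simp add: s_def)
  define \<eta> where "\<eta> = (\<lambda>n. inverse (real (Suc n)))"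
  have \<eta>: "0 < \<eta> n" for n by (simp add: \<eta>_def)
  define L where "L = (\<lambda>n. riesz_norm DIM('a) \<alpha> * (LINT t|lborel. mellin_weight p t * sine_profile h s (\<eta> n) t))"
  define Q where "Q = (\<lambda>n. cW * sine_profile h s (\<eta> n) (1 / 2))"
  have limit: "riesz_norm DIM('a) \<alpha> * (pi powr h * (Gamma (h - p) * s powr (- (h - p)))) = \<alpha> powr (- (\<alpha> / 2))"
  proof -
    have "0 < Gamma (\<alpha> / 2)" using \<alpha> by (intro Gamma_real_pos) simp
    then have "Gamma (\<alpha> / 2) \<noteq> 0" by simp
    moreover have "s powr (- (\<alpha> / 2)) = 2 powr \<alpha> * \<alpha> powr (- (\<alpha> / 2))"
    proof -
      have "(4::real) powr (\<alpha> / 2) = (2 powr 2) powr (\<alpha> / 2)" by simp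
      also have "\<dots> = 2 powr \<alpha>" by (simp only: powr_powr) simp
      finally show ?thesis using \<alpha> by (simp add: s_def powr_divide powr_minus_divide)
    qed
    ultimately show ?thesis unfolding p(3) by (simp add: riesz_norm_def h_def)
  qed
  have "L \<longlonglongrightarrow> \<alpha> powr (- (\<alpha> / 2))"
    unfolding L_def \<eta>_def limit[symmetric] by (intro tendsto_mult_left mellin_sine_profile_tendsto p h s)
  moreover have "Q \<longlonglongrightarrow> cW * ((2 * pi) powr h * exp (- (\<alpha> / 2)))"
    using tendsto_mult_left[OF sine_profile_tendsto[of "1 / 2" s h], of cW] s
    by (simp add: Q_def \<eta>_def s_def mult.commute)
  ultimately have "(\<lambda>n. L n - Q n) \<longlonglongrightarrow> \<alpha> powr (- (\<alpha> / 2)) - cW * ((2 * pi) powr h * exp (- (\<alpha> / 2)))"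
    by (rule tendsto_diff)
  moreover have "\<alpha> powr (- (\<alpha> / 2)) - cW * ((2 * pi) powr h * exp (- (\<alpha> / 2))) < 0"
    using cW c_lower_less_iff[OF \<alpha>(1), of "DIM('a)" cW] by (simp add: h_def mult.assoc)
  ultimately have "eventually (\<lambda>n. L n - Q n < 0) sequentially" by (rule order_tendstoD(2))
  then obtain n where n: "L n < Q n" by (auto simp: eventually_sequentially)
  define c where "c = 1 / 2 * (pi / (4 * \<eta> n)) powr h"
  have c: "0 < c" using \<eta>[of n] by (simp add: c_def)
  have G: "gauss_avg t (autocorr (\<lambda>x. gaussian (2 * \<eta> n) x * sin (x \<bullet> \<xi>))) = c * sine_profile h s (\<eta> n) t" if "0 \<le> t" for t
    using gauss_avg_gaussian_sine[OF \<eta>[of n] that, of \<xi>] \<xi> by (simp add: c_def h_def s_def)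
  have "mellin_weight p t * gauss_avg t (autocorr (\<lambda>x. gaussian (2 * \<eta> n) x * sin (x \<bullet> \<xi>))) =
      c * (mellin_weight p t * sine_profile h s (\<eta> n) t)" for t
    using G[of t] by (cases "0 < t") (auto simp: mellin_weight_def)
  then have "riesz_norm DIM('a) \<alpha> * (LINT t|lborel. mellin_weight p t *
        gauss_avg t (autocorr (\<lambda>x. gaussian (2 * \<eta> n) x * sin (x \<bullet> \<xi>)))) = c * L n"
    by (simp only: integral_mult_right_zero L_def mult.left_commute)
  also have "\<dots> < c * Q n" using n c by simp
  also have "\<dots> = cW * gauss_avg (1 / 2) (autocorr (\<lambda>x. gaussian (2 * \<eta> n) x * sin (x \<bullet> \<xi>)))"
    by (simp add: Q_def G)
  finally show ?thesis
    using \<eta>[of n] by (intro exI[of _ "2 * \<eta> n"]) (simp add: p_def)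
qed

lemma integral_odd_eq_0:
  fixes f :: "'a::euclidean_space \<Rightarrow> real"
  assumes [measurable]: "f \<in> borel_measurable borel" and odd: "\<And>x. f (- x) = - f x"
  shows "integral\<^sup>L lborel f = 0"
  using lborel_integral_scale[of "-1" f] by (simp add: odd)

text \<open>
  Truncation preserves the Gaussian bound, so convergence is dominated in both integrations.
\<close>

lemma autocorr_truncation_tendsto:
  fixes \<nu> k :: "'a::euclidean_space \<Rightarrow> real"
  assumes \<nu>: "\<nu> \<in> borel_measurable borel" "0 < \<epsilon>" "\<And>x. \<bar>\<nu> x\<bar> \<le> gaussian \<epsilon> x"
    and [measurable]: "k \<in> borel_measurable borel"
    and k: "integrable lborel (\<lambda>z. k z * gaussian (\<epsilon> / 4) z)"
  shows "(\<lambda>m. LINT z|lborel. k z * autocorr (\<lambda>x. indicator (cball 0 (real m)) x * \<nu> x) z)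
     \<longlonglongrightarrow> (LINT z|lborel. k z * autocorr \<nu> z)"
proof -
  have [measurable]: "\<nu> \<in> borel_measurable borel" by fact
  define \<mu> where "\<mu> = (\<lambda>m x. indicator (cball 0 (real m)) x * \<nu> x)"
  have [measurable]: "\<mu> m \<in> borel_measurable borel" for m
    unfolding \<mu>_def using \<nu>(1) by (intro borel_measurable_times borel_measurable_indicator) auto
  have \<mu>_le: "\<bar>\<mu> m x\<bar> \<le> gaussian \<epsilon> x" for m x
    using \<nu>(3)[of x] by (auto simp: \<mu>_def indicator_def)
  have \<mu>_lim: "(\<lambda>m. \<mu> m x) \<longlonglongrightarrow> \<nu> x" for x
  proof (rule tendsto_eventually)
    obtain N where "norm x \<le> real N" using real_arch_simple by blast
    then show "eventually (\<lambda>m. \<mu> m x = \<nu> x) sequentially"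
      unfolding eventually_sequentially by (intro exI[of _ N]) (auto simp: \<mu>_def indicator_def)
  qed
  have pw: "(\<lambda>m. autocorr (\<mu> m) z) \<longlonglongrightarrow> autocorr \<nu> z" for z
    unfolding autocorr_def
  proof (rule integral_dominated_convergence)
    show "integrable lborel (\<lambda>y::'a. gaussian (\<epsilon> / 4) z * gaussian (\<epsilon> / 2) y)"
      using \<nu>(2) by (intro integrable_mult_right integrable_gaussian) auto
    show "AE y in lborel. (\<lambda>m. \<mu> m (z + y) * \<mu> m y) \<longlonglongrightarrow> \<nu> (z + y) * \<nu> y"
      by (intro AE_I2 tendsto_mult \<mu>_lim)
    show "AE y in lborel. norm (\<mu> m (z + y) * \<mu> m y) \<le> gaussian (\<epsilon> / 4) z * gaussian (\<epsilon> / 2) y" for m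
      using shifted_product_bound[OF \<nu>(2) \<mu>_le] by (intro AE_I2) simp
  qed measurable
  have "(\<lambda>m. LINT z|lborel. k z * autocorr (\<mu> m) z) \<longlonglongrightarrow> (LINT z|lborel. k z * autocorr \<nu> z)"
  proof (rule integral_dominated_convergence)
    show "integrable lborel (\<lambda>z. (2 * pi / \<epsilon>) powr (real DIM('a) / 2) * \<bar>k z * gaussian (\<epsilon> / 4) z\<bar>)"
      using k by (intro integrable_mult_right integrable_abs)
    show "AE z in lborel. (\<lambda>m. k z * autocorr (\<mu> m) z) \<longlonglongrightarrow> k z * autocorr \<nu> z"
      by (intro AE_I2 tendsto_mult_left pw)
    show "AE z in lborel. norm (k z * autocorr (\<mu> m) z) \<le> (2 * pi / \<epsilon>) powr (real DIM('a) / 2) * \<bar>k z * gaussian (\<epsilon> / 4) z\<bar>" for m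
    proof (intro AE_I2)
      fix z
      have "\<bar>k z\<bar> * \<bar>autocorr (\<mu> m) z\<bar> \<le> \<bar>k z\<bar> * ((2 * pi / \<epsilon>) powr (real DIM('a) / 2) * gaussian (\<epsilon> / 4) z)"
        by (intro mult_left_mono autocorr_bound \<nu>(2) \<mu>_le) auto
      then show "norm (k z * autocorr (\<mu> m) z) \<le> (2 * pi / \<epsilon>) powr (real DIM('a) / 2) * \<bar>k z * gaussian (\<epsilon> / 4) z\<bar>"
        by (simp add: abs_mult mult_ac)
    qed
  qed measurable
  then show ?thesis by (simp only: \<mu>_def)
qed

text \<open>
  The sine is odd and the cut-off is even, so truncations to centred balls keep mean \<open>0\<close> exactly.
\<close>

lemma compactly_supported_negative_energy:
  assumes \<alpha>: "0 < \<alpha>" "\<alpha> < real DIM('a::euclidean_space) + 2" and cW: "c_lower DIM('a) \<alpha> < cW"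
  shows "\<exists>(\<mu>::'a \<Rightarrow> real) \<epsilon> m. \<mu> \<in> borel_measurable borel \<and> 0 < \<epsilon> \<and> (\<forall>x. \<bar>\<mu> x\<bar> \<le> gaussian \<epsilon> x) \<and>
     (\<forall>x. real m < norm x \<longrightarrow> \<mu> x = 0) \<and> integral\<^sup>L lborel \<mu> = 0 \<and>
     riesz_norm DIM('a) \<alpha> * (LINT t|lborel. mellin_weight ((real DIM('a) - \<alpha>) / 2) t * gauss_avg t (autocorr \<mu>))
      < cW * gauss_avg (1 / 2) (autocorr \<mu>)"
proof -
  define p where "p = (real DIM('a) - \<alpha>) / 2"
  obtain b :: 'a where b: "b \<in> Basis" using SOME_Basis by blast
  define \<xi> where "\<xi> = sqrt \<alpha> *\<^sub>R b"
  have "(norm \<xi>)\<^sup>2 = \<alpha>" using b \<alpha> by (simp add: \<xi>_def power_mult_distrib)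
  from gaussian_sine_negative_energy[OF \<alpha> cW this] obtain \<epsilon> where \<epsilon>: "0 < \<epsilon>"
    and neg: "riesz_norm DIM('a) \<alpha> * (LINT t|lborel. mellin_weight p t *
        gauss_avg t (autocorr (\<lambda>x. gaussian \<epsilon> x * sin (x \<bullet> \<xi>))))
      < cW * gauss_avg (1 / 2) (autocorr (\<lambda>x. gaussian \<epsilon> x * sin (x \<bullet> \<xi>)))"
    unfolding p_def by blast
  define \<nu> where "\<nu> = (\<lambda>x::'a. gaussian \<epsilon> x * sin (x \<bullet> \<xi>))"
  define \<mu> where "\<mu> = (\<lambda>m x. indicator (cball 0 (real m)) x * \<nu> x)"
  have m\<nu>: "\<nu> \<in> borel_measurable borel" unfolding \<nu>_def by measurable
  then have m\<mu>: "\<mu> m \<in> borel_measurable borel" for m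
    unfolding \<mu>_def by (intro borel_measurable_times borel_measurable_indicator) auto
  have b\<nu>: "\<bar>\<nu> x\<bar> \<le> gaussian \<epsilon> x" for x
    by (auto simp: \<nu>_def abs_mult intro!: mult_right_le_one_le)
  then have b\<mu>: "\<bar>\<mu> m x\<bar> \<le> gaussian \<epsilon> x" for m x
    using b\<nu>[of x] by (auto simp: \<mu>_def indicator_def)
  have i\<nu>: "integral\<^sup>L lborel \<nu> = 0" using m\<nu> by (rule integral_odd_eq_0) (simp add: \<nu>_def)
  have i\<mu>: "integral\<^sup>L lborel (\<mu> m) = 0" for m using m\<mu> by (rule integral_odd_eq_0) (simp add: \<mu>_def \<nu>_def indicator_def)
  let ?R = "\<lambda>z::'a. riesz_kernel DIM('a) \<alpha> (norm z)"
  have energy: "(LINT z|lborel. ?R z * autocorr \<rho> z) = riesz_norm DIM('a) \<alpha> * (LINT t|lborel. mellin_weight p t * gauss_avg t (autocorr \<rho>))"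
    if "\<rho> \<in> borel_measurable borel" "\<And>x. \<bar>\<rho> x\<bar> \<le> gaussian \<epsilon> x" "integral\<^sup>L lborel \<rho> = 0" for \<rho> :: "'a \<Rightarrow> real"
    using integral_riesz[OF moderate_autocorr[OF that(1) \<epsilon> that(2)] \<alpha>] integral_autocorr[OF that(1) \<epsilon> that(2)] that(3)
    by (simp add: p_def)
  have "integrable lborel (\<lambda>z. ?R z * gaussian (\<epsilon> / 4) z)"
    using integrable_riesz[OF moderate_gaussian[of "\<epsilon> / 4"] \<alpha>] \<epsilon> by simp
  then have "(\<lambda>m. LINT z|lborel. ?R z * autocorr (\<mu> m) z) \<longlonglongrightarrow> (LINT z|lborel. ?R z * autocorr \<nu> z)"
    unfolding \<mu>_def by (intro autocorr_truncation_tendsto[OF m\<nu> \<epsilon> b\<nu>]) auto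
  moreover have "(\<lambda>m. gauss_avg (1 / 2) (autocorr (\<mu> m))) \<longlonglongrightarrow> gauss_avg (1 / 2) (autocorr \<nu>)"
  proof -
    have "integrable lborel (\<lambda>z::'a. gaussian (1 / 2) z * gaussian (\<epsilon> / 4) z)"
      using moderate_integrable_exp[OF moderate_gaussian[of "\<epsilon> / 4"], of "1 / 2", where 'a='a] \<epsilon> by simp
    then show ?thesis
      unfolding \<mu>_def gauss_avg_def real_scaleR_def by (intro autocorr_truncation_tendsto[OF m\<nu> \<epsilon> b\<nu>]) auto
  qed
  ultimately have "(\<lambda>m. (LINT z|lborel. ?R z * autocorr (\<mu> m) z) - cW * gauss_avg (1 / 2) (autocorr (\<mu> m)))
      \<longlonglongrightarrow> (LINT z|lborel. ?R z * autocorr \<nu> z) - cW * gauss_avg (1 / 2) (autocorr \<nu>)"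
    by (intro tendsto_diff tendsto_mult_left)
  moreover have "(LINT z|lborel. ?R z * autocorr \<nu> z) - cW * gauss_avg (1 / 2) (autocorr \<nu>) < 0"
    using neg unfolding energy[OF m\<nu> b\<nu> i\<nu>] by (simp add: \<nu>_def)
  ultimately have "eventually (\<lambda>m. (LINT z|lborel. ?R z * autocorr (\<mu> m) z) - cW * gauss_avg (1 / 2) (autocorr (\<mu> m)) < 0) sequentially"
    by (rule order_tendstoD(2))
  then obtain m where m: "(LINT z|lborel. ?R z * autocorr (\<mu> m) z) < cW * gauss_avg (1 / 2) (autocorr (\<mu> m))"
    by (auto simp: eventually_sequentially)
  show ?thesis
    by (intro exI[of _ "\<mu> m"] exI[of _ \<epsilon>] exI[of _ m])
       (use m m\<mu> \<epsilon> b\<mu> i\<mu> energy[OF m\<mu> b\<mu> i\<mu>, of m] in \<open>auto simp: p_def \<mu>_def indicator_def\<close>)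
qed

lemma energy_eq_autocorr:
  fixes \<mu> :: "'a::euclidean_space \<Rightarrow> real"
  assumes \<mu>: "\<mu> \<in> borel_measurable borel" "0 < \<epsilon>" "\<And>x. \<bar>\<mu> x\<bar> \<le> gaussian \<epsilon> x"
    and lam: "0 < lam" "lam < 1" and \<alpha>: "0 < \<alpha>" "\<alpha> < real DIM('a) + 2"
  shows "energy (W_potential \<alpha> lam cW) \<mu> = 1 / 2 * (LINT z|lborel. W_potential \<alpha> lam cW z * autocorr \<mu> z)"
proof -
  have "integrable lborel (\<lambda>z::'a. W_potential \<alpha> lam cW z * gaussian (\<epsilon> / 4) z)"
    using integrable_W_potential[OF moderate_gaussian[of "\<epsilon> / 4"] lam \<alpha>] \<mu>(2) by simp
  then show ?thesis
    unfolding energy_def by (subst interaction_eq_autocorr[OF \<mu>(1) _ \<mu>(2,3)]) auto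
qed

text \<open>
  Dilation by \<open>c\<close> multiplies the Riesz energy by \<open>c\<^sup>2\<^sup>d\<^sup>+\<^sup>\<alpha>\<^sup>-\<^sup>d\<close>. If \<open>c\<close> is a positive power of \<open>lam\<close>, the term of the
  series whose Gaussian has width \<open>c\<close> scales by the same factor, and it outweighs the Riesz energy. The other terms of
  the series and the quadratic term only lower the energy.
\<close>

lemma infinitesimal_concave_W_potential:
  assumes lam: "0 < lam" "lam < 1" and \<alpha>: "0 < \<alpha>" "\<alpha> < real DIM('a::euclidean_space) + 2"
    and cW: "0 < cW" "c_lower DIM('a) \<alpha> < cW"
  shows "infinitesimal_concave (W_potential \<alpha> lam cW :: 'a \<Rightarrow> real)"
  unfolding infinitesimal_concave_def
proof (intro allI impI)
  fix \<delta> :: real assume \<delta>: "0 < \<delta>"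
  define p where "p = (real DIM('a) - \<alpha>) / 2"
  obtain \<nu> :: "'a \<Rightarrow> real" and \<epsilon> m where [measurable]: "\<nu> \<in> borel_measurable borel" and \<epsilon>: "0 < \<epsilon>"
    and \<nu>_le: "\<And>x. \<bar>\<nu> x\<bar> \<le> gaussian \<epsilon> x" and \<nu>_supp: "\<And>x. real m < norm x \<Longrightarrow> \<nu> x = 0"
    and \<nu>_mean: "integral\<^sup>L lborel \<nu> = 0"
    and neg: "riesz_norm DIM('a) \<alpha> * (LINT t|lborel. mellin_weight p t * gauss_avg t (autocorr \<nu>)) < cW * gauss_avg (1 / 2) (autocorr \<nu>)"
    using compactly_supported_negative_energy[OF \<alpha> cW(2)] unfolding p_def by blast
  obtain n where n: "lam ^ n < \<delta> / (2 * (real m + 1))"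
    using real_arch_pow_inv[of "\<delta> / (2 * (real m + 1))" lam] \<delta> lam by auto
  \<comment> \<open>The series starts with the first power of lam, so the term of index n has width lam to the power n + 1.\<close>
  define c where "c = lam ^ Suc n"
  have c: "0 < c" using lam by (simp add: c_def)
  have "c \<le> lam ^ n" using lam by (simp add: c_def mult_left_le_one_le)
  then have c\<delta>: "2 * (c * real m) \<le> \<delta>"
  proof -
    have "c * (2 * (real m + 1)) \<le> lam ^ n * (2 * (real m + 1))" using \<open>c \<le> lam ^ n\<close> by (intro mult_right_mono) auto
    also have "\<dots> \<le> \<delta>" using n by (simp add: pos_less_divide_eq less_imp_le)
    finally show ?thesis using c by (simp add: algebra_simps)
  qed
  define \<mu> where "\<mu> = (\<lambda>x. \<nu> (x /\<^sub>R c))"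
  have [measurable]: "\<mu> \<in> borel_measurable borel" unfolding \<mu>_def by measurable
  define \<epsilon>' where "\<epsilon>' = \<epsilon> / c\<^sup>2"
  have \<epsilon>': "0 < \<epsilon>'" using \<epsilon> c by (simp add: \<epsilon>'_def)
  have \<mu>_le: "\<bar>\<mu> x\<bar> \<le> gaussian \<epsilon>' x" for x
    using \<nu>_le[of "x /\<^sub>R c"] c by (simp add: \<mu>_def \<epsilon>'_def power_mult_distrib power_inverse divide_inverse mult_ac)
  have \<mu>: "\<mu> \<in> borel_measurable borel" "0 < \<epsilon>'" "\<And>x. \<bar>\<mu> x\<bar> \<le> gaussian \<epsilon>' x"
    using \<epsilon>' \<mu>_le by auto
  have \<mu>_mean: "integral\<^sup>L lborel \<mu> = 0"
    using lborel_integral_scale[of "inverse c" \<nu>] c \<nu>_mean by (simp add: \<mu>_def)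
  have \<mu>_supp: "\<mu> x = 0" if "c * real m < norm x" for x
  proof -
    have "real m < norm (x /\<^sub>R c)" using that c by (simp add: field_simps)
    then show ?thesis by (simp add: \<mu>_def \<nu>_supp)
  qed
  define w where "w = autocorr \<mu>"
  have w: "moderate w" unfolding w_def by (rule moderate_autocorr[OF \<mu>])
  have w_mean: "integral\<^sup>L lborel w = 0" by (simp add: w_def integral_autocorr[OF \<mu>] \<mu>_mean)
  have G: "gauss_avg t w = c ^ (2 * DIM('a)) * gauss_avg (t * c\<^sup>2) (autocorr \<nu>)" for t
    unfolding w_def \<mu>_def by (rule gauss_avg_autocorr_scale[OF c]) measurable
  have mellin: "(LINT t|lborel. mellin_weight p t * gauss_avg t w) =
      c ^ (2 * DIM('a)) * (c powr (\<alpha> - real DIM('a)) * (LINT t|lborel. mellin_weight p t * gauss_avg t (autocorr \<nu>)))"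
  proof -
    have "(LINT t|lborel. mellin_weight p t * gauss_avg t w) =
       (LINT t|lborel. c ^ (2 * DIM('a)) * (mellin_weight p t * gauss_avg (t * c\<^sup>2) (autocorr \<nu>)))"
      by (simp only: G mult.left_commute[of "mellin_weight p _"])
    also have "\<dots> = c ^ (2 * DIM('a)) * (c powr (- 2 * p) * (LINT t|lborel. mellin_weight p t * gauss_avg t (autocorr \<nu>)))"
      using mellin_scale[OF c, of p "\<lambda>t. gauss_avg t (autocorr \<nu>)"] by simp
    also have "- 2 * p = \<alpha> - real DIM('a)" by (simp add: p_def)
    finally show ?thesis .
  qed
  define S where "S = (\<lambda>j. lam powr ((\<alpha> - real DIM('a)) * real (Suc j)) *\<^sub>R gauss_avg (gauss_rate lam j) w)"
  have S_nn: "0 \<le> S j" for j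
    unfolding S_def w_def using gauss_avg_autocorr_nonneg[OF \<mu> gauss_rate_pos[OF lam(1)]] by simp
  have S_n: "S n = c ^ (2 * DIM('a)) * (c powr (\<alpha> - real DIM('a)) * gauss_avg (1 / 2) (autocorr \<nu>))"
  proof -
    \<comment> \<open>The term kept has the Gaussian of the base problem after rescaling.\<close>
    have "gauss_rate lam n * c\<^sup>2 = 1 / 2"
    proof -
      have "lam ^ (2 * Suc n) = c\<^sup>2" by (simp only: c_def power_mult[symmetric] mult.commute)
      then show ?thesis using c by (simp add: gauss_rate_def)
    qed
    moreover have "lam powr ((\<alpha> - real DIM('a)) * real (Suc n)) = c powr (\<alpha> - real DIM('a))"
      unfolding c_def using lam by (simp only: powr_realpow[symmetric] powr_powr mult.commute)
    ultimately show ?thesis by (simp only: S_def G real_scaleR_def mult_ac)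
  qed
  have "summable S" unfolding S_def by (rule sums_summable[OF gauss_series_sums[OF w lam \<alpha>(1)]])
  then have "S n \<le> suminf S" using sum_le_suminf[of S "{n}"] S_nn by simp
  then have S_le: "cW * S n \<le> cW * suminf S" using cW by simp
  have quad: "(LINT z|lborel. (norm z)\<^sup>2 *\<^sub>R w z) \<le> 0"
    using integral_norm2_autocorr_nonpos[OF \<mu> \<mu>_mean] by (simp add: w_def)
  have "(LINT z|lborel. W_potential \<alpha> lam cW z *\<^sub>R w z) =
      riesz_norm DIM('a) \<alpha> * (LINT t|lborel. mellin_weight p t * gauss_avg t w) + 1 / 2 * (LINT z|lborel. (norm z)\<^sup>2 *\<^sub>R w z) - cW * suminf S"
    using integral_W_potential[OF w lam \<alpha> w_mean, of cW] by (simp add: S_def p_def)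
  also have "\<dots> \<le> riesz_norm DIM('a) \<alpha> * (LINT t|lborel. mellin_weight p t * gauss_avg t w) - cW * S n"
    using quad S_le by linarith
  also have "\<dots> = c ^ (2 * DIM('a)) * c powr (\<alpha> - real DIM('a)) *
      (riesz_norm DIM('a) \<alpha> * (LINT t|lborel. mellin_weight p t * gauss_avg t (autocorr \<nu>)) - cW * gauss_avg (1 / 2) (autocorr \<nu>))"
    unfolding mellin S_n by (simp add: algebra_simps)
  also have "\<dots> < 0" using neg c by (intro mult_pos_neg) auto
  finally have "(LINT z|lborel. W_potential \<alpha> lam cW z * w z) < 0" by simp
  then have energy: "energy (W_potential \<alpha> lam cW) \<mu> < 0"
    using energy_eq_autocorr[OF \<mu> lam \<alpha>, of cW] by (simp add: w_def)
  have ess: "ess_support \<mu> \<subseteq> cball 0 (c * real m)"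
  proof
    fix x assume x: "x \<in> ess_support \<mu>"
    show "x \<in> cball 0 (c * real m)"
    proof (rule ccontr)
      assume "x \<notin> cball 0 (c * real m)"
      then have pos: "0 < norm x - c * real m" by simp
      have "\<mu> y = 0" if "y \<in> ball x (norm x - c * real m)" for y
      proof (rule \<mu>_supp)
        have "norm x \<le> norm y + dist x y" using norm_triangle_ineq2[of x y] by (simp add: dist_norm)
        then show "c * real m < norm y" using that by simp
      qed
      then have "AE y in lborel. y \<in> ball x (norm x - c * real m) \<longrightarrow> \<mu> y = 0" by (intro AE_I2) blast
      with x pos show False by (auto simp: ess_support_def)
    qed
  qed
  have "\<not> (AE x in lborel. \<mu> x = 0)"
  proof
    assume "AE x in lborel. \<mu> x = 0"
    then have "autocorr \<mu> z = 0" for z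
      unfolding autocorr_def by (intro integral_eq_zero_AE) auto
    then show False using energy energy_eq_autocorr[OF \<mu> lam \<alpha>, of cW] by simp
  qed
  moreover have "L_infinity \<mu>"
    unfolding L_infinity_def
  proof (intro conjI exI[of _ 1] AE_I2)
    show "\<bar>\<mu> x\<bar> \<le> 1" for x using \<mu>_le[of x] \<epsilon>' by (intro order_trans[OF \<mu>_le]) auto
  qed measurable
  moreover have "bounded (ess_support \<mu>)" using ess bounded_cball bounded_subset by blast
  moreover have "diameter (ess_support \<mu>) \<le> \<delta>"
  proof -
    have "\<not> c * real m < 0" using c by (simp add: not_less)
    then have "diameter (cball (0::'a) (c * real m)) = 2 * (c * real m)" by (simp add: diameter_cball)
    then show ?thesis using diameter_subset[OF ess bounded_cball] c\<delta> by simp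
  qed
  ultimately show "lin_interp_concave (W_potential \<alpha> lam cW :: 'a \<Rightarrow> real) \<delta>"
    unfolding lin_interp_concave_def using \<mu>_mean energy by blast
qed

section \<open>Shape of the potential for well separated scales\<close>

text \<open>
  Termwise differentiation: on \<open>[r / 2, 2 r]\<close> the differentiated terms are dominated by those of a convergent series
  of the same kind at \<open>r / 2\<close>.
\<close>

lemma gauss_series_has_derivative:
  assumes lam: "0 < lam" "lam < 1" and r: "0 < r"
  shows "(gauss_series lam q has_real_derivative - (r * gauss_series lam (q - 2) r)) (at r)"
proof -
  define f where "f = (\<lambda>j r. gauss_term lam q r j)"
  define f' where "f' = (\<lambda>j r. - r * (gauss_term lam (q - 2) r j))"
  define S where "S = {r / 2 .. 2 * r}"
  have der: "(f j has_field_derivative f' j x) (at x within S)" for j x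
  proof -
    define l where "l = lam ^ (2 * Suc j)"
    have l: "0 < l" using lam by (simp add: l_def)
    have coeff: "lam powr (q * real (Suc j)) / l = lam powr ((q - 2) * real (Suc j))"
    proof -
      have "l = lam powr (2 * real (Suc j))"
        unfolding l_def using lam by (simp add: powr_realpow[symmetric] del: power_Suc)
      then show ?thesis by (simp add: powr_diff[symmetric] algebra_simps del: of_nat_Suc)
    qed
    have eq: "f' j x = lam powr (q * real (Suc j)) * (exp (- (x\<^sup>2 / (2 * l))) * (- (x / l)))"
      unfolding f'_def l_def[symmetric] coeff[symmetric] by simp
    show ?thesis
      unfolding eq unfolding f_def l_def[symmetric] using l
      by (auto intro!: derivative_eq_intros)
  qed
  have r_int: "r \<in> interior S" "r \<in> S"
    using r by (auto simp: S_def interior_atLeastAtMost_real)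
  have conv: "uniformly_convergent_on S (\<lambda>n x. \<Sum>j<n. f' j x)"
    unfolding uniformly_convergent_on_def
  proof (rule exI, rule Weierstrass_m_test)
    show "summable (\<lambda>j. 2 * r * (gauss_term lam (q - 2) (r / 2) j))"
      using r by (intro summable_mult gauss_series_summable lam) auto
    fix j x assume x: "x \<in> S"
    have l: "0 < lam ^ (2 * Suc j)" using lam by simp
    have "(r / 2)\<^sup>2 \<le> x\<^sup>2" using x r by (intro power_mono) (auto simp: S_def)
    then have "exp (- (x\<^sup>2 / (2 * lam ^ (2 * Suc j)))) \<le> exp (- ((r / 2)\<^sup>2 / (2 * lam ^ (2 * Suc j))))"
      using l by (simp add: divide_right_mono del: power_Suc)
    moreover have "norm (f' j x) = \<bar>x\<bar> * (gauss_term lam (q - 2) x j)"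
      by (simp add: f'_def abs_mult)
    moreover have "0 \<le> x" "x \<le> 2 * r" using x r by (auto simp: S_def)
    ultimately show "norm (f' j x) \<le> 2 * r * (gauss_term lam (q - 2) (r / 2) j)"
      by (simp only: abs_of_nonneg) (intro mult_mono mult_left_mono, auto)
  qed
  have "((\<lambda>x. \<Sum>j. f j x) has_field_derivative (\<Sum>j. f' j r)) (at r)"
  proof (rule has_field_derivative_series'(2)[OF _ der conv r_int(2) _ r_int(1)])
    show "convex S" by (simp add: S_def)
    show "summable (\<lambda>j. f j r)" unfolding f_def by (rule gauss_series_summable[OF lam r])
  qed
  moreover have "(\<Sum>j. f' j r) = - (r * gauss_series lam (q - 2) r)"
    unfolding f'_def gauss_series_def by (subst suminf_mult[OF gauss_series_summable[OF lam r]]) simp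
  moreover have "(\<lambda>x. \<Sum>j. f j x) = gauss_series lam q"
    by (simp add: f_def gauss_series_def fun_eq_iff)
  ultimately show ?thesis by simp
qed

lemma riesz_kernel_has_derivative:
  assumes \<alpha>: "\<alpha> < real d + 2" and r: "0 < r"
  shows "(riesz_kernel d \<alpha> has_real_derivative - (riesz_const_mult d \<alpha> * r powr (\<alpha> - real d - 1))) (at r)"
proof -
  define p where "p = (real d - \<alpha>) / 2"
  have "((\<lambda>x. - (riesz_norm d \<alpha> * Gamma (p + 1) * power_primitive p (x\<^sup>2))) has_real_derivative
      - (riesz_norm d \<alpha> * Gamma (p + 1) * ((r\<^sup>2) powr (- p - 1) * (2 * r)))) (at r)"
    using r by (auto intro!: derivative_eq_intros DERIV_chain2[OF power_primitive_deriv])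
  moreover have "- (riesz_norm d \<alpha> * Gamma (p + 1) * ((r\<^sup>2) powr (- p - 1) * (2 * r))) =
      - (riesz_const_mult d \<alpha> * r powr (\<alpha> - real d - 1))"
  proof -
    have "(r\<^sup>2) powr (- p - 1) = (r powr 2) powr (- p - 1)" using r by simp
    also have "\<dots> = r powr (2 * (- p - 1))" by (simp only: powr_powr)
    also have "2 * (- p - 1) = \<alpha> - real d - 1 - 1" by (simp add: p_def field_simps)
    finally have "(r\<^sup>2) powr (- p - 1) * r = r powr (\<alpha> - real d - 1)"
      using powr_mult_base[of r "\<alpha> - real d - 1 - 1"] r by (simp add: mult.commute)
    then show ?thesis by (simp add: riesz_const_mult_eq[OF \<alpha>] p_def[symmetric] mult_ac)
  qed
  ultimately have "((\<lambda>x. - (riesz_norm d \<alpha> * Gamma (p + 1) * power_primitive p (x\<^sup>2))) has_real_derivative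
     - (riesz_const_mult d \<alpha> * r powr (\<alpha> - real d - 1))) (at r)" by (simp only:)
  then show ?thesis
  proof (rule has_field_derivative_transform_within_open)
    show "open {0::real<..}" "r \<in> {0<..}" using r by auto
    show "- (riesz_norm d \<alpha> * Gamma (p + 1) * power_primitive p (x\<^sup>2)) = riesz_kernel d \<alpha> x" if "x \<in> {0<..}" for x
      using that by (simp add: riesz_kernel_eq[OF \<alpha>] p_def)
  qed
qed

text \<open>
  The derivative of \<open>W\<close> multiplied by \<open>r\<^sup>d\<^sup>+\<^sup>1\<^sup>-\<^sup>\<alpha>\<close>, which turns the contribution of the Riesz kernel into a constant and
  the series into a sum of values of a single function at \<open>r / lam\<^sup>k\<close>.
\<close>

definition reduced_slope :: "nat \<Rightarrow> real \<Rightarrow> real \<Rightarrow> real \<Rightarrow> real \<Rightarrow> real" where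
  "reduced_slope d \<alpha> lam cW r = r powr (real d + 2 - \<alpha>)
     + cW * (r powr (real d + 2 - \<alpha>) * gauss_series lam (- (real d + 2 - \<alpha>)) r) - riesz_const_mult d \<alpha>"

lemma W_radial_has_derivative:
  assumes lam: "0 < lam" "lam < 1" and \<alpha>: "\<alpha> < real d + 2" and r: "0 < r"
  shows "(W_radial d \<alpha> lam cW has_real_derivative r powr (\<alpha> - real d - 1) * reduced_slope d \<alpha> lam cW r) (at r)"
proof -
  have "((\<lambda>x. riesz_kernel d \<alpha> x + x\<^sup>2 / 2 - cW * gauss_series lam (\<alpha> - real d) x) has_real_derivative
     - (riesz_const_mult d \<alpha> * r powr (\<alpha> - real d - 1)) + r + cW * (r * gauss_series lam (- (real d + 2 - \<alpha>)) r)) (at r)"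
    using gauss_series_has_derivative[OF lam r, of "\<alpha> - real d"] riesz_kernel_has_derivative[OF \<alpha> r]
    by (auto intro!: derivative_eq_intros simp: algebra_simps)
  moreover have "- (riesz_const_mult d \<alpha> * r powr (\<alpha> - real d - 1)) + r + cW * (r * gauss_series lam (- (real d + 2 - \<alpha>)) r) =
     r powr (\<alpha> - real d - 1) * reduced_slope d \<alpha> lam cW r"
  proof -
    have "r powr (\<alpha> - real d - 1) * r powr (real d + 2 - \<alpha>) = r powr 1" by (simp flip: powr_add)
    then have *: "r powr (\<alpha> - real d - 1) * r powr (real d + 2 - \<alpha>) = r" using r by simp
    have "r powr (\<alpha> - real d - 1) * reduced_slope d \<alpha> lam cW r =
      (r powr (\<alpha> - real d - 1) * r powr (real d + 2 - \<alpha>)) +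
      cW * ((r powr (\<alpha> - real d - 1) * r powr (real d + 2 - \<alpha>)) * gauss_series lam (- (real d + 2 - \<alpha>)) r)
      - riesz_const_mult d \<alpha> * r powr (\<alpha> - real d - 1)"
      by (simp add: reduced_slope_def algebra_simps)
    then show ?thesis unfolding * by simp
  qed
  ultimately show ?thesis by (simp add: W_radial_eq [abs_def])
qed

lemma sum_power_le:
  fixes q :: real
  assumes q: "0 < q" "q < 1"
  shows "(\<Sum>i<n. q ^ i) \<le> 1 / (1 - q)"
proof -
  have "(\<Sum>i<n. q ^ i) \<le> (\<Sum>i. q ^ i)" using q by (intro sum_le_suminf summable_geometric) auto
  then show ?thesis using q by (simp add: suminf_geometric)
qed

text \<open>
  At most one index has \<open>v\<close> of order one. Below the first index \<open>k\<close> at which \<open>v\<close> exceeds \<open>\<surd>q\<close> the values of \<open>v\<close> are at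
  most \<open>\<surd>q\<close> and grow geometrically, and above it the values of \<open>1 / v\<close> are at most \<open>1 / \<surd>q\<close> times positive powers of \<open>q\<close>;
  both sides sum to multiples of \<open>\<surd>q / (1 - q)\<close>, and \<open>k\<close> itself contributes at most \<open>M\<close>.
\<close>

lemma sum_peaked_geometric_le:
  fixes h v :: "nat \<Rightarrow> real"
  assumes q: "0 < q" "q < 1" and v: "0 < v 0" "\<And>j. v (Suc j) = v j / q" and K: "0 \<le> K"
    and h: "\<And>j. 0 \<le> h j" "\<And>j. h j \<le> M" "\<And>j. h j \<le> v j" "\<And>j. h j \<le> K / v j"
  shows "(\<Sum>j<N. h j) \<le> M + (1 + K) * (sqrt q / (1 - q))"
proof -
  have v_shift: "v (j + m) = v j / q ^ m" for j m
    by (induction m) (simp_all add: v(2))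
  have "\<exists>j. sqrt q < v j"
  proof -
    obtain n where n: "q ^ n < v 0 / sqrt q"
      using real_arch_pow_inv[of "v 0 / sqrt q" q] v(1) q by auto
    then have "sqrt q < v 0 / q ^ n" using q by (simp add: field_simps)
    then show ?thesis using v_shift[of 0 n] by (intro exI[of _ n]) simp
  qed
  then obtain k where k: "sqrt q < v k" "\<And>j. j < k \<Longrightarrow> v j \<le> sqrt q"
    using exists_least_iff[of "\<lambda>j. sqrt q < v j"] by (auto simp: not_less)
  have below: "h j \<le> sqrt q * q ^ (k - Suc j)" if "j < k" for j
  proof -
    have "v (k - 1) = v j / q ^ (k - Suc j)" using v_shift[of j "k - Suc j"] that by simp
    then have "v j = v (k - 1) * q ^ (k - Suc j)" using q by simp
    also have "\<dots> \<le> sqrt q * q ^ (k - Suc j)" using k(2)[of "k - 1"] that q by (intro mult_right_mono) auto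
    finally show ?thesis using h(3)[of j] by simp
  qed
  have above: "h (Suc k + i) \<le> K * (sqrt q * q ^ i)" for i
  proof -
    have "v (Suc k + i) = v k / q ^ Suc i" using v_shift[of k "Suc i"] by simp
    moreover have "sqrt q / q ^ Suc i \<le> v k / q ^ Suc i" using k(1) q by (intro divide_right_mono) auto
    ultimately have "sqrt q / q ^ Suc i \<le> v (Suc k + i)" by simp
    moreover have "0 < sqrt q / q ^ Suc i" using q by simp
    ultimately have "K / v (Suc k + i) \<le> K / (sqrt q / q ^ Suc i)" using K by (intro divide_left_mono mult_pos_pos) auto
    also have "\<dots> = K * (q ^ Suc i / sqrt q)" using q by simp
    also have "q ^ Suc i / sqrt q = sqrt q * q ^ i"
    proof -
      have "q / sqrt q = sqrt q" using q by (simp add: real_div_sqrt)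
      then show ?thesis by (simp flip: times_divide_eq_left)
    qed
    finally show ?thesis using h(4)[of "Suc k + i"] by simp
  qed
  have sq: "0 \<le> sqrt q" using q by simp
  have "(\<Sum>j<k. h j) \<le> (\<Sum>j<k. sqrt q * q ^ (k - Suc j))" using below by (intro sum_mono) auto
  also have "\<dots> = sqrt q * (\<Sum>i<k. q ^ i)"
    unfolding sum.nat_diff_reindex[symmetric, of "\<lambda>i. q ^ i" k] by (simp add: sum_distrib_left)
  also have "\<dots> \<le> sqrt q * (1 / (1 - q))" using sq by (intro mult_left_mono sum_power_le q) auto
  finally have low: "(\<Sum>j<k. h j) \<le> sqrt q / (1 - q)" by simp
  have "(\<Sum>i<N. h (Suc k + i)) \<le> (\<Sum>i<N. K * (sqrt q * q ^ i))" using above by (intro sum_mono) auto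
  also have "\<dots> = K * (sqrt q * (\<Sum>i<N. q ^ i))" by (simp add: sum_distrib_left)
  also have "\<dots> \<le> K * (sqrt q * (1 / (1 - q)))" using sq K by (intro mult_left_mono sum_power_le q) auto
  finally have high: "(\<Sum>i<N. h (Suc k + i)) \<le> K * (sqrt q / (1 - q))" by simp
  have "(\<Sum>j<N. h j) \<le> (\<Sum>j<Suc k + N. h j)" using h(1) by (intro sum_mono2) auto
  also have "\<dots> = (\<Sum>j<Suc k. h j) + (\<Sum>i<N. h (Suc k + i))"
    by (induction N) simp_all
  also have "\<dots> \<le> M + (1 + K) * (sqrt q / (1 - q))"
    unfolding distrib_right mult_1 sum.lessThan_Suc using low high h(2)[of k] by linarith
  finally show ?thesis .
qed

text \<open>
  The points \<open>r / lam\<^sup>k\<close> are in geometric progression and \<open>h u = u\<^sup>\<beta> exp (- u\<^sup>2 / 2)\<close> is at most both \<open>u\<^sup>\<beta>\<close> and a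
  constant times \<open>u\<^sup>-\<^sup>\<beta>\<close>, so up to an error that vanishes with \<open>lam\<close> the sum does not exceed \<open>max h\<close>.
\<close>

lemma gauss_series_peak_bound:
  assumes lam: "0 < lam" "lam < 1" and \<beta>: "0 < \<beta>" and r: "0 < r"
  shows "r powr \<beta> * gauss_series lam (- \<beta>) r \<le>
     \<beta> powr (\<beta> / 2) * exp (- (\<beta> / 2)) + (1 + (2 * \<beta>) powr \<beta> * exp (- \<beta>)) * (sqrt (lam powr \<beta>) / (1 - lam powr \<beta>))"
proof -
  define g where "g = (\<lambda>j. gauss_term lam (- \<beta>) r j)"
  define u where "u = (\<lambda>j. r / lam ^ Suc j)"
  have u: "0 < u j" for j using r lam by (simp add: u_def)
  define q where "q = lam powr \<beta>"
  have q: "0 < q" "q < 1" using lam \<beta> powr_less_mono2[of \<beta> lam 1] by (auto simp: q_def)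
  have h_eq: "r powr \<beta> * g j = u j powr \<beta> * exp (- ((u j)\<^sup>2 / 2))" for j
  proof -
    have "(lam ^ Suc j) powr \<beta> = lam powr (\<beta> * real (Suc j))"
      using lam by (simp only: powr_realpow[symmetric] powr_powr mult.commute)
    then have "u j powr \<beta> = r powr \<beta> * lam powr (- \<beta> * real (Suc j))"
      using r lam by (simp add: u_def powr_divide powr_minus_divide del: power_Suc of_nat_Suc)
    moreover have "(u j)\<^sup>2 / 2 = r\<^sup>2 / (2 * lam ^ (2 * Suc j))"
    proof -
      have "(lam ^ Suc j)\<^sup>2 = lam ^ (2 * Suc j)" by (simp only: power_mult[symmetric] mult.commute)
      then show ?thesis by (simp add: u_def power_divide del: power_Suc)
    qed
    ultimately show ?thesis by (simp only: g_def mult.assoc)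
  qed
  have summ: "summable g" unfolding g_def by (rule gauss_series_summable[OF lam r])
  have partial: "(\<Sum>j<N. r powr \<beta> * g j) \<le> \<beta> powr (\<beta> / 2) * exp (- (\<beta> / 2)) + (1 + (2 * \<beta>) powr \<beta> * exp (- \<beta>)) * (sqrt q / (1 - q))" for N
  proof (rule sum_peaked_geometric_le[OF q, where v = "\<lambda>j. u j powr \<beta>"])
    show "0 < u 0 powr \<beta>" using u[of 0] by simp
    show "u (Suc j) powr \<beta> = u j powr \<beta> / q" for j
    proof -
      have "u (Suc j) = u j / lam" by (simp add: u_def)
      then show ?thesis using lam u[of j] by (simp add: powr_divide q_def)
    qed
    show "0 \<le> r powr \<beta> * g j" for j by (simp add: g_def)
    show "r powr \<beta> * g j \<le> \<beta> powr (\<beta> / 2) * exp (- (\<beta> / 2))" for j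
      unfolding h_eq by (rule powr_times_gaussian_le[OF \<beta> u])
    show "r powr \<beta> * g j \<le> u j powr \<beta>" for j
      unfolding h_eq by (simp add: mult_left_le)
    show "r powr \<beta> * g j \<le> (2 * \<beta>) powr \<beta> * exp (- \<beta>) / u j powr \<beta>" for j
    proof -
      have "u j powr (2 * \<beta>) * exp (- ((u j)\<^sup>2 / 2)) \<le> (2 * \<beta>) powr \<beta> * exp (- \<beta>)"
        using powr_times_gaussian_le[of "2 * \<beta>" "u j"] \<beta> u[of j] by simp
      moreover have "u j powr (2 * \<beta>) = u j powr \<beta> * u j powr \<beta>" by (simp flip: powr_add)
      moreover have "0 < u j powr \<beta>" using u[of j] by simp
      ultimately show ?thesis unfolding h_eq by (simp add: pos_le_divide_eq mult_ac)
    qed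
  qed simp
  have "(\<Sum>j. r powr \<beta> * g j) \<le> \<beta> powr (\<beta> / 2) * exp (- (\<beta> / 2)) + (1 + (2 * \<beta>) powr \<beta> * exp (- \<beta>)) * (sqrt q / (1 - q))"
    using summ by (intro suminf_le_const summable_mult partial) auto
  moreover have "(\<Sum>j. r powr \<beta> * g j) = r powr \<beta> * gauss_series lam (- \<beta>) r"
    unfolding suminf_mult[OF summ] by (simp add: g_def gauss_series_def)
  ultimately show ?thesis by (simp add: q_def)
qed

text \<open>
  On \<open>[r0, \<infinity>)\<close> the term with scale \<open>l = lam\<^sup>k\<close> becomes increasing after adding \<open>\<epsilon>\<^sub>k r\<^sup>\<beta>\<close> with \<open>\<epsilon>\<^sub>k\<close> proportional to \<open>l\<close>,
  since \<open>u\<^sup>\<beta>\<^sup>+\<^sup>3 exp (- u\<^sup>2 / 2)\<close> is bounded. Comparing termwise replaces a second differentiation of the series.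
\<close>

lemma gauss_series_decrease_bound:
  assumes lam: "0 < lam" "lam < 1" and \<beta>: "0 < \<beta>" and r0: "0 < r0" and r: "r0 \<le> r" "r \<le> r'"
  shows "r powr \<beta> * gauss_series lam (- \<beta>) r - r' powr \<beta> * gauss_series lam (- \<beta>) r' \<le>
     ((\<beta> + 3) powr ((\<beta> + 3) / 2) * exp (- ((\<beta> + 3) / 2)) / (\<beta> * r0 powr (\<beta> + 1))) * (lam / (1 - lam)) * (r' powr \<beta> - r powr \<beta>)"
proof -
  define C where "C = (\<beta> + 3) powr ((\<beta> + 3) / 2) * exp (- ((\<beta> + 3) / 2))"
  have C: "0 \<le> C" by (simp add: C_def)
  define g where "g = (\<lambda>j r. gauss_term lam (- \<beta>) r j)"
  define \<epsilon> where "\<epsilon> = (\<lambda>j. C / (\<beta> * r0 powr (\<beta> + 1)) * lam ^ Suc j)"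
  have pos: "0 < r" "0 < r'" using r r0 by auto
  have termwise: "r powr \<beta> * g j r - r' powr \<beta> * g j r' \<le> \<epsilon> j * (r' powr \<beta> - r powr \<beta>)" for j
  proof -
    define l where "l = lam ^ Suc j"
    have l: "0 < l" using lam by (simp add: l_def)
    define L where "L = lam powr (- \<beta> * real (Suc j))"
    have L: "0 < L" "L = l powr (- \<beta>)"
      using lam unfolding L_def l_def by (simp, simp only: powr_realpow[symmetric] powr_powr mult.commute)
    have g_eq: "g j x = L * exp (- (x\<^sup>2 / (2 * l\<^sup>2)))" for x
    proof -
      have "l\<^sup>2 = lam ^ (2 * Suc j)" by (simp only: l_def power_mult[symmetric] mult.commute)
      then show ?thesis by (simp only: g_def L_def)
    qed
    have "(\<lambda>x. \<epsilon> j * x powr \<beta> + x powr \<beta> * g j x) r \<le> (\<lambda>x. \<epsilon> j * x powr \<beta> + x powr \<beta> * g j x) r'"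
    proof (rule DERIV_nonneg_imp_nondecreasing[OF r(2)])
      fix x assume "r \<le> x" "x \<le> r'"
      then have x: "0 < x" "r0 \<le> x" using r r0 by auto
      define u where "u = x / l"
      have u: "0 < u" using x l by (simp add: u_def)
      define e where "e = exp (- (x\<^sup>2 / (2 * l\<^sup>2)))"
      have e_u: "e = exp (- (u\<^sup>2 / 2))" by (simp add: e_def u_def power_divide)
      define D where "D = \<epsilon> j * (\<beta> * x powr (\<beta> - 1)) + (\<beta> * x powr (\<beta> - 1) * (L * e) + x powr \<beta> * (L * (e * (- (x / l\<^sup>2)))))"
      have "((\<lambda>x. \<epsilon> j * x powr \<beta> + x powr \<beta> * g j x) has_real_derivative D) (at x)"
        unfolding g_eq D_def e_def using x l
        by (auto intro!: derivative_eq_intros simp: powr_diff field_simps power2_eq_square)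
      moreover have "0 \<le> D"
      proof -
        have "u powr (\<beta> + 3) * e \<le> C"
          unfolding C_def e_u using \<beta> u by (intro powr_times_gaussian_le) auto
        moreover have "u powr (\<beta> + 3) = u powr (\<beta> + 2) * u" 
          using powr_add[of u "\<beta> + 2" 1] u by (simp add: add.commute add.left_commute)
        ultimately have "u powr (\<beta> + 2) * e \<le> C / u" using u by (simp add: pos_le_divide_eq mult_ac)
        also have "\<dots> = C * l / x" using x l by (simp add: u_def)
        also have "\<dots> \<le> C * l / r0" using x r0 C l by (intro divide_left_mono) auto
        finally have 1: "u powr (\<beta> + 2) * e \<le> C * l / r0" .
        have 2: "C * l / r0 = \<epsilon> j * \<beta> * r0 powr \<beta>"
          using \<beta> r0 by (simp add: \<epsilon>_def l_def powr_add del: power_Suc)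
        have "\<epsilon> j * \<beta> * r0 powr \<beta> \<le> \<epsilon> j * \<beta> * x powr \<beta>"
          using \<beta> C x r0 lam by (intro mult_left_mono powr_mono2) (auto simp: \<epsilon>_def)
        with 1 2 have "u powr (\<beta> + 2) * e \<le> \<epsilon> j * \<beta> * x powr \<beta>" by linarith
        moreover have "u powr (\<beta> + 2) = x powr \<beta> * L * (x / l\<^sup>2) * x"
          using u x l by (simp add: u_def powr_add powr_divide L(2) powr_minus power2_eq_square field_simps)
        ultimately have "x * (x powr \<beta> * L * e * (x / l\<^sup>2)) \<le> x * (\<epsilon> j * \<beta> * x powr (\<beta> - 1))"
          using x by (simp add: powr_diff mult_ac)
        then have "x powr \<beta> * L * e * (x / l\<^sup>2) \<le> \<epsilon> j * \<beta> * x powr (\<beta> - 1)"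
          using x(1) by (rule mult_left_le_imp_le)
        moreover have "0 \<le> \<beta> * x powr (\<beta> - 1) * (L * e)" using \<beta> L by (simp add: e_def)
        ultimately show ?thesis by (simp add: D_def mult_ac)
      qed
      ultimately show "\<exists>y. ((\<lambda>x. \<epsilon> j * x powr \<beta> + x powr \<beta> * g j x) has_real_derivative y) (at x) \<and> 0 \<le> y" by blast
    qed
    then show ?thesis by (simp add: algebra_simps)
  qed
  have summ: "summable (\<lambda>j. g j x)" if "0 < x" for x unfolding g_def by (rule gauss_series_summable[OF lam that])
  have \<epsilon>_sums: "\<epsilon> sums (C / (\<beta> * r0 powr (\<beta> + 1)) * (lam / (1 - lam)))"
  proof -
    have "(\<lambda>j. lam * lam ^ j) sums (lam * (1 / (1 - lam)))" using lam by (intro sums_mult geometric_sums) auto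
    then show ?thesis unfolding \<epsilon>_def by (intro sums_mult) simp
  qed
  have gs: "(\<lambda>j. x powr \<beta> * g j x) sums (x powr \<beta> * gauss_series lam (- \<beta>) x)" if "0 < x" for x
    using sums_mult[OF summable_sums[OF summ[OF that]], of "x powr \<beta>"] by (simp add: g_def gauss_series_def)
  have "r powr \<beta> * gauss_series lam (- \<beta>) r - r' powr \<beta> * gauss_series lam (- \<beta>) r' \<le>
      (C / (\<beta> * r0 powr (\<beta> + 1)) * (lam / (1 - lam))) * (r' powr \<beta> - r powr \<beta>)"
    using termwise by (rule sums_le[OF _ sums_diff[OF gs[OF pos(1)] gs[OF pos(2)]] sums_mult2[OF \<epsilon>_sums]])
  then show ?thesis by (simp add: C_def)
qed

text \<open>
  The sign changes at the supremum of the points where \<open>D\<close> is negative; strict monotonicity takes the place of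
  continuity.
\<close>

lemma sign_change_of_eventually_increasing:
  fixes D :: "real \<Rightarrow> real"
  assumes r0: "0 < r0" and neg: "\<And>r. 0 < r \<Longrightarrow> r \<le> r0 \<Longrightarrow> D r < 0"
    and mono: "\<And>r r'. r0 \<le> r \<Longrightarrow> r < r' \<Longrightarrow> D r < D r'" and large: "0 \<le> D r1" "r0 \<le> r1"
  shows "\<exists>\<rho>>0. (\<forall>r. 0 < r \<and> r < \<rho> \<longrightarrow> D r < 0) \<and> (\<forall>r. \<rho> < r \<longrightarrow> 0 < D r)"
proof -
  define S where "S = {r. r0 \<le> r \<and> D r < 0}"
  have S: "r0 \<in> S" using neg[of r0] r0 by (simp add: S_def)
  have bdd: "bdd_above S"
  proof (rule bdd_aboveI)
    fix r assume "r \<in> S"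
    then show "r \<le> r1" using mono[of r1 r] large by (force simp: S_def not_le[symmetric])
  qed
  show ?thesis
  proof (intro exI[of _ "Sup S"] conjI allI impI)
    show "0 < Sup S" using cSup_upper[OF S bdd] r0 by linarith
    fix r
    show "D r < 0" if r: "0 < r \<and> r < Sup S"
    proof (cases "r \<le> r0")
      case False
      obtain r2 where "r2 \<in> S" "r < r2" using r less_cSupD[of S r] S by blast
      then show ?thesis using mono[of r r2] False by (auto simp: S_def)
    qed (use neg r in auto)
    show "0 < D r" if "Sup S < r"
    proof -
      define m where "m = (Sup S + r) / 2"
      have m: "Sup S < m" "m < r" using that by (auto simp: m_def)
      have "r0 \<le> m" using cSup_upper[OF S bdd] m by linarith
      moreover have "m \<notin> S" using cSup_upper[OF _ bdd, of m] m by auto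
      ultimately show ?thesis using mono[of m r] m by (auto simp: S_def not_less)
    qed
  qed
qed

text \<open>
  With \<open>4 g\<close> the gap between \<open>C\<close> and \<open>cW max h\<close> and \<open>r0\<^sup>\<beta> = g\<close>, choose \<open>lam\<close> so small that the error of the peak bound
  contributes at most \<open>g\<close> and the total decrease of the sum beyond \<open>r0\<close> is less than the increase of \<open>r\<^sup>\<beta>\<close>.
\<close>

lemma reduced_slope_sign_change:
  assumes \<alpha>: "0 < \<alpha>" "\<alpha> < real d + 2" and cW: "0 < cW" "cW < C_upper d \<alpha>"
  shows "\<exists>lam0>0. \<forall>lam. 0 < lam \<and> lam < 1 \<and> lam < lam0 \<longrightarrow>
    (\<exists>\<rho>>0. (\<forall>r. 0 < r \<and> r < \<rho> \<longrightarrow> reduced_slope d \<alpha> lam cW r < 0) \<and> (\<forall>r. \<rho> < r \<longrightarrow> 0 < reduced_slope d \<alpha> lam cW r))"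
proof -
  define \<beta> where "\<beta> = real d + 2 - \<alpha>"
  have \<beta>: "0 < \<beta>" using \<alpha> by (simp add: \<beta>_def)
  define M where "M = \<beta> powr (\<beta> / 2) * exp (- (\<beta> / 2))"
  define Cm where "Cm = riesz_const_mult d \<alpha>"
  have gap: "cW * M < Cm"
  proof -
    have "(exp 1 / \<beta>) powr (\<beta> / 2) * M = 1"
    proof -
      have "exp 1 powr (\<beta> / 2) = exp (\<beta> / 2)" by (simp add: powr_def)
      then show ?thesis using \<beta> by (simp add: M_def powr_divide exp_minus)
    qed
    then have "C_upper d \<alpha> * M = Cm" by (simp add: C_upper_def \<beta>_def[symmetric] Cm_def mult_ac)
    moreover have "cW * M < C_upper d \<alpha> * M" using cW \<beta> by (intro mult_strict_right_mono) (auto simp: M_def)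
    ultimately show ?thesis by simp
  qed
  define g where "g = (Cm - cW * M) / 4"
  have g: "0 < g" using gap by (simp add: g_def)
  define r0 where "r0 = g powr (1 / \<beta>)"
  have r0: "0 < r0" "r0 powr \<beta> = g" using g \<beta> by (auto simp: r0_def powr_powr)
  define K where "K = 1 + (2 * \<beta>) powr \<beta> * exp (- \<beta>)"
  define B where "B = (\<beta> + 3) powr ((\<beta> + 3) / 2) * exp (- ((\<beta> + 3) / 2)) / (\<beta> * r0 powr (\<beta> + 1))"
  have "((\<lambda>lam. cW * (K * (sqrt (lam powr \<beta>) / (1 - lam powr \<beta>)))) \<longlongrightarrow> 0) (at_right 0)"
    using \<beta> by real_asymp
  then have "eventually (\<lambda>lam. cW * (K * (sqrt (lam powr \<beta>) / (1 - lam powr \<beta>))) < g) (at_right 0)"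
    using g by (rule order_tendstoD(2))
  moreover have "((\<lambda>lam. cW * (B * (lam / (1 - lam)))) \<longlongrightarrow> 0) (at_right 0)"
    by real_asymp
  then have "eventually (\<lambda>lam. cW * (B * (lam / (1 - lam))) < 1) (at_right 0)"
    by (rule order_tendstoD(2)) simp
  ultimately have "eventually (\<lambda>lam. cW * (K * (sqrt (lam powr \<beta>) / (1 - lam powr \<beta>))) < g \<and> cW * (B * (lam / (1 - lam))) < 1) (at_right 0)"
    by eventually_elim simp
  then obtain lam0 where lam0: "0 < lam0" and small:
    "\<And>lam. 0 < lam \<Longrightarrow> lam < lam0 \<Longrightarrow> cW * (K * (sqrt (lam powr \<beta>) / (1 - lam powr \<beta>))) < g \<and> cW * (B * (lam / (1 - lam))) < 1"
    unfolding eventually_at_right_field by auto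
  show ?thesis
  proof (rule exI[of _ lam0], intro conjI allI impI lam0)
    fix lam :: real assume "0 < lam \<and> lam < 1 \<and> lam < lam0"
    then have lam: "0 < lam" "lam < 1" and "lam < lam0" by auto
    have s: "cW * (K * (sqrt (lam powr \<beta>) / (1 - lam powr \<beta>))) < g" "cW * (B * (lam / (1 - lam))) < 1"
      using small[OF lam(1) \<open>lam < lam0\<close>] by blast+
    define H where "H = (\<lambda>r. r powr \<beta> * gauss_series lam (- \<beta>) r)"
    have D: "reduced_slope d \<alpha> lam cW r = r powr \<beta> + cW * H r - Cm" for r
      by (simp add: reduced_slope_def \<beta>_def H_def Cm_def)
    show "\<exists>\<rho>>0. (\<forall>r. 0 < r \<and> r < \<rho> \<longrightarrow> reduced_slope d \<alpha> lam cW r < 0) \<and> (\<forall>r. \<rho> < r \<longrightarrow> 0 < reduced_slope d \<alpha> lam cW r)"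
    proof (rule sign_change_of_eventually_increasing[OF r0(1)])
      fix r :: real assume r: "0 < r" "r \<le> r0"
      have "r powr \<beta> \<le> g" using r \<beta> r0(2) powr_mono2[of \<beta> r r0] by simp
      moreover have "cW * H r \<le> cW * (M + K * (sqrt (lam powr \<beta>) / (1 - lam powr \<beta>)))"
        using gauss_series_peak_bound[OF lam \<beta> r(1)] cW(1) by (intro mult_left_mono) (auto simp: H_def M_def K_def)
      then have "cW * H r \<le> cW * M + g" using s(1) by (simp add: distrib_left)
      moreover have "4 * g = Cm - cW * M" by (simp add: g_def)
      ultimately show "reduced_slope d \<alpha> lam cW r < 0" using g unfolding D by linarith
    next
      fix r r' :: real assume r: "r0 \<le> r" "r < r'"
      have lt: "r powr \<beta> < r' powr \<beta>" using r r0(1) \<beta> by (intro powr_less_mono2) auto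
      have "H r - H r' \<le> (B * (lam / (1 - lam))) * (r' powr \<beta> - r powr \<beta>)"
        using gauss_series_decrease_bound[OF lam \<beta> r0(1) r(1), of r'] r(2) by (simp add: H_def B_def)
      then have "cW * (H r - H r') \<le> cW * ((B * (lam / (1 - lam))) * (r' powr \<beta> - r powr \<beta>))"
        using cW(1) by (intro mult_left_mono) auto
      also have "\<dots> = (cW * (B * (lam / (1 - lam)))) * (r' powr \<beta> - r powr \<beta>)" by (simp only: mult.assoc)
      also have "\<dots> < 1 * (r' powr \<beta> - r powr \<beta>)" using s(2) lt by (intro mult_strict_right_mono) auto
      finally show "reduced_slope d \<alpha> lam cW r < reduced_slope d \<alpha> lam cW r'"
        unfolding D by (simp add: right_diff_distrib)
    next
      define r1 where "r1 = max r0 (\<bar>Cm\<bar> powr (1 / \<beta>))"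
      show "r0 \<le> r1" by (simp add: r1_def)
      have "Cm \<le> (\<bar>Cm\<bar> powr (1 / \<beta>)) powr \<beta>" using \<beta> by (simp add: powr_powr)
      also have "\<dots> \<le> r1 powr \<beta>" using \<beta> by (intro powr_mono2) (auto simp: r1_def)
      finally have "Cm \<le> r1 powr \<beta>" .
      moreover have "0 < r1" using r0(1) by (simp add: r1_def less_max_iff_disj)
      then have "0 \<le> cW * H r1" using cW(1) gauss_series_nonneg[OF lam] by (simp add: H_def)
      ultimately show "0 \<le> reduced_slope d \<alpha> lam cW r1" unfolding D by linarith
    qed
  qed
qed

theorem theorem8p1:
  fixes \<alpha> cW :: real
  assumes alpha: "(DIM('a::euclidean_space) \<ge> 2 \<and> 0 < \<alpha> \<and> \<alpha> < real DIM('a) + 2) \<or>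
                  (DIM('a) = 1 \<and> \<alpha> \<in> {0<..1} \<union> {2..<3})"
    and cW: "0 < cW"
  shows
    "(c_lower DIM('a) \<alpha> < cW \<longrightarrow>
       (\<forall>lam. 0 < lam \<and> lam < 1 \<longrightarrow>
         (\<exists>c1>0. \<exists>C1>0. \<exists>What :: 'a \<Rightarrow> real.
            (\<forall>r. 1 \<le> r \<or> (real DIM('a) < \<alpha> \<and> 0 < r) \<longrightarrow>
               W_radial DIM('a) \<alpha> lam cW r \<le> C1 * (1 + r)\<^sup>2) \<and>
            (tempered_function (W_potential \<alpha> lam cW :: 'a \<Rightarrow> real) \<and>
             continuous_on (UNIV - {0}) What \<and>
             (\<forall>K. compact K \<and> K \<subseteq> UNIV - {0} \<longrightarrow>
                is_function_on (fourier_dist (function_dist (W_potential \<alpha> lam cW))) What K)) \<and>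
            (\<forall>R\<ge>1. \<exists>J :: real set. is_interval J \<and> J \<subseteq> {0<..} \<and> measure lborel J = R \<and>
               (\<forall>\<xi>. norm \<xi> \<in> J \<longrightarrow> What \<xi> < - c1 * R powr (- \<alpha>)))) \<and>
         infinitesimal_concave (W_potential \<alpha> lam cW :: 'a \<Rightarrow> real))) \<and>
     (cW < C_upper DIM('a) \<alpha> \<longrightarrow>
       (\<exists>lam0>0. \<forall>lam. 0 < lam \<and> lam < 1 \<and> lam < lam0 \<longrightarrow>
         (\<exists>RW>0.
            (\<forall>r. 0 < r \<and> r < RW \<longrightarrow>
               W_radial DIM('a) \<alpha> lam cW differentiable (at r) \<and>
               deriv (W_radial DIM('a) \<alpha> lam cW) r < 0) \<and>
            (\<forall>r. RW < r \<longrightarrow>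
               W_radial DIM('a) \<alpha> lam cW differentiable (at r) \<and>
               deriv (W_radial DIM('a) \<alpha> lam cW) r > 0))))"
proof -
  have \<alpha>: "0 < \<alpha>" "\<alpha> < real DIM('a) + 2" using alpha by auto
  show ?thesis
  proof (intro conjI impI allI, goal_cases)
    case (1 lam)
    then have c: "c_lower DIM('a) \<alpha> < cW" and lam: "0 < lam" "lam < 1" by auto
    obtain C1 where C1: "0 < C1" "\<And>r. 1 \<le> r \<or> (real DIM('a) < \<alpha> \<and> 0 < r) \<Longrightarrow> W_radial DIM('a) \<alpha> lam cW r \<le> C1 * (1 + r)\<^sup>2"
      using W_radial_quadratic_bound[OF lam cW, of "DIM('a)" \<alpha>] \<alpha>(2) by blast
    obtain c1 where c1: "0 < c1" "\<And>R. 1 \<le> R \<Longrightarrow> \<exists>J. is_interval J \<and> J \<subseteq> {0<..} \<and> measure lborel J = R \<and>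
        (\<forall>\<xi>::'a. norm \<xi> \<in> J \<longrightarrow> W_hat \<alpha> lam cW \<xi> < - c1 * R powr (- \<alpha>))"
      using W_hat_negative_on_intervals[OF lam \<alpha>(1) cW c] by blast
    show ?case
      using C1 c1 tempered_function_W_potential[OF lam \<alpha>] continuous_on_W_hat[OF lam \<alpha>(1)] is_function_on_W_hat[OF lam \<alpha>]
      by (intro exI[of _ c1] exI[of _ C1] exI[of _ "W_hat \<alpha> lam cW"] conjI allI impI) auto
  next
    case (2 lam)
    then show ?case using infinitesimal_concave_W_potential[OF _ _ \<alpha> cW] by blast
  next
    case 3
    then obtain lam0 where lam0: "0 < lam0" and sign: "\<And>lam. 0 < lam \<Longrightarrow> lam < 1 \<Longrightarrow> lam < lam0 \<Longrightarrow>
      \<exists>\<rho>>0. (\<forall>r. 0 < r \<and> r < \<rho> \<longrightarrow> reduced_slope DIM('a) \<alpha> lam cW r < 0) \<and> (\<forall>r. \<rho> < r \<longrightarrow> 0 < reduced_slope DIM('a) \<alpha> lam cW r)"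
      using reduced_slope_sign_change[OF \<alpha> cW] by blast
    show ?case
    proof (rule exI[of _ lam0], intro conjI allI impI lam0, goal_cases)
      case (1 lam)
      then have lam: "0 < lam" "lam < 1" and "lam < lam0" by auto
      obtain \<rho> where \<rho>: "0 < \<rho>" "\<And>r. 0 < r \<Longrightarrow> r < \<rho> \<Longrightarrow> reduced_slope DIM('a) \<alpha> lam cW r < 0"
         "\<And>r. \<rho> < r \<Longrightarrow> 0 < reduced_slope DIM('a) \<alpha> lam cW r"
        using sign[OF lam \<open>lam < lam0\<close>] by blast
      have diff: "W_radial DIM('a) \<alpha> lam cW differentiable (at r)"
        and deriv: "deriv (W_radial DIM('a) \<alpha> lam cW) r = r powr (\<alpha> - real DIM('a) - 1) * reduced_slope DIM('a) \<alpha> lam cW r"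
        if "0 < r" for r
        using W_radial_has_derivative[OF lam \<alpha>(2) that, of cW] DERIV_imp_deriv by (auto simp: real_differentiable_def)
      show ?case
        using \<rho> diff deriv by (intro exI[of _ \<rho>]) (auto intro!: mult_pos_neg mult_pos_pos)
    qed
  qed
qed

end
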